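(* Let $\mathbb{P}=\{\pm p : p \text{ a prime number}\}\subseteq \mathbb{Z}\subseteq\mathbb{R}$ be the set of positive and negative primes. Let $(A_n)_n=([a_n,b_n])_n$ be a van Hove sequence of intervals in $\mathbb{R}$ (i.e. $a_n<b_n$ and $b_n-a_n\to\infty$). Assume that there exists a constant $d>0$ such that $|a_n|<d(b_n-a_n)$ for all $n$. Then, with respect to $(A_n)_n$, the counting autocorrelation of $\mathbb{P}$ exists and equals $\gamma_{\mathrm{count}}=\delta_0$, and the counting diffraction is $\widehat{\gamma_{\mathrm{count}}}=\lambda$, the Lebesgue measure on $\mathbb{R}$.
   Context: For a finite set $F\subseteq\mathbb{R}$ put $\gamma_F=\frac{1}{\mathrm{card}(F)}\sum_{x,y\in F}\delta_{x-y}$ if $F\neq\emptyset$ and $\gamma_\emptyset=0$. For a locally finite point set $\varLambda\subseteq\mathbb{R}$ and a sequence $(A_n)_n$ of compact sets, let $F_n=\varLambda\cap A_n$. The counting autocorrelation of $\varLambda$ with respect to $(A_n)_n$ exists if $\gamma_{F_n}$ converges in the vague topology (i.e. $\gamma_{F_n}(f)\to\gamma_{\mathrm{count}}(f)$ for all compactly supported continuous $f$) to a measure $\gamma_{\mathrm{count}}$; this limit is positive definite and its Fourier transform $\widehat{\gamma_{\mathrm{count}}}$ is called the counting diffraction. A sequence of intervals $([a_n,b_n])_n$ is a van Hove sequence iff $b_n-a_n\to\infty$. *)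

theory Defs
  imports "HOL-Analysis.Analysis" "HOL-Probability.Giry_Monad" "HOL-Computational_Algebra.Primes"
begin

definition pm_primes :: "real set" where
  "pm_primes = {x. \<exists>p::nat. prime p \<and> (x = real p \<or> x = - real p)}"

definition Cc :: "(real \<Rightarrow> complex) set" where
  "Cc = {f. continuous_on UNIV f \<and> (\<exists>K. compact K \<and> (\<forall>x. x \<notin> K \<longrightarrow> f x = 0))}"

definition gamma_fin :: "real set \<Rightarrow> (real \<Rightarrow> complex) \<Rightarrow> complex" where
  "gamma_fin F f = (if F = {} then 0
      else (1 / of_nat (card F)) * (\<Sum>(x,y)\<in>F \<times> F. f (x - y)))"

definition locally_finite_borel :: "real measure \<Rightarrow> bool" where
  "locally_finite_borel \<mu> \<longleftrightarrow> sets \<mu> = sets borel \<and>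
     (\<forall>K. compact K \<longrightarrow> emeasure \<mu> K < \<infinity>)"

definition counting_autocorrelation ::
    "real set \<Rightarrow> (nat \<Rightarrow> real set) \<Rightarrow> real measure \<Rightarrow> bool" where
  "counting_autocorrelation \<Lambda> A \<gamma> \<longleftrightarrow> locally_finite_borel \<gamma> \<and>
     (\<forall>f\<in>Cc. (\<lambda>n. gamma_fin (\<Lambda> \<inter> A n) f) \<longlonglongrightarrow> (LINT x|\<gamma>. f x))"

definition inv_fourier :: "(real \<Rightarrow> complex) \<Rightarrow> real \<Rightarrow> complex" where
  "inv_fourier g \<xi> = (LINT x|lborel. g x * cis (2 * pi * x * \<xi>))"

text \<open>g * g~ where g~(x) = cnj (g (-x)): (g * g~)(x) = int g(x+t) cnj(g t) dt.\<close>
definition conv_tilde :: "(real \<Rightarrow> complex) \<Rightarrow> real \<Rightarrow> complex" where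
  "conv_tilde g x = (LINT t|lborel. g (x + t) * cnj (g t))"

text \<open>Fourier transform of a positive definite measure gamma (Berg--Forst / Baake--Grimm):
  the unique positive locally finite measure mu with
  int |g-check|^2 d mu = gamma(g * g~) for all g in C_c.\<close>
definition is_fourier_transform :: "real measure \<Rightarrow> real measure \<Rightarrow> bool" where
  "is_fourier_transform \<gamma> \<mu> \<longleftrightarrow> locally_finite_borel \<mu> \<and>
     (\<forall>g\<in>Cc. integrable \<mu> (\<lambda>\<xi>. (cmod (inv_fourier g \<xi>))\<^sup>2) \<and>
        complex_of_real (LINT \<xi>|\<mu>. (cmod (inv_fourier g \<xi>))\<^sup>2)
          = (LINT x|\<gamma>. conv_tilde g x))"

end

theory Submission
  imports Defs "HOL-Complex_Analysis.Complex_Analysis" "HOL-Number_Theory.Prime_Powers" "HOL-Number_Theory.Cong"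
    "HOL-Probability.Characteristic_Functions" "HOL-Real_Asymp.Real_Asymp"
begin

text \<open>The off-diagonal part of \<open>\<gamma>\<^sub>F(f)\<close> is controlled, for each of the finitely many shifts
  \<open>h \<noteq> 0\<close> within the support of \<open>f\<close>, by the number of pairs \<open>k, k + h\<close> of primes (up to sign) in an
  interval of length \<open>L = b\<^sub>n - a\<^sub>n\<close>. Brun's pure sieve makes this \<open>o(L / log L)\<close>, uniformly in the
  position of the interval. On the other hand, \<open>|a\<^sub>n| < d L\<close> and the prime number theorem give at
  least \<open>c L / log L\<close> primes in the interval: for large \<open>d\<close> a Chebyshev bound would not suffice,
  since the interval may be short compared with its distance from \<open>0\<close>. So only the diagonal
  \<open>f(0)\<close> survives. The prime number theorem is obtained by Newman's method, applied
  to \<open>\<integral> (\<psi>(u) - u) u\<^sup>-\<^sup>2 du\<close>. The statement on the diffraction is Plancherel's identity for \<open>C\<^sub>c\<close>,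
  obtained by Gaussian regularisation and monotone convergence.\<close>

section \<open>Newman's Tauberian theorem\<close>

text \<open>The sieve has only to beat \<open>L / ln L\<close>, so its crudest form will do: sifting
  by the primes up to \<open>2 ^ J\<close> bounds the pairs by a multiple of
  \<open>L / J ^ 2\<close> plus an error of order \<open>2 ^ (J * r)\<close> with
  \<open>r = O(ln J)\<close>. The choice of \<open>J\<close> near \<open>ln L powr (3/4)\<close>
  suits both terms: an exponent above 1/2 makes \<open>1 / J ^ 2\<close> negligible against
  \<open>1 / ln L\<close>, and one below 1 keeps the error at \<open>L\<close> to an exponent
  tending to 0. Only the length of the interval enters here. Its distance from 0 matters for the
  lower bound: \<open>\<psi>\<close> must be known at arguments up to \<open>(d + 1) * L\<close>
  with an error below a fixed fraction of \<open>L\<close>, so the admissible relative error shrinks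
  as \<open>d\<close> grows. The analytic part works with \<open>(s - 1) * \<zeta>(s)\<close>, which
  has no pole to be avoided and equals 1 at \<open>s = 1\<close>. Whether it vanishes at
  \<open>s\<close> is read off from the limit of \<open>e * f'(s + e) / f(s + e)\<close> for
  \<open>e\<close> tending to 0 from the right, which is the order of the zero; this settles the
  region \<open>Re s > 1\<close> as well, in place of an Euler product.\<close>

lemma newman_kernel_on_circle:
  fixes w :: complex
  assumes "cmod w = R" "R > 0"
  shows "1 / w + w / of_real (R^2) = of_real (2 * Re w / R^2)"
proof -
  have "w \<noteq> 0" using assms by auto
  have "w * cnj w = of_real (R^2)"
    using assms complex_norm_square[of w] by simp
  then have "1 / w = cnj w / of_real (R^2)"
    using \<open>w \<noteq> 0\<close> assms by (simp add: field_simps)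
  then have "1 / w + w / of_real (R^2) = (w + cnj w) / of_real (R^2)"
    by (simp add: add_divide_distrib)
  also have "w + cnj w = of_real (2 * Re w)"
    by (rule complex_add_cnj)
  finally show ?thesis by simp
qed

text \<open>Needed for the constant \<open>F 0\<close> on the left arc: there the kernel carries the
  factor \<open>- Re w * exp (L * Re w)\<close>, which is \<open>O(1 / L)\<close> uniformly in
  \<open>w\<close>.\<close>

lemma mult_exp_neg_le:
  fixes x L :: real
  assumes "L > 0"
  shows "x * exp (- (L * x)) \<le> 1 / L"
proof -
  have "L * x \<le> exp (L * x)" using exp_ge_add_one_self[of "L * x"] by linarith
  then have "L * x * exp (- (L * x)) \<le> 1"
    by (simp add: exp_minus field_simps)
  then show ?thesis using assms by (simp add: field_simps)
qed

text \<open>The imaginary axis between the heights \<open>- R\<close> and \<open>R\<close> is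
  compact and lies in \<open>U\<close>, so one width \<open>\<delta>\<close> serves all of it; along
  the whole axis \<open>U\<close> may become arbitrarily thin.\<close>

lemma open_superset_halfplane_strip:
  assumes "open U" "{w. Re w \<ge> 0} \<subseteq> U" "(R::real) > 0"
  obtains \<delta> where "\<delta> > 0" "{w. Re w > - \<delta> \<and> \<bar>Im w\<bar> \<le> R} \<subseteq> U"
proof -
  have "compact (closed_segment (- \<i> * R) (\<i> * R))" by simp
  moreover have "closed_segment (- \<i> * R) (\<i> * R) \<subseteq> U"
    using assms(2) by (force simp: closed_segment_def)
  ultimately obtain e where e: "e > 0" "(\<Union>x\<in>closed_segment (- \<i> * R) (\<i> * R). ball x e) \<subseteq> U"
    using compact_subset_open_imp_ball_epsilon_subset[OF _ assms(1)] by metis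
  have "w \<in> U" if w: "Re w > - e" "\<bar>Im w\<bar> \<le> R" for w
  proof (cases "Re w \<ge> 0")
    case False
    define y where "y = \<i> * of_real (Im w)"
    have "y = (1 - (Im w + R) / (2 * R)) *\<^sub>R (- \<i> * R) + ((Im w + R) / (2 * R)) *\<^sub>R (\<i> * R)"
      using assms(3) by (auto simp: y_def complex_eq_iff field_simps)
    then have "y \<in> closed_segment (- \<i> * R) (\<i> * R)"
      using w assms(3) unfolding closed_segment_def
      by (intro CollectI exI[of _ "(Im w + R) / (2 * R)"]) (auto simp: field_simps)
    moreover have "y - w = of_real (- Re w)"
      by (auto simp: y_def complex_eq_iff)
    then have "dist y w = \<bar>Re w\<bar>"
      by (simp add: dist_norm)
    then have "w \<in> ball y e" using w False by simp
    ultimately show ?thesis using e(2) by blast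
  qed (use assms in auto)
  with that e(1) show ?thesis by blast
qed

text \<open>\<open>circlepath\<close> starts at angle 0, in the middle of the right half. That half
  is cut there, and its lower quarter is moved to the end of the circle.\<close>

lemma has_contour_integral_circle_split:
  assumes f: "continuous_on (path_image (part_circlepath c r (-(pi/2)) (pi/2))) f" and r: "r > 0"
    and I: "(f has_contour_integral I) (part_circlepath c r (-(pi/2)) (pi/2))"
    and J: "(f has_contour_integral J) (part_circlepath c r (pi/2) (3*pi/2))"
  shows "(f has_contour_integral (I + J)) (circlepath c r)"
proof -
  have shift: "part_circlepath c r (-(pi/2)) 0 = part_circlepath c r (3*pi/2) (2*pi)"
  proof
    fix x
    have "linepath (a + d) (b + d) x = linepath a b x + d" for a b d :: real
      by (simp add: linepath_def algebra_simps)
    from this[of "-(pi/2)" "2 * pi" 0]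
    have "linepath (3*pi/2) (2*pi) x = linepath (-(pi/2)) 0 x + 2 * pi"
      by simp
    then have "\<i> * of_real (linepath (3*pi/2) (2*pi) x) = \<i> * of_real (linepath (-(pi/2)) 0 x) + of_real (2 * pi) * \<i>"
      by (simp add: distrib_left)
    then show "part_circlepath c r (-(pi/2)) 0 x = part_circlepath c r (3*pi/2) (2*pi) x"
      unfolding part_circlepath_def by (simp add: exp_add)
  qed
  let ?g = "\<lambda>t. f (c + of_real r * cis t) * of_real r * \<i> * cis t"
  have iff: "(f has_contour_integral A) (part_circlepath c r s t) \<longleftrightarrow> (?g has_integral A) {s..t}" if "s < t" for A s t
    using that by (rule has_contour_integral_part_circlepath_iff)
  have gI: "(?g has_integral I) {-(pi/2)..pi/2}" and gJ: "(?g has_integral J) {pi/2..3*pi/2}"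
    using I J by (simp_all add: iff)
  have "?g integrable_on {-(pi/2)..0}" "?g integrable_on {0..pi/2}"
    by (rule integrable_subinterval_real[of ?g "-(pi/2)" "pi/2"], use gI in \<open>auto simp: has_integral_integrable\<close>)+
  then obtain A B where A: "(?g has_integral A) {-(pi/2)..0}" and B: "(?g has_integral B) {0..pi/2}"
    by (auto simp: integrable_on_def)
  have "(?g has_integral (A + B)) {-(pi/2)..pi/2}"
    by (rule has_integral_combine[OF _ _ A B]) auto
  then have "I = A + B" using gI has_integral_unique by blast
  have "(f has_contour_integral A) (part_circlepath c r (3*pi/2) (2*pi))"
    using A iff[of "-(pi/2)" 0 A] by (simp add: shift)
  then have A': "(?g has_integral A) {3*pi/2..2*pi}" by (simp add: iff)
  have "(?g has_integral (B + J)) {0..3*pi/2}"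
    by (rule has_integral_combine[OF _ _ B gJ]) auto
  then have "(?g has_integral (B + J + A)) {0..2*pi}"
    by (rule has_integral_combine[rotated 2, OF _ A']) auto
  then show ?thesis
    using \<open>I = A + B\<close> iff[of 0 "2*pi" "B + J + A"] by (simp add: circlepath_def algebra_simps)
qed

text \<open>Newman's contour argument at a fixed radius: \<open>S - F\<close> is integrated over the right half
  of the circle and \<open>S\<close> over the left half, while the remaining integral of \<open>F\<close> over
  the right half is moved to the vertical diameter and is \<open>O(1 / L)\<close> by partial integration.\<close>

lemma newman_fixed_radius:
  fixes F :: "complex \<Rightarrow> complex"
  assumes U: "open U" "{w. Re w \<ge> 0} \<subseteq> U" and F: "F holomorphic_on U" and R: "R > 0"
  obtains M where "\<And>S L C. \<lbrakk>S holomorphic_on UNIV; L > 0; C \<ge> 0;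
      \<And>w. Re w \<ge> 0 \<Longrightarrow> Re w * cmod (F w - S w) \<le> C * exp (- L * Re w);
      \<And>w. Re w \<le> 0 \<Longrightarrow> - Re w * cmod (S w) \<le> C * exp (- L * Re w)\<rbrakk>
      \<Longrightarrow> cmod (S 0 - F 0) \<le> 2 * C / R + M / L"
proof -
  obtain \<delta> where \<delta>: "\<delta> > 0" "{w. Re w > - \<delta> \<and> \<bar>Im w\<bar> \<le> R + 1} \<subseteq> U"
    using open_superset_halfplane_strip[OF U, of "R + 1"] R by auto
  define V where "V = {w. Re w > - \<delta> \<and> \<bar>Im w\<bar> < R + 1}"
  have V_eq: "V = {w. Re w > - \<delta>} \<inter> {w. Im w < R + 1} \<inter> {w. Im w > - (R + 1)}"
    by (auto simp: V_def)
  have V: "open V" "convex V"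
    unfolding V_eq by (intro open_Int convex_Int open_halfspace_Re_gt open_halfspace_Im_lt
      open_halfspace_Im_gt convex_halfspace_Re_gt convex_halfspace_Im_lt convex_halfspace_Im_gt)+
  have "V \<subseteq> U" using \<delta>(2) by (auto simp: V_def)
  have FV: "F holomorphic_on V" using F \<open>V \<subseteq> U\<close> holomorphic_on_subset by blast
  have "0 \<in> V" using \<delta> R by (auto simp: V_def)
  \<comment> \<open>Subtracting \<open>F 0\<close> turns the pole of the kernel at 0 into a
    removable singularity, so the right arc can be moved to the diameter through 0 without an
    indentation.\<close>
  define F1 where "F1 = (\<lambda>w. if w = 0 then deriv F 0 else (F w - F 0) / (w - 0))"
  have "((\<lambda>w. F w - F 0) has_field_derivative deriv F 0) (at 0)"
    using DERIV_diff[OF holomorphic_derivI[OF FV V(1) \<open>0 \<in> V\<close>] DERIV_const] by simp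
  then have dF: "deriv (\<lambda>w. F w - F 0) 0 = deriv F 0"
    by (rule DERIV_imp_deriv)
  have F1: "F1 holomorphic_on V"
  proof (rule pole_theorem_open_0)
    show "(\<lambda>w. F w - F 0) holomorphic_on V" by (intro holomorphic_on_diff FV) auto
    show "F z - F 0 = (z - 0) * F1 z" if "z \<in> V - {0}" for z
      using that by (simp add: F1_def)
    show "F1 0 = deriv (\<lambda>w. F w - F 0) 0" by (simp add: F1_def dF)
  qed (use V in auto)
  define Q where "Q = (\<lambda>w. (1 + w\<^sup>2 / of_real (R^2)) * F1 w)"
  have Q: "Q holomorphic_on V"
    unfolding Q_def using F1 R by (intro holomorphic_intros) auto
  have Q': "deriv Q holomorphic_on V" using Q V(1) by (rule holomorphic_deriv)
  let ?seg = "closed_segment (- \<i> * R) (\<i> * R)"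
  have segRe: "Re w = 0" "\<bar>Im w\<bar> \<le> R" if "w \<in> ?seg" for w
  proof -
    from that obtain u where u: "0 \<le> u" "u \<le> 1" "w = (1 - u) *\<^sub>R (- \<i> * R) + u *\<^sub>R (\<i> * R)"
      by (auto simp: closed_segment_def)
    show "Re w = 0" using u by simp
    have "Im w = (1 - u) * - R + u * R" using u(3) by simp
    also have "\<dots> = (2 * u - 1) * R" by (simp add: algebra_simps)
    finally have "Im w = (2 * u - 1) * R" .
    moreover have "\<bar>2 * u - 1\<bar> \<le> 1" using u by auto
    ultimately show "\<bar>Im w\<bar> \<le> R"
      using R by (simp add: abs_mult mult_left_le_one_le)
  qed
  have segV: "?seg \<subseteq> V"
    using segRe \<delta>(1) R by (force simp: V_def)
  have "compact (deriv Q ` ?seg)"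
    using Q' segV by (intro compact_continuous_image) (auto intro: holomorphic_on_imp_continuous_on holomorphic_on_subset)
  then obtain B where B: "B > 0" "\<And>w. w \<in> ?seg \<Longrightarrow> cmod (deriv Q w) \<le> B"
    by (metis bounded_pos compact_imp_bounded imageI)
  \<comment> \<open>The factor \<open>1 + w^2 / R^2\<close> vanishes at both ends of the diameter,
    so that partial integration leaves no boundary terms.\<close>
  have Qend: "Q (\<i> * R) = 0" "Q (- \<i> * R) = 0"
    using R by (auto simp: Q_def power_mult_distrib)
  \<comment> \<open>Everything of order \<open>1 / L\<close>: \<open>deriv Q\<close> along the
    diameter of length \<open>2 * R\<close>, and \<open>F 0\<close> on the left arc. It depends on
    \<open>F\<close> and \<open>R\<close> alone, which allows \<open>R\<close> to be fixed before
    \<open>L\<close> grows.\<close>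
  define M where "M = (2 * R * B + 2 * pi * cmod (F 0) / R) / (2 * pi)"
  show ?thesis
  proof (rule that[of M])
    fix S :: "complex \<Rightarrow> complex" and L C :: real
    assume S: "S holomorphic_on UNIV" and L: "L > 0" and C: "C \<ge> 0"
      and right: "\<And>w. Re w \<ge> 0 \<Longrightarrow> Re w * cmod (F w - S w) \<le> C * exp (- L * Re w)"
      and left: "\<And>w. Re w \<le> 0 \<Longrightarrow> - Re w * cmod (S w) \<le> C * exp (- L * Re w)"
    define E where "E = (\<lambda>w. exp (of_real L * w) :: complex)"
    have E: "E holomorphic_on A" for A unfolding E_def by (intro holomorphic_intros)
    have normE: "cmod (E w) = exp (L * Re w)" for w by (simp add: E_def)
    define K where "K = (\<lambda>w. E w * (1 / w + w / of_real (R^2)))"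
    \<comment> \<open>On the circle the kernel is proportional to \<open>Re w\<close>, and this
      supplies the factor \<open>Re w\<close> in the two hypotheses on \<open>S\<close>; the
      exponentials cancel.\<close>
    have normK: "cmod (K w) = exp (L * Re w) * (2 * \<bar>Re w\<bar> / R^2)" if "cmod w = R" for w
      unfolding K_def norm_mult normE newman_kernel_on_circle[OF that R] norm_of_real
      by (simp add: abs_mult)
    let ?ra = "part_circlepath 0 R (-(pi/2)) (pi/2)"
    let ?la = "part_circlepath 0 R (pi/2) (3*pi/2)"
    have arcR: "cmod w = R" if "w \<in> path_image (part_circlepath 0 R s t)" for w s t
      using path_image_part_circlepath_subset'[of R 0 s t] that R by auto
    have raRe: "Re w \<ge> 0" if "w \<in> path_image ?ra" for w
    proof -
      from that obtain x where x: "x \<in> {-(pi/2)..pi/2}" "w = of_real R * exp (\<i> * of_real x)"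
        by (subst (asm) path_image_part_circlepath) auto
      then show ?thesis using R by (auto simp: Re_exp intro!: mult_nonneg_nonneg cos_ge_zero)
    qed
    have laRe: "Re w \<le> 0" if "w \<in> path_image ?la" for w
    proof -
      from that obtain x where x: "x \<in> {pi/2..3*pi/2}" "w = of_real R * exp (\<i> * of_real x)"
        by (subst (asm) path_image_part_circlepath) auto
      then have "cos (x - pi) \<ge> 0" by (intro cos_ge_zero) auto
      then show ?thesis using R x by (auto simp: Re_exp cos_diff mult_le_0_iff)
    qed
    have nz: "w \<noteq> 0" if "w \<in> path_image (part_circlepath 0 R s t)" for w s t
      using arcR[OF that] R by auto
    have contK: "continuous_on (path_image (part_circlepath 0 R s t)) K" for s t
      unfolding K_def using nz R
      by (intro continuous_intros holomorphic_on_imp_continuous_on[OF E]) auto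
    have contS: "continuous_on A S" for A
      using S holomorphic_on_imp_continuous_on holomorphic_on_subset by blast
    have raV: "path_image ?ra \<subseteq> V"
    proof
      fix w assume w: "w \<in> path_image ?ra"
      have "\<bar>Im w\<bar> < R + 1" using abs_Im_le_cmod[of w] arcR[OF w] by linarith
      then show "w \<in> V" using raRe[OF w] \<delta>(1) by (simp add: V_def)
    qed
    have contF: "continuous_on (path_image ?ra) F"
      using FV raV holomorphic_on_imp_continuous_on holomorphic_on_subset by blast
    have EQ: "(\<lambda>w. E w * Q w) holomorphic_on V" using E Q by (intro holomorphic_intros)
    obtain P where P: "\<And>w. w \<in> V \<Longrightarrow> (P has_field_derivative E w * Q w) (at w within V)"
      using holomorphic_convex_primitive[of V "{}" "\<lambda>w. E w * Q w"] EQ V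
      by (metis Diff_empty finite.emptyI holomorphic_on_imp_continuous_on
          holomorphic_on_imp_differentiable_at interior_open)
    have st: "pathstart ?ra = - \<i> * R" "pathfinish ?ra = \<i> * R"
      by (simp_all only: pathstart_part_circlepath pathfinish_part_circlepath cis_conv_exp[symmetric])
        (auto simp: complex_eq_iff)
    have I1: "((\<lambda>w. E w * Q w) has_contour_integral (P (\<i> * R) - P (- \<i> * R))) ?ra"
      using contour_integral_primitive[OF P, of ?ra] raV by (simp only: st) auto
    have I2: "((\<lambda>w. E w * Q w) has_contour_integral (P (\<i> * R) - P (- \<i> * R))) (linepath (- \<i> * R) (\<i> * R))"
      using contour_integral_primitive[OF P, of "linepath (- \<i> * R) (\<i> * R)"] segV by simp
    have dP: "((\<lambda>w. E w * Q w / of_real L) has_field_derivative (E w * Q w + E w * deriv Q w / of_real L)) (at w within V)"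
      if "w \<in> V" for w
    proof -
      have "(Q has_field_derivative deriv Q w) (at w within V)"
        using Q V that by (meson has_field_derivative_at_within holomorphic_derivI)
      then show ?thesis unfolding E_def using L
        by (auto intro!: derivative_eq_intros simp: field_simps)
    qed
    \<comment> \<open>The derivative of \<open>E * Q / L\<close> integrates to 0 between zeros of
      \<open>Q\<close>; subtracting it replaces \<open>E * Q\<close> by
      \<open>- E * deriv Q / L\<close>.\<close>
    have "((\<lambda>w. E w * Q w + E w * deriv Q w / of_real L) has_contour_integral 0) (linepath (- \<i> * R) (\<i> * R))"
      using contour_integral_primitive[OF dP, of "linepath (- \<i> * R) (\<i> * R)"] segV Qend by simp
    from has_contour_integral_diff[OF I2 this]
    have I3: "((\<lambda>w. - (E w * deriv Q w / of_real L)) has_contour_integral (P (\<i> * R) - P (- \<i> * R))) (linepath (- \<i> * R) (\<i> * R))"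
      by simp
    have "cmod (P (\<i> * R) - P (- \<i> * R)) \<le> B / L * cmod (\<i> * R - (- \<i> * R))"
    proof (rule has_contour_integral_bound_linepath[OF I3])
      fix w assume w: "w \<in> ?seg"
      show "cmod (- (E w * deriv Q w / of_real L)) \<le> B / L"
        using B(2)[OF w] segRe[OF w] L by (simp add: norm_mult norm_divide normE divide_right_mono)
    qed (use B L in auto)
    also have "\<i> * R - (- \<i> * R) = \<i> * of_real (2 * R)" by simp
    also have "cmod \<dots> = 2 * R" using R by (simp only: norm_mult norm_of_real) simp
    finally have bound1: "cmod (P (\<i> * R) - P (- \<i> * R)) \<le> B / L * (2 * R)" .
    have I4: "((\<lambda>w. (F w - F 0) * K w) has_contour_integral (P (\<i> * R) - P (- \<i> * R))) ?ra"
    proof (rule has_contour_integral_eq[OF I1])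
      fix w assume "w \<in> path_image ?ra"
      then have "w \<noteq> 0" by (rule nz)
      then show "E w * Q w = (F w - F 0) * K w"
        using R by (simp add: K_def Q_def F1_def field_simps power2_eq_square)
    qed
    have "(\<lambda>w. (S w - F w) * K w) contour_integrable_on ?ra"
      by (intro contour_integrable_continuous_part_circlepath continuous_intros contS contK contF)
    then obtain J2 where J2: "((\<lambda>w. (S w - F w) * K w) has_contour_integral J2) ?ra"
      by (auto simp: contour_integrable_on_def)
    have bound2: "cmod J2 \<le> 2 * C / R^2 * R * (pi/2 - (-(pi/2)))"
    proof (rule has_contour_integral_bound_part_circlepath[OF J2])
      fix w assume w: "w \<in> path_image ?ra"
      have "cmod ((S w - F w) * K w) = (Re w * cmod (F w - S w)) * exp (L * Re w) * (2 / R^2)"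
        using raRe[OF w] by (simp add: norm_mult normK[OF arcR[OF w]] norm_minus_commute)
      also have "\<dots> \<le> (C * exp (- L * Re w)) * exp (L * Re w) * (2 / R^2)"
        using right[OF raRe[OF w]] by (intro mult_right_mono) auto
      also have "\<dots> = 2 * C / R^2" by (simp add: exp_minus field_simps)
      finally show "cmod ((S w - F w) * K w) \<le> 2 * C / R^2" .
    qed (use C R in auto)
    have "(\<lambda>w. (S w - F 0) * K w) contour_integrable_on ?la"
      by (intro contour_integrable_continuous_part_circlepath continuous_intros contS contK)
    then obtain J3 where J3: "((\<lambda>w. (S w - F 0) * K w) has_contour_integral J3) ?la"
      by (auto simp: contour_integrable_on_def)
    have bound3: "cmod J3 \<le> (2 * C / R^2 + 2 * cmod (F 0) / (R^2 * L)) * R * (3*pi/2 - pi/2)"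
    proof (rule has_contour_integral_bound_part_circlepath[OF J3])
      fix w assume w: "w \<in> path_image ?la"
      have "cmod ((S w - F 0) * K w) \<le> (cmod (S w) + cmod (F 0)) * cmod (K w)"
        by (simp add: norm_mult mult_right_mono norm_triangle_ineq4)
      also have "\<dots> = (- Re w * cmod (S w)) * exp (L * Re w) * (2 / R^2)
          + cmod (F 0) * (2 / R^2) * (- Re w * exp (- (L * - Re w)))"
        using laRe[OF w] by (simp add: normK[OF arcR[OF w]] algebra_simps add_divide_distrib)
      also have "\<dots> \<le> (C * exp (- L * Re w)) * exp (L * Re w) * (2 / R^2)
          + cmod (F 0) * (2 / R^2) * (1 / L)"
        using left[OF laRe[OF w]] mult_exp_neg_le[OF L, of "- Re w"]
        by (intro add_mono mult_right_mono mult_left_mono) auto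
      also have "\<dots> = 2 * C / R^2 + 2 * cmod (F 0) / (R^2 * L)" by (simp add: exp_minus field_simps)
      finally show "cmod ((S w - F 0) * K w) \<le> 2 * C / R^2 + 2 * cmod (F 0) / (R^2 * L)" .
    qed (use C R L in auto)
    have right_arc: "((\<lambda>w. (S w - F 0) * K w) has_contour_integral (J2 + (P (\<i> * R) - P (- \<i> * R)))) ?ra"
      using has_contour_integral_add[OF J2 I4] by (simp add: algebra_simps)
    \<comment> \<open>\<open>S\<close> is entire, so Cauchy's formula on the full circle isolates
      \<open>S 0 - F 0\<close>; the exponential and the factor \<open>1 + u^2 / R^2\<close> are 1 at
      0.\<close>
    have "((\<lambda>u. ((S u - F 0) * E u * (1 + u\<^sup>2 / of_real (R^2))) / (u - 0)) has_contour_integral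
        (2 * of_real pi * \<i> * ((S 0 - F 0) * E 0 * (1 + 0\<^sup>2 / of_real (R^2))))) (circlepath 0 R)"
      using R S by (intro Cauchy_integral_circlepath_simple holomorphic_intros E)
        (auto intro: holomorphic_on_subset)
    then have circ: "((\<lambda>u. (S u - F 0) * K u) has_contour_integral (2 * of_real pi * \<i> * (S 0 - F 0))) (circlepath 0 R)"
      using R by (auto elim!: has_contour_integral_eq simp: E_def K_def field_simps power2_eq_square)
    have "((\<lambda>w. (S w - F 0) * K w) has_contour_integral (J2 + (P (\<i> * R) - P (- \<i> * R)) + J3)) (circlepath 0 R)"
      by (rule has_contour_integral_circle_split[OF _ R right_arc J3]) (intro continuous_intros contS contK)
    with circ have "2 * of_real pi * \<i> * (S 0 - F 0) = J2 + (P (\<i> * R) - P (- \<i> * R)) + J3"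
      by (rule has_contour_integral_unique)
    then have "2 * pi * cmod (S 0 - F 0) = cmod (J2 + (P (\<i> * R) - P (- \<i> * R)) + J3)"
      by (metis (no_types, opaque_lifting) abs_of_nonneg mult.right_neutral norm_ii norm_mult norm_numeral norm_of_real pi_ge_zero)
    also have "\<dots> \<le> cmod J2 + cmod (P (\<i> * R) - P (- \<i> * R)) + cmod J3"
      by (meson add_mono norm_triangle_ineq order_refl order_trans)
    also have "\<dots> \<le> 2 * pi * (2 * C / R + M / L)"
    proof -
      have "2 * C / R^2 * R * (pi/2 - (-(pi/2))) + B / L * (2 * R)
         + (2 * C / R^2 + 2 * cmod (F 0) / (R^2 * L)) * R * (3*pi/2 - pi/2) = 2 * pi * (2 * C / R + M / L)"
        using R L by (simp add: M_def field_simps power2_eq_square)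
      then show ?thesis using bound1 bound2 bound3 by linarith
    qed
    finally show "cmod (S 0 - F 0) \<le> 2 * C / R + M / L"
      by simp
  qed
qed

theorem newman_tauberian:
  fixes F :: "complex \<Rightarrow> complex" and S :: "nat \<Rightarrow> complex \<Rightarrow> complex"
  assumes U: "open U" "{w. Re w \<ge> 0} \<subseteq> U" and F: "F holomorphic_on U"
    and S: "\<And>n. S n holomorphic_on UNIV" and L: "filterlim L at_top sequentially" and C: "C \<ge> 0"
    and right: "\<And>n w. Re w \<ge> 0 \<Longrightarrow> Re w * cmod (F w - S n w) \<le> C * exp (- L n * Re w)"
    and left: "\<And>n w. Re w \<le> 0 \<Longrightarrow> - Re w * cmod (S n w) \<le> C * exp (- L n * Re w)"
  shows "(\<lambda>n. S n 0) \<longlonglongrightarrow> F 0"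
proof (rule LIMSEQ_I)
  fix e :: real assume e: "e > 0"
  \<comment> \<open>Makes \<open>2 * C / R \<le> e / 2\<close>; \<open>C + 1\<close> instead of
    \<open>C\<close> keeps \<open>R\<close> positive when \<open>C = 0\<close>.\<close>
  define R where "R = 4 * (C + 1) / e"
  have R: "R > 0" using e C by (simp add: R_def)
  obtain M where M: "\<And>S L C. \<lbrakk>S holomorphic_on UNIV; L > 0; C \<ge> 0;
      \<And>w. Re w \<ge> 0 \<Longrightarrow> Re w * cmod (F w - S w) \<le> C * exp (- L * Re w);
      \<And>w. Re w \<le> 0 \<Longrightarrow> - Re w * cmod (S w) \<le> C * exp (- L * Re w)\<rbrakk>
      \<Longrightarrow> cmod (S 0 - F 0) \<le> 2 * C / R + M / L"
    using newman_fixed_radius[OF U F R] by blast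
  have "(\<lambda>n. M / L n) \<longlonglongrightarrow> 0"
    by (rule real_tendsto_divide_at_top[OF tendsto_const L])
  then have "\<forall>\<^sub>F n in sequentially. M / L n < e / 2"
    using e by (intro order_tendstoD(2)[of _ 0]) auto
  moreover have "\<forall>\<^sub>F n in sequentially. L n > 0"
    using L by (simp add: filterlim_at_top_dense)
  ultimately have "\<forall>\<^sub>F n in sequentially. norm (S n 0 - F 0) < e"
  proof eventually_elim
    case (elim n)
    have "norm (S n 0 - F 0) \<le> 2 * C / R + M / L n"
      by (rule M) (use S C elim right left in auto)
    also have "2 * C / R \<le> e / 2" using e C by (simp add: R_def field_simps)
    finally show ?case using elim by linarith
  qed
  then show "\<exists>no. \<forall>n\<ge>no. norm (S n 0 - F 0) < e"
    by (simp add: eventually_sequentially)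
qed

section \<open>The zeta function and the series of the von Mangoldt function\<close>

lemma norm_nat_powr_complex: "cmod (of_nat n powr s) = real n powr Re s"
  by (simp add: norm_powr_real_powr)

lemma summable_nat_powr: "s > 1 \<Longrightarrow> summable (\<lambda>n. real n powr (- s))"
  by (simp add: summable_real_powr_iff)

text \<open>Half of the excess \<open>s - 1\<close> absorbs the logarithm, the other half gives
  convergence.\<close>

lemma summable_ln_nat_powr:
  assumes "s > 1"
  shows "summable (\<lambda>n. ln (real n) * real n powr (- s))"
proof (rule summable_comparison_test')
  show "summable (\<lambda>n. 2 / (s - 1) * real n powr (- ((s + 1) / 2)))"
    using assms by (intro summable_mult summable_nat_powr) auto
  show "norm (ln (real n) * real n powr (- s)) \<le> 2 / (s - 1) * real n powr (- ((s + 1) / 2))" if "n \<ge> 1" for n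
  proof -
    have "ln (real n) \<le> real n powr ((s - 1) / 2) / ((s - 1) / 2)"
      using that assms by (intro ln_powr_bound) auto
    then have "ln (real n) * real n powr (- s) \<le> real n powr ((s - 1) / 2) / ((s - 1) / 2) * real n powr (- s)"
      by (intro mult_right_mono) auto
    also have "\<dots> = 2 / (s - 1) * (real n powr ((s - 1) / 2) * real n powr (- s))" by simp
    also have "real n powr ((s - 1) / 2) * real n powr (- s) = real n powr (- ((s + 1) / 2))"
    proof -
      have "(s - 1) / 2 + - s = - ((s + 1) / 2)" by (simp add: field_simps)
      then show ?thesis by (simp only: powr_add[symmetric])
    qed
    finally show ?thesis using that by simp
  qed
qed

lemma summable_mangoldt_powr:
  assumes "s > 1"
  shows "summable (\<lambda>n. mangoldt n * real n powr (- s))"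
proof (rule summable_comparison_test'[OF summable_ln_nat_powr[OF assms]])
  show "norm (mangoldt n * real n powr (- s)) \<le> ln (real n) * real n powr (- s)" if "n \<ge> 1" for n
    using that mangoldt_le[of n] mangoldt_nonneg[of n] by (simp add: mult_right_mono)
qed

text \<open>Since \<open>0 powr z = 0\<close>, the term at \<open>n = 0\<close> vanishes and the sum
  is the usual Dirichlet series.\<close>

definition zeta_series :: "complex \<Rightarrow> complex" where
  "zeta_series s = (\<Sum>n. of_nat n powr (- s))"

definition mangoldt_series :: "complex \<Rightarrow> complex" where
  "mangoldt_series s = (\<Sum>n. mangoldt n * of_nat n powr (- s))"

lemma zeta_series_sums: "Re s > 1 \<Longrightarrow> (\<lambda>n. of_nat n powr (- s)) sums zeta_series s"
  unfolding zeta_series_def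
  by (intro summable_sums summable_norm_cancel[of "\<lambda>n. of_nat n powr (- s)"])
    (simp add: norm_nat_powr_complex summable_nat_powr)

lemma summable_norm_mangoldt_series:
  "Re s > 1 \<Longrightarrow> summable (\<lambda>n. cmod (mangoldt n * of_nat n powr (- s)))"
  by (simp add: norm_mult norm_nat_powr_complex summable_mangoldt_powr)

lemma mangoldt_series_sums:
  "Re s > 1 \<Longrightarrow> (\<lambda>n. mangoldt n * of_nat n powr (- s)) sums mangoldt_series s"
  unfolding mangoldt_series_def
  by (rule summable_sums, rule summable_norm_cancel, rule summable_norm_mangoldt_series)

text \<open>The sum of \<open>mangoldt\<close> over the divisors of \<open>n\<close> is
  \<open>ln n\<close>; absolute convergence permits regrouping the double sum by the product of its
  two indices.\<close>

lemma zeta_series_mult_mangoldt_series: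
  assumes s: "Re s > 1"
  shows "(\<lambda>n. of_real (ln (real n)) * of_nat n powr (- s)) sums (mangoldt_series s * zeta_series s)"
proof -
  let ?f = "\<lambda>n. mangoldt n * of_nat n powr (- s) :: complex"
  let ?g = "\<lambda>n. of_nat n powr (- s) :: complex"
  let ?A = "{0<..} :: nat set"
  have "(?f has_sum mangoldt_series s) UNIV"
    by (intro norm_summable_imp_has_sum summable_norm_mangoldt_series mangoldt_series_sums s)
  then have f: "(?f has_sum mangoldt_series s) ?A"
    by (rule has_sum_cong_neutral[THEN iffD1, rotated -1]) auto
  have "(?g has_sum zeta_series s) UNIV"
    by (intro norm_summable_imp_has_sum zeta_series_sums s) (simp add: norm_nat_powr_complex summable_nat_powr s)
  then have g: "(?g has_sum zeta_series s) ?A"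
    by (rule has_sum_cong_neutral[THEN iffD1, rotated -1]) auto
  have fa: "(\<lambda>a. norm (?f a)) summable_on ?A" and ga: "(\<lambda>b. norm (?g b)) summable_on ?A"
    using has_sum_imp_summable[OF f] has_sum_imp_summable[OF g]
    by (simp_all only: summable_on_iff_abs_summable_on_complex)
  have "(\<lambda>x. norm ((\<lambda>(a, b). ?f a * ?g b) x)) summable_on (?A \<times> ?A)"
    unfolding Infinite_Sum.abs_summable_on_Sigma_iff
  proof (intro conjI ballI, goal_cases)
    case (1 x)
    show ?case using summable_on_cmult_right[OF ga, of "norm (?f x)"] by (simp add: norm_mult)
  next
    case 2
    have "(\<lambda>x. norm (?f x) * (\<Sum>\<^sub>\<infinity>y\<in>?A. norm (?g y))) summable_on ?A"
      by (intro summable_on_cmult_left fa)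
    then have "(\<lambda>x. norm (norm (?f x) * (\<Sum>\<^sub>\<infinity>y\<in>?A. norm (?g y)))) summable_on ?A"
      by (rule summable_on_iff_abs_summable_on_real[THEN iffD1])
    then show ?case by (simp add: norm_mult infsum_cmult_right')
  qed
  then have "(\<lambda>(a, b). ?f a * ?g b) summable_on (?A \<times> ?A)"
    by (rule Infinite_Sum.abs_summable_summable)
  then obtain S where S: "((\<lambda>(a, b). ?f a * ?g b) has_sum S) (?A \<times> ?A)"
    by (auto simp: summable_on_def)
  have "((\<lambda>a. ?f a * zeta_series s) has_sum S) ?A"
    using S by (rule has_sum_SigmaD) (simp add: has_sum_cmult_right[OF g])
  moreover have "((\<lambda>a. ?f a * zeta_series s) has_sum mangoldt_series s * zeta_series s) ?A"
    by (rule has_sum_cmult_left[OF f])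
  ultimately have S_eq: "S = mangoldt_series s * zeta_series s"
    by (rule has_sum_unique)
  \<comment> \<open>The index 0 has been removed from both sums because it would destroy this
    bijection: every number divides it.\<close>
  have bij: "bij_betw (\<lambda>(n, d). (d, n div d)) (SIGMA n:?A. {d. d dvd n}) (?A \<times> ?A)"
    by (rule bij_betwI[of _ _ _ "\<lambda>(a, b). (a * b, a)"]) (auto intro: Nat.gr0I)
  have "((\<lambda>x. (\<lambda>(a, b). ?f a * ?g b) ((\<lambda>(n, d). (d, n div d)) x)) has_sum S) (SIGMA n:?A. {d. d dvd n})"
    using S by (subst has_sum_reindex_bij_betw[OF bij])
  then have "((\<lambda>n. of_real (ln (real n)) * of_nat n powr (- s)) has_sum S) ?A"
  proof (rule has_sum_SigmaD)
    fix n :: nat assume n: "n \<in> ?A"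
    have "((\<lambda>d. ?f d * ?g (n div d)) has_sum (\<Sum>d | d dvd n. ?f d * ?g (n div d))) {d. d dvd n}"
      using n by (intro has_sum_finite) auto
    also have "(\<Sum>d | d dvd n. ?f d * ?g (n div d)) = (\<Sum>d | d dvd n. mangoldt d * of_nat n powr (- s))"
    proof (rule sum.cong)
      fix d assume "d \<in> {d. d dvd n}"
      then obtain k where k: "n = d * k" by auto
      with n have "d > 0" by auto
      have "?g (d * k) = ?g d * ?g k"
        using powr_times_real[of "of_nat d" "of_nat k" "- s"] by simp
      then show "?f d * ?g (n div d) = mangoldt d * of_nat n powr (- s)"
        using k \<open>d > 0\<close> by simp
    qed auto
    also have "\<dots> = of_real (ln (real n)) * of_nat n powr (- s)"
      using n mangoldt_sum[of n, where ?'a = complex] by (simp flip: sum_distrib_right)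
    finally show "((\<lambda>y. (\<lambda>(a, b). ?f a * ?g b) ((\<lambda>(n, d). (d, n div d)) (n, y))) has_sum
       of_real (ln (real n)) * of_nat n powr (- s)) {d. d dvd n}" by simp
  qed
  then have "((\<lambda>n. of_real (ln (real n)) * of_nat n powr (- s)) has_sum S) UNIV"
    by (rule has_sum_cong_neutral[THEN iffD1, rotated -1]) auto
  then show ?thesis
    unfolding S_eq by (rule has_sum_imp_sums)
qed

text \<open>The derived series has the coefficients \<open>- ln n\<close> and is therefore a
  product. No division by zeta occurs, whose zeros have not been excluded yet.\<close>

lemma has_field_derivative_zeta_series:
  assumes s: "Re s > 1"
  shows "(zeta_series has_field_derivative - (mangoldt_series s * zeta_series s)) (at s)"
proof -
  let ?S = "{s. Re s > 1}"
  have "\<exists>g g'. \<forall>x\<in>?S. ((\<lambda>n. of_nat n powr (- x)) sums g x) \<and>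
     ((\<lambda>n. - (of_real (ln (real n)) * of_nat n powr (- x))) sums g' x) \<and> (g has_field_derivative g' x) (at x)"
  proof (rule series_and_derivative_comparison_local)
    show "open ?S" by (rule open_halfspace_Re_gt)
    show "((\<lambda>x. of_nat n powr (- x)) has_field_derivative - (of_real (ln (real n)) * of_nat n powr (- x))) (at x)"
      for n and x :: complex
      by (cases "n = 0") (auto intro!: derivative_eq_intros simp: powr_def Ln_of_nat)
    fix x assume x: "x \<in> ?S"
    define d where "d = (Re x - 1) / 2"
    have d: "d > 0" using x by (simp add: d_def)
    show "\<exists>d h. 0 < d \<and> summable h \<and> (\<forall>\<^sub>F n in sequentially. \<forall>y\<in>ball x d \<inter> ?S. norm (of_nat n powr (- y)) \<le> h n)"
    proof (intro exI conjI)
      show "summable (\<lambda>n. real n powr (- (1 + d)))" using d by (intro summable_nat_powr) auto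
      show "\<forall>\<^sub>F n in sequentially. \<forall>y\<in>ball x d \<inter> ?S. norm (of_nat n powr (- y)) \<le> real n powr (- (1 + d))"
      proof (intro eventually_sequentiallyI[of 1] ballI)
        fix n :: nat and y assume n: "n \<ge> 1" and y: "y \<in> ball x d \<inter> ?S"
        have "\<bar>Re x - Re y\<bar> < d" using y abs_Re_le_cmod[of "x - y"] by (auto simp: dist_norm)
        moreover have "2 * d = Re x - 1" by (simp add: d_def)
        ultimately have "Re y \<ge> 1 + d" by linarith
        then show "norm (of_nat n powr (- y)) \<le> real n powr (- (1 + d))"
          using n by (simp add: norm_nat_powr_complex powr_mono)
      qed
    qed (use d in auto)
  qed
  then obtain g g' where g: "\<And>x. Re x > 1 \<Longrightarrow> (\<lambda>n. of_nat n powr (- x)) sums g x"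
     "\<And>x. Re x > 1 \<Longrightarrow> (\<lambda>n. - (of_real (ln (real n)) * of_nat n powr (- x))) sums g' x"
     "\<And>x. Re x > 1 \<Longrightarrow> (g has_field_derivative g' x) (at x)"
    by auto
  have "g x = zeta_series x" if "Re x > 1" for x
    using g(1)[OF that] zeta_series_sums[OF that] sums_unique2 by blast
  then have "(zeta_series has_field_derivative g' s) (at s)"
    using s by (intro has_field_derivative_transform_within_open[OF g(3)[OF s] open_halfspace_Re_gt[of 1]]) auto
  moreover have "g' s = - (mangoldt_series s * zeta_series s)"
    using g(2)[OF s] sums_minus[OF zeta_series_mult_mangoldt_series[OF s]] sums_unique2 by blast
  ultimately show ?thesis by simp
qed

section \<open>Continuation of \<open>(s - 1) * zeta\<close> to the half-plane
  \<open>Re s > 0\<close>\<close>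

lemma powr_diff_bound:
  fixes s :: complex and x u :: real
  assumes x: "x > 0" "x \<le> u" and s: "Re s > 0"
  shows "cmod (of_real u powr (- s) - of_real x powr (- s)) \<le> cmod s * x powr (- Re s - 1) * (u - x)"
proof -
  let ?S = "complex_of_real ` {x..u}"
  have "cmod (of_real u powr (- s) - of_real x powr (- s)) \<le> (cmod s * x powr (- Re s - 1)) * cmod (of_real u - of_real x)"
  proof (rule field_differentiable_bound)
    show "convex ?S" by (intro convex_linear_image) (auto simp: linear_iff scaleR_conv_of_real)
    fix z assume "z \<in> ?S"
    then obtain t where t: "z = of_real t" "x \<le> t" "t \<le> u" by auto
    then show "((\<lambda>z. z powr (- s)) has_field_derivative - s * z powr (- s - 1)) (at z within ?S)"
      using x by (intro has_field_derivative_at_within[OF has_field_derivative_powr]) (auto simp: complex_nonpos_Reals_iff)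
    have "t powr (- Re s - 1) \<le> x powr (- Re s - 1)"
      using t x s by (intro powr_mono2') auto
    then show "cmod (- s * z powr (- s - 1)) \<le> cmod s * x powr (- Re s - 1)"
      using t x by (simp add: norm_mult norm_powr_real_powr mult_left_mono)
  qed (use x in auto)
  also have "cmod (of_real u - of_real x) = u - x"
    using x by (simp flip: of_real_diff)
  finally show ?thesis .
qed

text \<open>The terms of \<open>(s - 1) \<zeta>(s)\<close>, each one corrected by the telescoping difference
  \<open>(n + 1)\<^sup>1\<^sup>-\<^sup>s - n\<^sup>1\<^sup>-\<^sup>s\<close>, which extends the series to \<open>Re s > 0\<close>.\<close>

definition zeta_pole_term :: "nat \<Rightarrow> complex \<Rightarrow> complex" where
  "zeta_pole_term n s = (s - 1) * of_nat n powr (- s) + of_nat (Suc n) powr (1 - s) - of_nat n powr (1 - s)"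

definition zeta_pole :: "complex \<Rightarrow> complex" where
  "zeta_pole s = (\<Sum>n. zeta_pole_term n s)"

text \<open>The term is \<open>(s - 1)\<close> times the integral of
  \<open>n powr (- s) - u powr (- s)\<close> over \<open>[n, n + 1]\<close>, and this difference is
  smaller than \<open>n powr (- s)\<close> by a factor of order \<open>1 / n\<close>. The mean value
  inequality is applied to a primitive \<open>?g\<close> of the integrand.\<close>

lemma norm_zeta_pole_term_le:
  assumes s: "Re s > 0" and n: "n > 0"
  shows "cmod (zeta_pole_term n s) \<le> cmod (s - 1) * cmod s * real n powr (- Re s - 1)"
proof -
  let ?x = "real n" let ?S = "complex_of_real ` {?x..?x + 1}"
  let ?g = "\<lambda>z. (s - 1) * z * of_real ?x powr (- s) + z powr (1 - s)"
  have "cmod (?g (of_real (?x + 1)) - ?g (of_real ?x)) \<le> (cmod (s - 1) * (cmod s * ?x powr (- Re s - 1)))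
      * cmod (of_real (?x + 1) - of_real ?x)"
  proof (rule field_differentiable_bound)
    show "convex ?S" by (intro convex_linear_image) (auto simp: linear_iff scaleR_conv_of_real)
    fix z assume "z \<in> ?S"
    then obtain t where t: "z = of_real t" "?x \<le> t" "t \<le> ?x + 1" by auto
    have "z \<notin> \<real>\<^sub>\<le>\<^sub>0" using t n by (auto simp: complex_nonpos_Reals_iff)
    then show "(?g has_field_derivative (s - 1) * (of_real ?x powr (- s) - z powr (- s))) (at z within ?S)"
      by (auto intro!: derivative_eq_intros simp: algebra_simps)
    have "cmod (of_real t powr (- s) - of_real ?x powr (- s)) \<le> cmod s * ?x powr (- Re s - 1) * (t - ?x)"
      using t n s by (intro powr_diff_bound) auto
    also have "\<dots> \<le> cmod s * ?x powr (- Re s - 1) * 1"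
      using t by (intro mult_left_mono) auto
    finally show "cmod ((s - 1) * (of_real ?x powr (- s) - z powr (- s))) \<le> cmod (s - 1) * (cmod s * ?x powr (- Re s - 1))"
      using t by (simp add: norm_mult mult_left_mono norm_minus_commute)
  qed (intro imageI, simp)+
  also have "?g (of_real (?x + 1)) - ?g (of_real ?x) = zeta_pole_term n s"
    by (simp add: zeta_pole_term_def algebra_simps)
  also have "cmod (of_real (?x + 1) - of_real ?x) = 1" by simp
  finally show ?thesis by (simp add: mult.assoc)
qed

lemma zeta_pole_holomorphic_and_sums:
  "zeta_pole holomorphic_on {s. Re s > 0}"
  "Re s > 0 \<Longrightarrow> (\<lambda>n. zeta_pole_term n s) sums zeta_pole s"
proof -
  let ?S = "{s. Re s > 0}"
  have hol: "zeta_pole_term n holomorphic_on ?S" for n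
    unfolding zeta_pole_term_def by (cases "n = 0") (auto intro!: holomorphic_intros)
  have "\<exists>g g'. \<forall>x\<in>?S. ((\<lambda>n. zeta_pole_term n x) sums g x) \<and>
     ((\<lambda>n. deriv (zeta_pole_term n) x) sums g' x) \<and> (g has_field_derivative g' x) (at x)"
  proof (rule series_and_derivative_comparison_local)
    show "open ?S" by (rule open_halfspace_Re_gt)
    show "(zeta_pole_term n has_field_derivative deriv (zeta_pole_term n) x) (at x)" if "x \<in> ?S" for n x
      by (rule holomorphic_derivI[OF hol open_halfspace_Re_gt that])
    fix x assume x: "x \<in> ?S"
    define d where "d = Re x / 2"
    have d: "d > 0" using x by (simp add: d_def)
    define A where "A = cmod x + d + 1"
    show "\<exists>d h. 0 < d \<and> summable h \<and> (\<forall>\<^sub>F n in sequentially. \<forall>y\<in>ball x d \<inter> ?S. norm (zeta_pole_term n y) \<le> h n)"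
    proof (intro exI conjI)
      show "summable (\<lambda>n. A * A * real n powr (- (1 + d)))" using d by (intro summable_mult summable_nat_powr) auto
      show "\<forall>\<^sub>F n in sequentially. \<forall>y\<in>ball x d \<inter> ?S. norm (zeta_pole_term n y) \<le> A * A * real n powr (- (1 + d))"
      proof (intro eventually_sequentiallyI[of 1] ballI)
        fix n :: nat and y assume n: "n \<ge> 1" and y: "y \<in> ball x d \<inter> ?S"
        have dist: "cmod (x - y) < d" using y by (auto simp: dist_norm)
        have "Re x - Re y < d" using dist abs_Re_le_cmod[of "x - y"] by auto
        moreover have "2 * d = Re x" by (simp add: d_def)
        ultimately have "Re y \<ge> d" by linarith
        have "cmod y \<le> cmod x + d" using dist norm_triangle_ineq2[of y x] by (simp add: norm_minus_commute)
        moreover have "cmod (y - 1) \<le> cmod y + 1" using norm_triangle_ineq4[of y 1] by simp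
        ultimately have "cmod y \<le> A" "cmod (y - 1) \<le> A" by (auto simp: A_def)
        have "norm (zeta_pole_term n y) \<le> cmod (y - 1) * cmod y * real n powr (- Re y - 1)"
          using n y by (intro norm_zeta_pole_term_le) auto
        also have "\<dots> \<le> A * A * real n powr (- (1 + d))"
          using \<open>cmod y \<le> A\<close> \<open>cmod (y - 1) \<le> A\<close> \<open>Re y \<ge> d\<close> n order_trans[OF norm_ge_zero \<open>cmod y \<le> A\<close>]
          by (intro mult_mono powr_mono) auto
        finally show "norm (zeta_pole_term n y) \<le> A * A * real n powr (- (1 + d))" .
      qed
    qed (use d in auto)
  qed
  then obtain g g' where g: "\<And>x. Re x > 0 \<Longrightarrow> (\<lambda>n. zeta_pole_term n x) sums g x"
     "\<And>x. Re x > 0 \<Longrightarrow> (g has_field_derivative g' x) (at x)"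
    by auto
  have eq: "g x = zeta_pole x" if "Re x > 0" for x
    using sums_unique[OF g(1)[OF that]] by (simp add: zeta_pole_def)
  have "g holomorphic_on ?S"
    using g(2) by (auto simp: holomorphic_on_def field_differentiable_def intro: has_field_derivative_at_within)
  then show "zeta_pole holomorphic_on ?S"
    by (rule holomorphic_transform) (use eq in auto)
  show "(\<lambda>n. zeta_pole_term n s) sums zeta_pole s" if "Re s > 0" for s
    using g(1)[OF that] eq[OF that] by simp
qed

lemma zeta_pole_1: "zeta_pole 1 = 1"
proof -
  \<comment> \<open>With \<open>0 powr z = 0\<close> the term at \<open>n = 0\<close> is identically
    1, which is the residue of zeta; at \<open>s = 1\<close> all other terms vanish.\<close>
  have "(\<lambda>n. zeta_pole_term n 1) = (\<lambda>n. if n = 0 then 1 else 0)"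
    by (auto simp: zeta_pole_term_def simp del: of_nat_Suc)
  then have "(\<lambda>n. zeta_pole_term n 1) sums 1"
    using sums_single[of 0 "\<lambda>_. 1 :: complex"] by simp
  then show ?thesis using zeta_pole_holomorphic_and_sums(2)[of 1] sums_unique2 by force
qed

lemma zeta_pole_eq:
  assumes s: "Re s > 1"
  shows "zeta_pole s = (s - 1) * zeta_series s"
proof -
  have "(\<lambda>n. of_nat n powr (1 - s)) \<longlonglongrightarrow> (0 :: complex)"
  proof (rule tendsto_norm_zero_cancel)
    have "(\<lambda>n. real n powr (Re (1 - s))) \<longlonglongrightarrow> 0"
      using s by (intro tendsto_neg_powr filterlim_real_sequentially) auto
    then show "(\<lambda>n. cmod (of_nat n powr (1 - s))) \<longlonglongrightarrow> 0"
      by (simp add: norm_nat_powr_complex)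
  qed
  from telescope_sums[OF this]
  have "(\<lambda>n. of_nat (Suc n) powr (1 - s) - of_nat n powr (1 - s)) sums (0 - of_nat 0 powr (1 - s))" .
  from sums_add[OF sums_mult[OF zeta_series_sums[OF s], of "s - 1"] this]
  have "(\<lambda>n. zeta_pole_term n s) sums ((s - 1) * zeta_series s)"
    by (simp add: zeta_pole_term_def algebra_simps)
  moreover have "(\<lambda>n. zeta_pole_term n s) sums zeta_pole s"
    using s by (intro zeta_pole_holomorphic_and_sums) auto
  ultimately show ?thesis by (rule sums_unique2[symmetric])
qed

section \<open>Zeros on the line of real part 1\<close>

lemma tendsto_of_real_at_right_0:
  "((\<lambda>e. \<xi> + of_real e) \<longlongrightarrow> (\<xi> :: complex)) (at_right 0)"
proof -
  have "((\<lambda>e. \<xi> + of_real e) \<longlongrightarrow> \<xi> + of_real 0) (at_right 0)"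
    by (intro tendsto_intros)
  then show ?thesis by (simp only: of_real_0 add_0_right)
qed

text \<open>Near a zero \<open>f\<close> is \<open>(w - \<xi>)^n * g\<close> with \<open>g\<close>
  free of zeros, so \<open>f' / f\<close> is \<open>n / (w - \<xi>)\<close> plus a bounded term.
  Approaching from the right stays, for \<open>\<xi>\<close> on the line of real part 1, where the
  Dirichlet series are available.\<close>

lemma log_deriv_at_zero:
  assumes f: "f holomorphic_on S" and S: "open S" "connected S" and \<xi>: "\<xi> \<in> S" "f \<xi> = 0"
    and nonconst: "\<not> f constant_on S"
  obtains n :: nat where "n > 0"
    "((\<lambda>e. of_real e * (deriv f (\<xi> + of_real e) / f (\<xi> + of_real e))) \<longlongrightarrow> of_nat n) (at_right 0)"
proof -
  obtain g r and n :: nat where g: "0 < n" "0 < r" "ball \<xi> r \<subseteq> S" "g holomorphic_on ball \<xi> r"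
      "\<And>w. w \<in> ball \<xi> r \<Longrightarrow> f w = (w - \<xi>)^n * g w" "\<And>w. w \<in> ball \<xi> r \<Longrightarrow> g w \<noteq> 0"
    by (rule holomorphic_factor_zero_nonconstant[OF f S \<xi> nonconst]) (rule that)
  have df: "deriv f w = of_nat n * (w - \<xi>) ^ (n - 1) * g w + (w - \<xi>) ^ n * deriv g w" if w: "w \<in> ball \<xi> r" for w
  proof -
    have "((\<lambda>w. (w - \<xi>)^n * g w) has_field_derivative (of_nat n * (w - \<xi>) ^ (n - 1) * g w + (w - \<xi>) ^ n * deriv g w)) (at w)"
      using holomorphic_derivI[OF g(4) open_ball w, of UNIV]
      by (auto intro!: derivative_eq_intros)
    then have "(f has_field_derivative (of_nat n * (w - \<xi>) ^ (n - 1) * g w + (w - \<xi>) ^ n * deriv g w)) (at w)"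
      using g(5) w by (intro has_field_derivative_transform_within_open[of _ _ w "ball \<xi> r" f]) auto
    then show ?thesis by (rule DERIV_imp_deriv)
  qed
  have ev: "\<forall>\<^sub>F e in at_right 0. of_real e * (deriv f (\<xi> + of_real e) / f (\<xi> + of_real e))
      = of_nat n + of_real e * (deriv g (\<xi> + of_real e) / g (\<xi> + of_real e))"
    using eventually_at_right_real[OF g(2)]
  proof eventually_elim
    case (elim e)
    then have w: "\<xi> + of_real e \<in> ball \<xi> r" and e: "e > 0" by (auto simp: dist_norm)
    have "(of_real e :: complex) ^ n = of_real e * of_real e ^ (n - 1)"
      using g(1) by (cases n) auto
    then show ?case
      using df[OF w] g(5)[OF w] g(6)[OF w] e by (simp add: field_simps)
  qed
  have "isCont g \<xi>" "isCont (deriv g) \<xi>"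
    using g(2,4) by (auto intro!: holomorphic_on_imp_continuous_on[THEN continuous_on_interior] holomorphic_deriv)
  then have "((\<lambda>e. deriv g (\<xi> + of_real e) / g (\<xi> + of_real e)) \<longlongrightarrow> deriv g \<xi> / g \<xi>) (at_right 0)"
    using g(2,6) by (intro tendsto_divide isCont_tendsto_compose[OF _ tendsto_of_real_at_right_0]) auto
  then have "((\<lambda>e. of_nat n + of_real e * (deriv g (\<xi> + of_real e) / g (\<xi> + of_real e))) \<longlongrightarrow> of_nat n + of_real 0 * (deriv g \<xi> / g \<xi>)) (at_right 0)"
    by (intro tendsto_add tendsto_mult tendsto_of_real tendsto_const tendsto_ident_at)
  then have "((\<lambda>e. of_real e * (deriv f (\<xi> + of_real e) / f (\<xi> + of_real e))) \<longlongrightarrow> of_nat n) (at_right 0)"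
    using tendsto_cong[OF ev] by simp
  with g(1) that show ?thesis by blast
qed

lemma log_deriv_zeta_pole:
  assumes s: "Re s > 1"
  shows "deriv zeta_pole s = zeta_pole s * (1 / (s - 1) - mangoldt_series s)"
proof -
  have "((\<lambda>s. (s - 1) * zeta_series s) has_field_derivative
      (zeta_series s + (s - 1) * - (mangoldt_series s * zeta_series s))) (at s)"
    using has_field_derivative_zeta_series[OF s] by (auto intro!: derivative_eq_intros)
  then have "(zeta_pole has_field_derivative
      (zeta_series s + (s - 1) * - (mangoldt_series s * zeta_series s))) (at s)"
    by (rule has_field_derivative_transform_within_open[OF _ open_halfspace_Re_gt[of 1]])
      (use s zeta_pole_eq in auto)
  then have "deriv zeta_pole s = zeta_series s + (s - 1) * - (mangoldt_series s * zeta_series s)"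
    by (rule DERIV_imp_deriv)
  moreover have "z + q * - (l * z) = q * z * (1 / q - l)" if "q \<noteq> 0" for z q l :: complex
    using that by (simp add: field_simps)
  moreover have "s - 1 \<noteq> 0" using s by auto
  ultimately have "deriv zeta_pole s = (s - 1) * zeta_series s * (1 / (s - 1) - mangoldt_series s)"
    by simp
  then show ?thesis by (simp only: zeta_pole_eq[OF s])
qed

text \<open>Away from zeros the limit is 0, so one natural number covers both cases; being natural,
  it is 0 as soon as it is bounded by something below 1.\<close>

lemma zeta_pole_order:
  assumes s: "Re s > 0"
  obtains n :: nat where "n = 0 \<longleftrightarrow> zeta_pole s \<noteq> 0"
    "((\<lambda>e. of_real e * (deriv zeta_pole (s + of_real e) / zeta_pole (s + of_real e))) \<longlongrightarrow> of_nat n) (at_right 0)"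
proof (cases "zeta_pole s = 0")
  case True
  have "\<not> zeta_pole constant_on {s. Re s > 0}"
  proof
    assume "zeta_pole constant_on {s. Re s > 0}"
    then have "zeta_pole s = zeta_pole 1" using s by (auto simp: constant_on_def)
    with True zeta_pole_1 show False by simp
  qed
  then obtain n :: nat where n: "n > 0"
    "((\<lambda>e. of_real e * (deriv zeta_pole (s + of_real e) / zeta_pole (s + of_real e))) \<longlongrightarrow> of_nat n) (at_right 0)"
    using s True log_deriv_at_zero[OF zeta_pole_holomorphic_and_sums(1) open_halfspace_Re_gt
        convex_connected[OF convex_halfspace_Re_gt], of s] by auto
  show ?thesis by (rule that[of n]) (use n True in auto)
next
  case False
  note hol = zeta_pole_holomorphic_and_sums(1)
  have "isCont zeta_pole s" "isCont (deriv zeta_pole) s"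
    using s by (auto intro!: holomorphic_on_imp_continuous_on[THEN continuous_on_interior, of _ "{s. Re s > 0}"]
        holomorphic_deriv hol simp: interior_open open_halfspace_Re_gt)
  then have "((\<lambda>e. deriv zeta_pole (s + of_real e) / zeta_pole (s + of_real e)) \<longlongrightarrow> deriv zeta_pole s / zeta_pole s) (at_right 0)"
    using False by (intro tendsto_divide isCont_tendsto_compose[OF _ tendsto_of_real_at_right_0]) auto
  then have "((\<lambda>e. of_real e * (deriv zeta_pole (s + of_real e) / zeta_pole (s + of_real e))) \<longlongrightarrow> of_real 0 * (deriv zeta_pole s / zeta_pole s)) (at_right 0)"
    by (intro tendsto_mult tendsto_of_real tendsto_ident_at)
  then show ?thesis using that[of 0] False by simp
qed

text \<open>The logarithmic derivative stays bounded along the ray to the right of \<open>s\<close>,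
  so the order of a zero at \<open>s\<close> would be 0.\<close>

lemma zeta_pole_nonzero_right:
  assumes s: "Re s > 1"
  shows "zeta_pole s \<noteq> 0"
proof -
  obtain n :: nat where n: "n = 0 \<longleftrightarrow> zeta_pole s \<noteq> 0"
    "((\<lambda>e. of_real e * (deriv zeta_pole (s + of_real e) / zeta_pole (s + of_real e))) \<longlongrightarrow> of_nat n) (at_right 0)"
    by (rule zeta_pole_order[of s]) (use s in auto)
  define B where "B = 1 / (Re s - 1) + (\<Sum>n. mangoldt n * real n powr (- Re s))"
  have B: "cmod (deriv zeta_pole (s + of_real e) / zeta_pole (s + of_real e)) \<le> B" if "e > 0" for e
  proof -
    let ?z = "s + of_real e"
    have z: "Re ?z > 1" using s that by simp
    have "cmod (mangoldt_series ?z) \<le> (\<Sum>n. mangoldt n * real n powr (- Re s))"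
      unfolding mangoldt_series_def
    proof (rule norm_suminf_le[OF _ summable_mangoldt_powr[OF s]])
      show "norm (mangoldt n * of_nat n powr (- ?z)) \<le> mangoldt n * real n powr (- Re s)" for n
        using that by (cases "n = 0") (auto simp: norm_mult norm_nat_powr_complex mangoldt_nonneg intro!: mult_left_mono powr_mono)
    qed
    moreover have "cmod (1 / (?z - 1)) \<le> 1 / (Re s - 1)"
    proof -
      have "Re s - 1 \<le> Re (?z - 1)" using that by simp
      also have "\<dots> \<le> cmod (?z - 1)" by (rule complex_Re_le_cmod)
      finally show ?thesis using s by (simp add: norm_divide frac_le)
    qed
    moreover have "cmod (1 / (?z - 1) - mangoldt_series ?z) \<le> cmod (1 / (?z - 1)) + cmod (mangoldt_series ?z)"
      by (rule norm_triangle_ineq4)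
    ultimately have "cmod (1 / (?z - 1) - mangoldt_series ?z) \<le> B" by (simp add: B_def)
    moreover have "0 \<le> B" using calculation norm_ge_zero order_trans by blast
    \<comment> \<open>\<open>log_deriv_zeta_pole\<close> is a product identity and says nothing
      about the quotient at a zero; there the quotient is 0 by \<open>x / 0 = 0\<close>.\<close>
    ultimately show ?thesis by (cases "zeta_pole ?z = 0") (auto simp: log_deriv_zeta_pole[OF z])
  qed
  have "((\<lambda>e. of_real e * (deriv zeta_pole (s + of_real e) / zeta_pole (s + of_real e))) \<longlongrightarrow> 0) (at_right 0)"
  proof (rule Lim_null_comparison)
    show "\<forall>\<^sub>F e in at_right 0. norm (of_real e * (deriv zeta_pole (s + of_real e) / zeta_pole (s + of_real e))) \<le> e * B"
      using eventually_at_right_less[of 0]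
    proof eventually_elim
      case (elim e)
      then have "e * cmod (deriv zeta_pole (s + of_real e) / zeta_pole (s + of_real e)) \<le> e * B"
        by (intro mult_left_mono B) auto
      then show ?case using elim by (simp only: norm_mult norm_of_real abs_of_pos)
    qed
    show "((\<lambda>e. e * B) \<longlongrightarrow> 0) (at_right 0)" by (rule tendsto_mult_left_zero[OF tendsto_ident_at])
  qed
  with n(2) have "of_nat n = (0 :: complex)" using tendsto_unique trivial_limit_at_right_real by blast
  then show ?thesis using n(1) by simp
qed

lemma Re_mangoldt_series_sums:
  assumes "x > 1"
  shows "(\<lambda>n. mangoldt n * real n powr (- x) * cos (t * ln (real n))) sums Re (mangoldt_series (Complex x t))"
proof -
  have eq: "Re (mangoldt n * of_nat n powr (- Complex x t)) = mangoldt n * real n powr (- x) * cos (t * ln (real n))" for n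
  proof (cases "n = 0")
    case False
    then have "of_nat n powr (- Complex x t) = exp (- Complex x t * of_real (ln (real n)))"
      by (simp add: powr_def)
    then show ?thesis using False by (simp add: Re_exp powr_def mult_ac)
  qed simp
  have "(\<lambda>n. Re (mangoldt n * of_nat n powr (- Complex x t))) sums Re (mangoldt_series (Complex x t))"
    by (intro sums_Re mangoldt_series_sums) (use assms in simp)
  then show ?thesis by (simp only: eq)
qed

text \<open>\<open>3 + 4 * cos t + cos (2 * t) = 2 * (1 + cos t)^2\<close> is nonnegative, and so
  are the coefficients.\<close>

lemma mangoldt_series_341:
  assumes "x > 1"
  shows "0 \<le> 3 * Re (mangoldt_series (Complex x 0)) + 4 * Re (mangoldt_series (Complex x t)) + Re (mangoldt_series (Complex x (2 * t)))"
proof (rule sums_le[OF _ sums_zero sums_add[OF sums_add[OF sums_mult sums_mult] ]])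
  show "0 \<le> 3 * (mangoldt n * real n powr (- x) * cos (0 * ln (real n))) + 4 * (mangoldt n * real n powr (- x) * cos (t * ln (real n)))
     + mangoldt n * real n powr (- x) * cos (2 * t * ln (real n))" for n
  proof -
    let ?c = "cos (t * ln (real n))"
    have double: "cos (2 * t * ln (real n)) = 2 * ?c\<^sup>2 - 1"
      using cos_double_cos[of "t * ln (real n)"] by (simp add: mult.assoc)
    have "3 * (mangoldt n * real n powr (- x) * cos (0 * ln (real n))) + 4 * (mangoldt n * real n powr (- x) * cos (t * ln (real n)))
     + mangoldt n * real n powr (- x) * cos (2 * t * ln (real n)) = mangoldt n * real n powr (- x) * (2 * (1 + ?c)\<^sup>2)"
      by (simp only: double) (simp add: algebra_simps power2_eq_square)
    also have "\<dots> \<ge> 0" by (simp add: mangoldt_nonneg)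
    finally show ?thesis .
  qed
qed (rule Re_mangoldt_series_sums[OF assms])+

lemma zeta_pole_nonzero_line:
  fixes t :: real
  assumes "t \<noteq> 0"
  shows "zeta_pole (Complex 1 t) \<noteq> 0"
proof -
  have lim: "\<exists>k::nat. (k = 0 \<longleftrightarrow> zeta_pole (Complex 1 u) \<noteq> 0) \<and>
     ((\<lambda>e. e * Re (mangoldt_series (Complex (1 + e) u))) \<longlongrightarrow> (if u = 0 then 1 else 0) - real k) (at_right 0)" for u
  proof -
    let ?s = "Complex 1 u"
    obtain k :: nat where k: "k = 0 \<longleftrightarrow> zeta_pole ?s \<noteq> 0"
      "((\<lambda>e. of_real e * (deriv zeta_pole (?s + of_real e) / zeta_pole (?s + of_real e))) \<longlongrightarrow> of_nat k) (at_right 0)"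
      by (rule zeta_pole_order[of ?s]) auto
    have lim1: "((\<lambda>e. of_real e * (1 / (of_real e + \<i> * of_real u))) \<longlongrightarrow> (if u = 0 then 1 else 0 :: complex)) (at_right 0)"
    proof (cases "u = 0")
      case True
      have "\<forall>\<^sub>F e in at_right 0. of_real e * (1 / (of_real e + \<i> * of_real u)) = (1 :: complex)"
        using eventually_at_right_less[of 0] by eventually_elim (simp add: True)
      then show ?thesis using True tendsto_eventually by auto
    next
      case False
      have "((\<lambda>e. of_real e * (1 / (of_real e + \<i> * of_real u))) \<longlongrightarrow> of_real 0 * (1 / (of_real 0 + \<i> * of_real u))) (at_right 0)"
        using False by (intro tendsto_intros) auto
      then show ?thesis using False by simp
    qed
    have ev: "\<forall>\<^sub>F e in at_right 0. Re (of_real e * (1 / (of_real e + \<i> * of_real u)) -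
        of_real e * (deriv zeta_pole (?s + of_real e) / zeta_pole (?s + of_real e))) = e * Re (mangoldt_series (Complex (1 + e) u))"
      using eventually_at_right_less[of 0]
    proof eventually_elim
      case (elim e)
      have eq: "?s + of_real e = Complex (1 + e) u" "Complex (1 + e) u - 1 = of_real e + \<i> * of_real u"
        by (auto simp: complex_eq_iff)
      have "Re (Complex (1 + e) u) > 1" using elim by simp
      from log_deriv_zeta_pole[OF this] zeta_pole_nonzero_right[OF this]
      have "deriv zeta_pole (Complex (1 + e) u) / zeta_pole (Complex (1 + e) u) = 1 / (of_real e + \<i> * of_real u) - mangoldt_series (Complex (1 + e) u)"
        by (simp add: eq)
      then show ?case by (simp only: eq right_diff_distrib) simp
    qed
    have "((\<lambda>e. Re (of_real e * (1 / (of_real e + \<i> * of_real u)) -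
        of_real e * (deriv zeta_pole (?s + of_real e) / zeta_pole (?s + of_real e)))) \<longlongrightarrow> Re ((if u = 0 then 1 else 0) - of_nat k)) (at_right 0)"
      by (intro tendsto_Re tendsto_diff lim1 k(2))
    then have "((\<lambda>e. e * Re (mangoldt_series (Complex (1 + e) u))) \<longlongrightarrow> (if u = 0 then 1 else 0) - real k) (at_right 0)"
      by (subst (asm) tendsto_cong[OF ev]) (auto split: if_splits)
    then show ?thesis by (intro exI[of _ k] conjI k(1))
  qed
  obtain k0 :: nat where k0: "((\<lambda>e. e * Re (mangoldt_series (Complex (1 + e) 0))) \<longlongrightarrow> 1 - real k0) (at_right 0)"
    using lim[of 0] by auto
  from lim[of t] obtain k1 :: nat where k1: "k1 = 0 \<longleftrightarrow> zeta_pole (Complex 1 t) \<noteq> 0"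
      "((\<lambda>e. e * Re (mangoldt_series (Complex (1 + e) t))) \<longlongrightarrow> (if t = 0 then 1 else 0) - real k1) (at_right 0)"
    by (elim exE conjE) (rule that)
  from lim[of "2 * t"] obtain k2 :: nat where
      "((\<lambda>e. e * Re (mangoldt_series (Complex (1 + e) (2 * t)))) \<longlongrightarrow> (if 2 * t = 0 then 1 else 0) - real k2) (at_right 0)"
    by (elim exE conjE) (rule that)
  then have k2: "((\<lambda>e. e * Re (mangoldt_series (Complex (1 + e) (2 * t)))) \<longlongrightarrow> - real k2) (at_right 0)"
    using assms by (simp only: mult_eq_0_iff) simp
  have k1': "((\<lambda>e. e * Re (mangoldt_series (Complex (1 + e) t))) \<longlongrightarrow> - real k1) (at_right 0)"
    using k1(2) assms by (simp only: if_False diff_0)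
  \<comment> \<open>\<open>mangoldt_series\<close> equals \<open>1 / (s - 1)\<close> minus the
    logarithmic derivative of \<open>zeta_pole\<close>. Multiplied by \<open>e\<close>, the pole
    contributes 1 at height 0 only, and the orders \<open>k0\<close>, \<open>k1\<close>,
    \<open>k2\<close> at the heights 0, \<open>t\<close> and \<open>2 * t\<close> enter negatively.
    The consequence \<open>4 * k1 \<le> 3\<close> leaves only \<open>k1 = 0\<close>.\<close>
  have "0 \<le> 3 * (1 - real k0) + 4 * (- real k1) + - real k2"
  proof (rule tendsto_lowerbound)
    show "((\<lambda>e. 3 * (e * Re (mangoldt_series (Complex (1 + e) 0))) + 4 * (e * Re (mangoldt_series (Complex (1 + e) t)))
       + e * Re (mangoldt_series (Complex (1 + e) (2 * t)))) \<longlongrightarrow> 3 * (1 - real k0) + 4 * (- real k1) + - real k2) (at_right 0)"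
      by (intro tendsto_add tendsto_mult_left k0 k1' k2)
    show "\<forall>\<^sub>F e in at_right 0. 0 \<le> 3 * (e * Re (mangoldt_series (Complex (1 + e) 0))) + 4 * (e * Re (mangoldt_series (Complex (1 + e) t)))
       + e * Re (mangoldt_series (Complex (1 + e) (2 * t)))"
      using eventually_at_right_less[of 0]
    proof eventually_elim
      case (elim e)
      have "0 \<le> e * (3 * Re (mangoldt_series (Complex (1 + e) 0)) + 4 * Re (mangoldt_series (Complex (1 + e) t))
         + Re (mangoldt_series (Complex (1 + e) (2 * t))))"
        using elim by (intro mult_nonneg_nonneg mangoldt_series_341) auto
      then show ?case by (simp add: algebra_simps)
    qed
  qed auto
  moreover have "real k0 \<ge> 0" "real k2 \<ge> 0" by simp_all
  ultimately have "real k1 < 1" by argo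
  then have "k1 = 0" by simp
  then show ?thesis using k1(1) by simp
qed

theorem zeta_pole_nonzero:
  assumes "Re s \<ge> 1"
  shows "zeta_pole s \<noteq> 0"
proof (cases "Re s > 1")
  case False
  then have s: "s = Complex 1 (Im s)" using assms by (simp add: complex_eq_iff)
  show ?thesis
  proof (cases "Im s = 0")
    case True
    then have "s = 1" by (subst s) (simp add: complex_eq_iff)
    then show ?thesis by (simp add: zeta_pole_1)
  next
    case False
    then show ?thesis using zeta_pole_nonzero_line s by metis
  qed
qed (use zeta_pole_nonzero_right in auto)

section \<open>The prime number theorem\<close>

definition chebyshev_psi :: "nat \<Rightarrow> real" where
  "chebyshev_psi n = (\<Sum>k\<in>{1..n}. mangoldt k)"

lemma chebyshev_psi_0 [simp]: "chebyshev_psi 0 = 0"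
  by (simp add: chebyshev_psi_def)

lemma chebyshev_psi_Suc: "chebyshev_psi (Suc n) = chebyshev_psi n + mangoldt (Suc n)"
  by (simp add: chebyshev_psi_def)

lemma chebyshev_psi_nonneg: "chebyshev_psi n \<ge> 0"
  by (simp add: chebyshev_psi_def sum_nonneg mangoldt_nonneg)

lemma chebyshev_psi_mono: "m \<le> n \<Longrightarrow> chebyshev_psi m \<le> chebyshev_psi n"
  unfolding chebyshev_psi_def by (intro sum_mono2) (auto simp: mangoldt_nonneg)

lemma chebyshev_psi_diff:
  assumes "m \<le> n"
  shows "chebyshev_psi n - chebyshev_psi m = (\<Sum>k\<in>{m<..n}. mangoldt k)"
proof -
  have "{1..n} = {1..m} \<union> {m<..n}" using assms by auto
  then have "chebyshev_psi n = (\<Sum>k\<in>{1..m}. mangoldt k) + (\<Sum>k\<in>{m<..n}. mangoldt k)"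
    unfolding chebyshev_psi_def by (simp add: sum.union_disjoint disjoint_iff)
  then show ?thesis by (simp add: chebyshev_psi_def)
qed

text \<open>In the step from \<open>n\<close> to \<open>n + 1\<close> the quotient
  \<open>n div m\<close> grows by 1 exactly for the divisors \<open>m\<close> of
  \<open>n + 1\<close>, and \<open>mangoldt\<close> over these adds up to
  \<open>ln (n + 1)\<close>.\<close>

lemma sum_mangoldt_div: "(\<Sum>m\<in>{1..n}. mangoldt m * real (n div m)) = ln (fact n)"
proof (induction n)
  case (Suc n)
  have "(\<Sum>m\<in>{1..Suc n}. mangoldt m * real (Suc n div m))
      = (\<Sum>m\<in>{1..Suc n}. mangoldt m * real (n div m) + (if m dvd Suc n then mangoldt m else 0))"
    by (intro sum.cong) (auto simp: div_Suc algebra_simps dvd_eq_mod_eq_0)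
  also have "\<dots> = (\<Sum>m\<in>{1..n}. mangoldt m * real (n div m)) + (\<Sum>m\<in>{1..Suc n}. if m dvd Suc n then mangoldt m else 0)"
    by (simp add: sum.distrib)
  also have "(\<Sum>m\<in>{1..Suc n}. if m dvd Suc n then mangoldt m else 0) = (\<Sum>m\<in>{m\<in>{1..Suc n}. m dvd Suc n}. mangoldt m :: real)"
    by (rule sum.inter_filter[symmetric]) simp
  also have "{m\<in>{1..Suc n}. m dvd Suc n} = {m. m dvd Suc n}"
    by (auto simp: Suc_le_eq intro: dvd_imp_le dvd_pos_nat[of "Suc n"])
  also have "(\<Sum>m\<in>{m. m dvd Suc n}. mangoldt m) = ln (real (Suc n))"
    using mangoldt_sum[of "Suc n", where ?'a = real] by simp
  finally show ?case using Suc by (simp add: ln_mult del: of_nat_Suc)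
qed simp

text \<open>The weights \<open>2n div m - 2 * (n div m)\<close> are never negative and equal 1 for
  \<open>n < m \<le> 2n\<close>; summed against \<open>mangoldt\<close> they give the logarithm of
  the central binomial coefficient, which is at most \<open>2n * ln 2\<close>.\<close>

lemma chebyshev_psi_double_le: "chebyshev_psi (2 * n) \<le> chebyshev_psi n + 2 * real n"
proof -
  have "chebyshev_psi (2 * n) - chebyshev_psi n = (\<Sum>m\<in>{n<..2 * n}. mangoldt m * 1)"
    by (simp add: chebyshev_psi_diff)
  also have "\<dots> = (\<Sum>m\<in>{n<..2 * n}. mangoldt m * (real (2 * n div m) - 2 * real (n div m)))"
  proof (intro sum.cong refl)
    fix m assume "m \<in> {n<..2 * n}"
    then have "n div m = 0" "2 * n div m = 1"
      by (auto intro: div_nat_eqI)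
    then show "mangoldt m * 1 = mangoldt m * (real (2 * n div m) - 2 * real (n div m))" by simp
  qed
  also have "\<dots> \<le> (\<Sum>m\<in>{1..2 * n}. mangoldt m * (real (2 * n div m) - 2 * real (n div m)))"
  proof (rule sum_mono2)
    fix m assume "m \<in> {1..2 * n} - {n<..2 * n}"
    then have "m > 0" by auto
    have "2 * (n div m) \<le> 2 * n div m"
      using \<open>m > 0\<close> by (simp add: less_eq_div_iff_mult_less_eq)
    then have "2 * real (n div m) \<le> real (2 * n div m)"
      by (metis of_nat_le_iff of_nat_mult of_nat_numeral)
    then show "0 \<le> mangoldt m * (real (2 * n div m) - 2 * real (n div m))"
      by (simp add: mangoldt_nonneg)
  qed auto
  also have "\<dots> = (\<Sum>m\<in>{1..2 * n}. mangoldt m * real (2 * n div m)) - 2 * (\<Sum>m\<in>{1..2 * n}. mangoldt m * real (n div m))"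
    by (simp add: sum_subtractf sum_distrib_left algebra_simps)
  also have "(\<Sum>m\<in>{1..2 * n}. mangoldt m * real (n div m)) = (\<Sum>m\<in>{1..n}. mangoldt m * real (n div m))"
    by (rule sum.mono_neutral_right) auto
  also have "(\<Sum>m\<in>{1..2 * n}. mangoldt m * real (2 * n div m)) - 2 * (\<Sum>m\<in>{1..n}. mangoldt m * real (n div m))
      = ln (fact (2 * n)) - 2 * ln (fact n)"
    by (simp only: sum_mangoldt_div)
  also have "\<dots> = ln (real ((2 * n) choose n))"
  proof -
    have "real ((2 * n) choose n) = fact (2 * n) / (fact n * fact n)"
      using binomial_fact[of n "2 * n", where ?'a = real] by (simp add: mult_2)
    then show ?thesis by (simp add: ln_div ln_mult)
  qed
  also have "\<dots> \<le> ln (2 ^ (2 * n))"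
  proof -
    have "real ((2 * n) choose n) \<le> real (2 ^ (2 * n))"
      using binomial_le_pow2[of "2 * n" n] by (rule of_nat_mono)
    moreover have "real ((2 * n) choose n) > 0" by simp
    ultimately show ?thesis by (subst ln_le_cancel_iff) (auto simp only: of_nat_power of_nat_numeral zero_less_power zero_less_numeral)
  qed
  also have "\<dots> = 2 * real n * ln 2"
    by (simp add: ln_realpow)
  also have "\<dots> \<le> 2 * real n * 1"
    using ln_2_less_1 by (intro mult_left_mono) auto
  finally show ?thesis by simp
qed

text \<open>By halving \<open>n\<close>: the induction gives at most \<open>6k\<close> at
  \<open>2k\<close>, and the gap to \<open>8k\<close> pays for the extra term
  \<open>mangoldt (2k + 1) \<le> 2k\<close> of an odd argument.\<close>

theorem chebyshev_psi_le: "chebyshev_psi n \<le> 4 * real n"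
proof (induction n rule: less_induct)
  case (less n)
  consider "n = 0" | k where "n = 2 * k" "k > 0" | k where "n = Suc (2 * k)"
    by (metis Suc_eq_plus1 gr0I mult_0_right oddE evenE)
  then show ?case
  proof cases
    case 2
    then show ?thesis using less.IH[of k] chebyshev_psi_double_le[of k] by simp
  next
    case 3
    have "chebyshev_psi k \<le> 4 * real k" using 3 less.IH[of k] by simp
    moreover have "mangoldt (Suc (2 * k)) \<le> 2 * real k"
      using mangoldt_le[of "Suc (2 * k)"] ln_le_minus_one[of "real (Suc (2 * k))"] by simp
    ultimately show ?thesis using 3 chebyshev_psi_double_le[of k] by (simp add: chebyshev_psi_Suc)
  qed simp
qed

section \<open>The Mellin transform of \<open>psi(u) - u\<close> and its partial sums\<close>

lemma has_integral_exp_ln: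
  fixes z :: complex
  assumes z: "z \<noteq> 0" and a: "0 < a" "a \<le> b"
  shows "((\<lambda>u. exp (- (z + 1) * of_real (ln u))) has_integral
     (exp (- z * of_real (ln a)) - exp (- z * of_real (ln b))) / z) {a..b}"
proof -
  have "((\<lambda>u. exp (- (z + 1) * of_real (ln u))) has_integral
     (- exp (- z * of_real (ln b)) / z - (- exp (- z * of_real (ln a)) / z))) {a..b}"
  proof (rule fundamental_theorem_of_calculus[OF a(2)])
    fix u assume "u \<in> {a..b}"
    then have u: "u > 0" using a by auto
    have "((\<lambda>u. of_real (ln u) :: complex) has_vector_derivative of_real (1 / u)) (at u within {a..b})"
      using u by (intro has_vector_derivative_of_real) (auto intro!: derivative_eq_intros simp: has_real_derivative_iff_has_vector_derivative[symmetric] divide_inverse)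
    moreover have "((\<lambda>v. - exp (- z * v) / z) has_field_derivative exp (- z * of_real (ln u))) (at (of_real (ln u)))"
      using z by (auto intro!: derivative_eq_intros)
    ultimately have "((\<lambda>v. - exp (- z * v) / z) \<circ> (\<lambda>u. of_real (ln u)) has_vector_derivative of_real (1 / u) * exp (- z * of_real (ln u))) (at u within {a..b})"
      by (rule field_vector_diff_chain_within[OF _ has_field_derivative_at_within])
    moreover have "exp (- (z + 1) * of_real (ln u)) = of_real (1 / u) * exp (- z * of_real (ln u))"
    proof -
      have "- (z + 1) * of_real (ln u) = of_real (- ln u) + - z * of_real (ln u)"
        by (simp add: algebra_simps)
      then show ?thesis
        using u by (simp only: exp_add exp_of_real) (simp add: exp_minus divide_inverse)
    qed
    ultimately show "((\<lambda>u. - exp (- z * of_real (ln u)) / z) has_vector_derivative exp (- (z + 1) * of_real (ln u))) (at u within {a..b})"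
      by (simp add: o_def)
  qed
  then show ?thesis by (simp add: diff_divide_distrib)
qed

text \<open>As \<open>\<psi>\<close> is constant on \<open>[n, n + 1)\<close>, these add up to \<open>\<integral> (\<psi>(u) - u) u\<^sup>-\<^sup>w\<^sup>-\<^sup>2 du\<close>.\<close>

definition psi_error_term :: "nat \<Rightarrow> complex \<Rightarrow> complex" where
  "psi_error_term n w = integral {real n..real (Suc n)}
     (\<lambda>u. of_real (chebyshev_psi n - u) * exp (- (w + 2) * of_real (ln u)))"

lemma psi_error_term_holomorphic:
  assumes "n > 0"
  shows "psi_error_term n holomorphic_on UNIV"
proof -
  have "(\<lambda>w. integral (cbox (real n) (real (Suc n))) (\<lambda>u. of_real (chebyshev_psi n - u) * exp (- (w + 2) * of_real (ln u)))) holomorphic_on UNIV"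
  \<comment> \<open>With the power of \<open>u\<close> written through \<open>exp\<close> and
    \<open>ln\<close>, the integrand is entire in \<open>w\<close> and jointly continuous.\<close>
  proof (rule leibniz_rule_holomorphic)
    fix w :: complex and u :: real
    show "((\<lambda>w. of_real (chebyshev_psi n - u) * exp (- (w + 2) * of_real (ln u))) has_field_derivative
       of_real (chebyshev_psi n - u) * (exp (- (w + 2) * of_real (ln u)) * - of_real (ln u))) (at w within UNIV)"
      by (auto intro!: derivative_eq_intros)
    show "(\<lambda>u. of_real (chebyshev_psi n - u) * exp (- (w + 2) * of_real (ln u))) integrable_on cbox (real n) (real (Suc n))"
      using assms by (intro integrable_continuous continuous_intros) auto
  next
    show "continuous_on (UNIV \<times> cbox (real n) (real (Suc n)))
       (\<lambda>(w :: complex, u). of_real (chebyshev_psi n - u) * (exp (- (w + 2) * of_real (ln u)) * - of_real (ln u)))"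
      using assms unfolding case_prod_unfold by (intro continuous_intros) auto
  qed auto
  then show ?thesis unfolding psi_error_term_def by simp
qed

lemma psi_error_term_eq:
  assumes n: "n > 0" and w: "w \<noteq> 0" "w \<noteq> - 1"
  shows "psi_error_term n w = of_real (chebyshev_psi n) / (w + 1) * (of_nat n powr (- (w + 1)) - of_nat (Suc n) powr (- (w + 1)))
     - (of_nat n powr (- w) - of_nat (Suc n) powr (- w)) / w"
proof -
  let ?I = "{real n..real (Suc n)}"
  have e: "exp (- z * of_real (ln (real m))) = of_nat m powr (- z)" if "m > 0" for m and z :: complex
    using that by (simp add: powr_def Ln_of_nat)
  have w1: "w + 1 \<noteq> 0" using w by (simp add: add_eq_0_iff2)
  have "((\<lambda>u. exp (- (w + 1 + 1) * of_real (ln u))) has_integral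
     (exp (- (w + 1) * of_real (ln (real n))) - exp (- (w + 1) * of_real (ln (real (Suc n))))) / (w + 1)) ?I"
    using n by (intro has_integral_exp_ln w1) auto
  from has_integral_diff[OF has_integral_mult_right[OF this, of "of_real (chebyshev_psi n)"]
      has_integral_exp_ln[OF w(1), of "real n" "real (Suc n)"]]
  have "((\<lambda>u. of_real (chebyshev_psi n) * exp (- (w + 1 + 1) * of_real (ln u)) - exp (- (w + 1) * of_real (ln u))) has_integral
     (of_real (chebyshev_psi n) * ((exp (- (w + 1) * of_real (ln (real n))) - exp (- (w + 1) * of_real (ln (real (Suc n))))) / (w + 1))
     - (exp (- w * of_real (ln (real n))) - exp (- w * of_real (ln (real (Suc n))))) / w)) ?I"
    using n by simp
  then have "((\<lambda>u. of_real (chebyshev_psi n - u) * exp (- (w + 2) * of_real (ln u))) has_integral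
     (of_real (chebyshev_psi n) * ((exp (- (w + 1) * of_real (ln (real n))) - exp (- (w + 1) * of_real (ln (real (Suc n))))) / (w + 1))
     - (exp (- w * of_real (ln (real n))) - exp (- w * of_real (ln (real (Suc n))))) / w)) ?I"
  proof (rule has_integral_eq[rotated])
    fix u assume "u \<in> ?I"
    then have "u > 0" using n by simp
    have "- (w + 1) * of_real (ln u) = of_real (ln u) + - (w + 2) * of_real (ln u)"
      by (simp add: algebra_simps)
    then have "exp (- (w + 1) * of_real (ln u)) = of_real u * exp (- (w + 2) * of_real (ln u))"
      using \<open>u > 0\<close> by (simp only: exp_add exp_of_real exp_ln)
    moreover have "w + 1 + 1 = w + 2" by simp
    ultimately show "of_real (chebyshev_psi n) * exp (- (w + 1 + 1) * of_real (ln u)) - exp (- (w + 1) * of_real (ln u))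
      = of_real (chebyshev_psi n - u) * exp (- (w + 2) * of_real (ln u))"
      by (simp only: of_real_diff left_diff_distrib)
  qed
  from integral_unique[OF this] show ?thesis
    unfolding psi_error_term_def by (simp only: e[OF n] e[OF zero_less_Suc] times_divide_eq_right times_divide_eq_left)
qed

text \<open>On \<open>[n, n + 1]\<close> Chebyshev's bound gives
  \<open>|psi(n) - u| \<le> 4u\<close>. The factor \<open>|Re w|\<close> clears the denominator of
  the power integral, so that the bounds telescope; it is also the factor in the hypotheses of
  \<open>newman_tauberian\<close>.\<close>

lemma norm_psi_error_term_le:
  assumes n: "n > 0"
  shows "\<bar>Re w\<bar> * cmod (psi_error_term n w) \<le> 4 * \<bar>real n powr (- Re w) - real (Suc n) powr (- Re w)\<bar>"
proof (cases "Re w = 0")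
  case False
  let ?I = "{real n..real (Suc n)}" let ?x = "Re w"
  let ?J = "(real n powr (- ?x) - real (Suc n) powr (- ?x)) / ?x"
  have eq1: "(\<lambda>u. exp (- (?x + 1) * ln u)) = (\<lambda>u. Re (exp (- (of_real ?x + 1) * of_real (ln u))))"
    by (simp add: Re_exp fun_eq_iff)
  have eq2: "?J = Re ((exp (- of_real ?x * of_real (ln (real n))) - exp (- of_real ?x * of_real (ln (real (Suc n))))) / of_real ?x)"
    unfolding Re_divide_of_real minus_complex.sel Re_exp using n by (simp add: powr_def)
  have J: "((\<lambda>u. exp (- (?x + 1) * ln u)) has_integral ?J) ?I"
    unfolding eq1 eq2 using n False by (intro has_integral_Re has_integral_exp_ln) auto
  have "cmod (psi_error_term n w) \<le> integral ?I (\<lambda>u. 4 * exp (- (?x + 1) * ln u))"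
    unfolding psi_error_term_def
  proof (rule integral_norm_bound_integral)
    show "(\<lambda>u. of_real (chebyshev_psi n - u) * exp (- (w + 2) * of_real (ln u))) integrable_on ?I"
      using n by (intro integrable_continuous_real continuous_intros) auto
    show "(\<lambda>u. 4 * exp (- (?x + 1) * ln u)) integrable_on ?I"
      using n by (intro integrable_continuous_real continuous_intros) auto
    fix u assume u: "u \<in> ?I"
    then have "u > 0" using n by simp
    have "\<bar>chebyshev_psi n - u\<bar> \<le> 4 * u"
      using chebyshev_psi_le[of n] chebyshev_psi_nonneg[of n] u \<open>u > 0\<close> by auto
    then have "\<bar>chebyshev_psi n - u\<bar> * exp (- (?x + 2) * ln u) \<le> 4 * u * exp (- (?x + 2) * ln u)"
      by (intro mult_right_mono) auto
    also have "\<dots> = 4 * (exp (ln u) * exp (- (?x + 2) * ln u))" using \<open>u > 0\<close> by simp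
    also have "exp (ln u) * exp (- (?x + 2) * ln u) = exp (- (?x + 1) * ln u)"
      by (simp add: exp_add[symmetric] algebra_simps)
    finally show "norm (of_real (chebyshev_psi n - u) * exp (- (w + 2) * of_real (ln u))) \<le> 4 * exp (- (?x + 1) * ln u)"
      by (simp only: norm_mult norm_of_real norm_exp_eq_Re) simp
  qed
  also have "\<dots> = 4 * ?J"
    using J by (intro integral_unique has_integral_mult_right)
  finally have "\<bar>?x\<bar> * cmod (psi_error_term n w) \<le> \<bar>?x\<bar> * (4 * ?J)"
    by (intro mult_left_mono) auto
  also have "\<dots> \<le> \<bar>?x * (4 * ?J)\<bar>" by (subst abs_mult) (rule mult_left_mono[OF abs_ge_self abs_ge_zero])
  also have "?x * (4 * ?J) = 4 * (real n powr (- ?x) - real (Suc n) powr (- ?x))"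
    using False by (simp del: of_nat_Suc)
  also have "\<bar>\<dots>\<bar> = 4 * \<bar>real n powr (- ?x) - real (Suc n) powr (- ?x)\<bar>"
    by (simp only: abs_mult abs_numeral)
  finally show ?thesis .
qed simp

text \<open>Summation by parts: the jumps of psi are the values of \<open>mangoldt\<close>.\<close>

lemma sum_psi_error_terms:
  assumes w: "Re w > 0"
  shows "(\<Sum>n\<in>{1..N}. psi_error_term n w) =
    ((\<Sum>n\<in>{1..N}. mangoldt n * of_nat n powr (- (w + 1))) - of_real (chebyshev_psi N) * of_nat (Suc N) powr (- (w + 1))) / (w + 1)
    - (1 - of_nat (Suc N) powr (- w)) / w"
proof (induction N)
  case (Suc N)
  have "w \<noteq> 0" "w \<noteq> -1" using w by auto
  then have "psi_error_term (Suc N) w = of_real (chebyshev_psi (Suc N)) / (w + 1) * (of_nat (Suc N) powr (- (w + 1)) - of_nat (Suc (Suc N)) powr (- (w + 1)))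
     - (of_nat (Suc N) powr (- w) - of_nat (Suc (Suc N)) powr (- w)) / w"
    by (intro psi_error_term_eq) auto
  moreover have "(S - p * x) / q - (1 - y) / v + ((p + l) / q * (x - x') - (y - y') / v) = (S + l * x - (p + l) * x') / q - (1 - y') / v"
    for S p x q y v l x' y' :: complex
    by (simp add: divide_inverse algebra_simps)
  ultimately show ?case
    using Suc by (simp add: chebyshev_psi_Suc del: of_nat_Suc)
qed (use w in auto)

text \<open>With \<open>s = w + 1\<close> this is
  \<open>- zeta'(s) / (s * zeta(s)) - 1 / (s - 1)\<close>. Expressed by \<open>zeta_pole\<close>,
  the two poles at \<open>w = 0\<close> have already cancelled.\<close>

definition psi_laplace :: "complex \<Rightarrow> complex" where
  "psi_laplace w = (- (deriv zeta_pole (w + 1) / zeta_pole (w + 1)) - 1) / (w + 1)"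

lemma psi_laplace_holomorphic:
  obtains U where "open U" "{w. Re w \<ge> 0} \<subseteq> U" "psi_laplace holomorphic_on U"
proof
  let ?S = "{s. Re s > 0}"
  have S: "open ?S" by (rule open_halfspace_Re_gt)
  note H = zeta_pole_holomorphic_and_sums(1)
  define V where "V = {s \<in> ?S. zeta_pole s \<in> - {0}}"
  have "open (?S \<inter> zeta_pole -` (- {0}))"
    by (rule continuous_open_preimage[OF holomorphic_on_imp_continuous_on[OF H] S]) auto
  also have "?S \<inter> zeta_pole -` (- {0}) = V" by (auto simp: V_def)
  finally have V: "open V" .
  define U where "U = (\<lambda>w. w + 1) -` V"
  show "open U" unfolding U_def
    by (rule open_vimage[OF V]) (intro continuous_intros)
  show "{w. Re w \<ge> 0} \<subseteq> U"
    using zeta_pole_nonzero by (auto simp: U_def V_def)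
  have G: "(\<lambda>s. (- (deriv zeta_pole s / zeta_pole s) - 1) / s) holomorphic_on V"
    by (intro holomorphic_on_divide holomorphic_on_diff holomorphic_on_minus holomorphic_on_const holomorphic_on_ident
        holomorphic_on_subset[OF H] holomorphic_on_subset[OF holomorphic_deriv[OF H S]]) (auto simp: V_def)
  have "(\<lambda>s. (- (deriv zeta_pole s / zeta_pole s) - 1) / s) \<circ> (\<lambda>w. w + 1) holomorphic_on U"
    by (rule holomorphic_on_compose_gen[OF _ G]) (auto intro!: holomorphic_intros simp: U_def)
  then show "psi_laplace holomorphic_on U"
    by (simp add: psi_laplace_def[abs_def] o_def)
qed

lemma psi_laplace_eq:
  assumes w: "Re w > 0"
  shows "psi_laplace w = mangoldt_series (w + 1) / (w + 1) - 1 / w"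
proof -
  have s: "Re (w + 1) > 1" using w by simp
  have "deriv zeta_pole (w + 1) / zeta_pole (w + 1) = 1 / w - mangoldt_series (w + 1)"
    using log_deriv_zeta_pole[OF s] zeta_pole_nonzero_right[OF s] by simp
  moreover have "(- (1 / v - l) - 1) / (v + 1) = l / (v + 1) - 1 / v" if "v \<noteq> 0" "v + 1 \<noteq> 0" for v l :: complex
    using that by (simp add: divide_simps)
  moreover have "w \<noteq> 0" using w by auto
  moreover have "w + 1 \<noteq> 0" using w by (auto simp: complex_eq_iff)
  ultimately show ?thesis unfolding psi_laplace_def by (simp only:)
qed

text \<open>By Chebyshev's bound, the boundary term left by the summation by parts is
  \<open>O(N powr (- Re w))\<close>.\<close>

lemma psi_error_terms_tendsto:
  assumes w: "Re w > 0"
  shows "(\<lambda>N. \<Sum>n\<in>{1..N}. psi_error_term n w) \<longlonglongrightarrow> psi_laplace w"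
proof -
  let ?L = "\<lambda>N. \<Sum>n\<in>{1..N}. mangoldt n * of_nat n powr (- (w + 1)) :: complex"
  have w1: "w + 1 \<noteq> 0" "w \<noteq> 0" using w by (auto simp: complex_eq_iff)
  have "(\<lambda>N. \<Sum>n<Suc N. mangoldt n * of_nat n powr (- (w + 1))) \<longlonglongrightarrow> mangoldt_series (w + 1)"
    using mangoldt_series_sums[of "w + 1"] w unfolding sums_def by (intro LIMSEQ_Suc) auto
  also have "(\<lambda>N. \<Sum>n<Suc N. mangoldt n * of_nat n powr (- (w + 1))) = ?L"
    by (intro ext sum.mono_neutral_right) (auto simp: Suc_le_eq)
  finally have lim1: "?L \<longlonglongrightarrow> mangoldt_series (w + 1)" .
  have pow0: "(\<lambda>N. real (Suc N) powr (- Re w)) \<longlonglongrightarrow> 0"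
    using w by (intro LIMSEQ_Suc tendsto_neg_powr filterlim_real_sequentially) auto
  have lim2: "(\<lambda>N. of_nat (Suc N) powr (- w) :: complex) \<longlonglongrightarrow> 0"
    by (rule tendsto_norm_zero_cancel) (use pow0 in \<open>simp only: norm_nat_powr_complex uminus_complex.sel\<close>)
  have lim3: "(\<lambda>N. of_real (chebyshev_psi N) * of_nat (Suc N) powr (- (w + 1)) :: complex) \<longlonglongrightarrow> 0"
  proof (rule Lim_null_comparison)
    show "\<forall>\<^sub>F N in sequentially. norm (of_real (chebyshev_psi N) * of_nat (Suc N) powr (- (w + 1)) :: complex) \<le> 4 * real (Suc N) powr (- Re w)"
    proof (intro always_eventually allI)
      fix N
      have "norm (of_real (chebyshev_psi N) * of_nat (Suc N) powr (- (w + 1)) :: complex) = chebyshev_psi N * real (Suc N) powr (- Re w - 1)"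
        using chebyshev_psi_nonneg[of N] by (simp add: norm_mult norm_nat_powr_complex del: of_nat_Suc)
      also have "\<dots> \<le> (4 * real (Suc N)) * real (Suc N) powr (- Re w - 1)"
        using chebyshev_psi_le[of N] by (intro mult_right_mono) auto
      also have "\<dots> = 4 * (real (Suc N) powr 1 * real (Suc N) powr (- Re w - 1))" by simp
      also have "real (Suc N) powr 1 * real (Suc N) powr (- Re w - 1) = real (Suc N) powr (- Re w)"
        by (simp only: powr_add[symmetric]) simp
      finally show "norm (of_real (chebyshev_psi N) * of_nat (Suc N) powr (- (w + 1)) :: complex) \<le> 4 * real (Suc N) powr (- Re w)" .
    qed
    show "(\<lambda>N. 4 * real (Suc N) powr (- Re w)) \<longlonglongrightarrow> 0"
      using tendsto_mult_left[OF pow0, of 4] by (simp only: mult_zero_right)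
  qed
  have "(\<lambda>N. (?L N - of_real (chebyshev_psi N) * of_nat (Suc N) powr (- (w + 1))) / (w + 1) - (1 - of_nat (Suc N) powr (- w)) / w)
     \<longlonglongrightarrow> (mangoldt_series (w + 1) - 0) / (w + 1) - (1 - 0) / w"
    by (intro tendsto_diff tendsto_divide lim1 lim2 lim3 tendsto_const w1)
  then show ?thesis
    by (simp only: sum_psi_error_terms[OF w] psi_laplace_eq[OF w] diff_zero)
qed

lemma sum_powr_telescope:
  "M \<le> N \<Longrightarrow> (\<Sum>n\<in>{Suc M..N}. real n powr x - real (Suc n) powr x) = real (Suc M) powr x - real (Suc N) powr x"
  by (induction N rule: dec_induct) (simp_all del: of_nat_Suc)

text \<open>All differences of consecutive powers have the same sign, which depends on that of
  \<open>Re w\<close>; the sum of their moduli is therefore the modulus of a telescoping sum. Both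
  signs occur, since Newman's theorem asks for bounds on either side of the imaginary axis.\<close>

lemma norm_sum_psi_error_terms_le:
  assumes "M \<le> N"
  shows "\<bar>Re w\<bar> * cmod (\<Sum>n\<in>{Suc M..N}. psi_error_term n w) \<le> 4 * \<bar>real (Suc M) powr (- Re w) - real (Suc N) powr (- Re w)\<bar>"
proof -
  have "\<bar>Re w\<bar> * cmod (\<Sum>n\<in>{Suc M..N}. psi_error_term n w) \<le> \<bar>Re w\<bar> * (\<Sum>n\<in>{Suc M..N}. cmod (psi_error_term n w))"
    by (intro mult_left_mono norm_sum) auto
  also have "\<dots> \<le> (\<Sum>n\<in>{Suc M..N}. 4 * \<bar>real n powr (- Re w) - real (Suc n) powr (- Re w)\<bar>)"
    unfolding sum_distrib_left by (intro sum_mono norm_psi_error_term_le) auto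
  also have "\<dots> = 4 * \<bar>\<Sum>n\<in>{Suc M..N}. real n powr (- Re w) - real (Suc n) powr (- Re w)\<bar>"
  proof (cases "Re w \<ge> 0")
    case True
    then have *: "real n powr (- Re w) - real (Suc n) powr (- Re w) \<ge> 0" if "n > 0" for n
      using that powr_mono2'[of "- Re w" "real n" "real (Suc n)"] by simp
    then have "(\<Sum>n\<in>{Suc M..N}. real n powr (- Re w) - real (Suc n) powr (- Re w)) \<ge> 0"
      by (intro sum_nonneg *) auto
    moreover have "(\<Sum>n\<in>{Suc M..N}. 4 * \<bar>real n powr (- Re w) - real (Suc n) powr (- Re w)\<bar>)
        = (\<Sum>n\<in>{Suc M..N}. 4 * (real n powr (- Re w) - real (Suc n) powr (- Re w)))"
      by (intro sum.cong refl) (simp add: abs_of_nonneg[OF *] del: of_nat_Suc)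
    ultimately show ?thesis by (simp only: abs_of_nonneg sum_distrib_left)
  next
    case False
    then have *: "real n powr (- Re w) - real (Suc n) powr (- Re w) \<le> 0" if "n > 0" for n
      using that powr_mono2[of "- Re w" "real n" "real (Suc n)"] by simp
    then have "(\<Sum>n\<in>{Suc M..N}. real n powr (- Re w) - real (Suc n) powr (- Re w)) \<le> 0"
      by (intro sum_nonpos *) auto
    moreover have "(\<Sum>n\<in>{Suc M..N}. 4 * \<bar>real n powr (- Re w) - real (Suc n) powr (- Re w)\<bar>)
        = (\<Sum>n\<in>{Suc M..N}. 4 * - (real n powr (- Re w) - real (Suc n) powr (- Re w)))"
      by (intro sum.cong refl) (simp add: abs_of_nonpos[OF *] del: of_nat_Suc)
    ultimately show ?thesis by (simp only: abs_of_nonpos sum_negf flip: sum_distrib_left)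
  qed
  finally show ?thesis by (simp only: sum_powr_telescope[OF assms])
qed

text \<open>The point 0 lies on the boundary of the half-plane in which convergence is known. The
  scale is \<open>L = ln (N + 1)\<close>, since \<open>exp (- L * Re w)\<close> is then the power of
  \<open>N + 1\<close> that the telescoped bounds produce.\<close>

theorem psi_error_terms_at_0_tendsto:
  "(\<lambda>N. \<Sum>n\<in>{1..N}. psi_error_term n 0) \<longlonglongrightarrow> psi_laplace 0"
proof -
  obtain U where U: "open U" "{w. Re w \<ge> 0} \<subseteq> U" "psi_laplace holomorphic_on U"
    by (rule psi_laplace_holomorphic)
  have exp_ln: "exp (- ln (real (Suc N)) * x) = real (Suc N) powr (- x)" for N x
    by (simp add: powr_def)
  show ?thesis
  proof (rule newman_tauberian[OF U, where L = "\<lambda>N. ln (real (Suc N))" and C = 4])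
    show "(\<lambda>w. \<Sum>n\<in>{1..N}. psi_error_term n w) holomorphic_on UNIV" for N
      by (intro holomorphic_intros psi_error_term_holomorphic) auto
    show "filterlim (\<lambda>N. ln (real (Suc N))) at_top sequentially"
      by (rule filterlim_compose[OF ln_at_top filterlim_compose[OF filterlim_real_sequentially filterlim_Suc]])
    show "- Re w * cmod (\<Sum>n\<in>{1..N}. psi_error_term n w) \<le> 4 * exp (- ln (real (Suc N)) * Re w)" if "Re w \<le> 0" for N w
    proof -
      have "\<bar>Re w\<bar> * cmod (\<Sum>n\<in>{Suc 0..N}. psi_error_term n w) \<le> 4 * \<bar>real (Suc 0) powr (- Re w) - real (Suc N) powr (- Re w)\<bar>"
        by (rule norm_sum_psi_error_terms_le) simp
      also have "\<bar>real (Suc 0) powr (- Re w) - real (Suc N) powr (- Re w)\<bar> \<le> real (Suc N) powr (- Re w)"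
        using that ge_one_powr_ge_zero[of "real (Suc N)" "- Re w"] by simp
      finally have "- Re w * cmod (\<Sum>n\<in>{1..N}. psi_error_term n w) \<le> 4 * real (Suc N) powr (- Re w)"
        using that by (simp del: of_nat_Suc)
      then show ?thesis by (simp only: exp_ln)
    qed
    show "Re w * cmod (psi_laplace w - (\<Sum>n\<in>{1..N}. psi_error_term n w)) \<le> 4 * exp (- ln (real (Suc N)) * Re w)" if "Re w \<ge> 0" for N w
    proof (cases "Re w = 0")
      case False
      with that have w: "Re w > 0" by simp
      have "Re w * cmod (psi_laplace w - (\<Sum>n\<in>{1..N}. psi_error_term n w)) \<le> 4 * real (Suc N) powr (- Re w)"
      \<comment> \<open>The tail of the series is bounded through its finite segments from
        \<open>N + 1\<close> to \<open>M\<close>.\<close>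
      proof (rule tendsto_upperbound)
        show "(\<lambda>M. Re w * cmod ((\<Sum>n\<in>{1..M}. psi_error_term n w) - (\<Sum>n\<in>{1..N}. psi_error_term n w)))
            \<longlonglongrightarrow> Re w * cmod (psi_laplace w - (\<Sum>n\<in>{1..N}. psi_error_term n w))"
          by (intro tendsto_mult_left tendsto_norm tendsto_diff tendsto_const psi_error_terms_tendsto w)
        show "\<forall>\<^sub>F M in sequentially. Re w * cmod ((\<Sum>n\<in>{1..M}. psi_error_term n w) - (\<Sum>n\<in>{1..N}. psi_error_term n w)) \<le> 4 * real (Suc N) powr (- Re w)"
        proof (rule eventually_sequentiallyI)
          fix M assume M: "M \<ge> N"
          have "{1..M} = {1..N} \<union> {Suc N..M}" using M by auto
          then have "(\<Sum>n\<in>{1..M}. psi_error_term n w) - (\<Sum>n\<in>{1..N}. psi_error_term n w) = (\<Sum>n\<in>{Suc N..M}. psi_error_term n w)"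
            by (simp add: sum.union_disjoint disjoint_iff)
          moreover have "\<bar>real (Suc N) powr (- Re w) - real (Suc M) powr (- Re w)\<bar> \<le> real (Suc N) powr (- Re w)"
            using powr_mono2'[of "- Re w" "real (Suc N)" "real (Suc M)"] M w by simp
          ultimately show "Re w * cmod ((\<Sum>n\<in>{1..M}. psi_error_term n w) - (\<Sum>n\<in>{1..N}. psi_error_term n w)) \<le> 4 * real (Suc N) powr (- Re w)"
            using norm_sum_psi_error_terms_le[OF M, of w] w by simp
        qed
      qed auto
      then show ?thesis by (simp only: exp_ln)
    qed simp
  qed auto
qed

section \<open>From the convergent integral to the asymptotics of psi\<close>

definition psi_error :: "nat \<Rightarrow> real" where
  "psi_error n = chebyshev_psi n * (1 / real n - 1 / real (Suc n)) - (ln (real (Suc n)) - ln (real n))"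

lemma psi_error_term_at_0:
  assumes n: "n > 0"
  shows "psi_error_term n 0 = of_real (psi_error n)"
proof -
  let ?I = "{real n..real (Suc n)}"
  have "((\<lambda>u. chebyshev_psi n / u ^ 2 - 1 / u) has_integral
     ((- chebyshev_psi n / real (Suc n) - ln (real (Suc n))) - (- chebyshev_psi n / real n - ln (real n)))) ?I"
  proof (rule fundamental_theorem_of_calculus)
    fix u assume "u \<in> ?I"
    then have "u > 0" using n by simp
    then have "((\<lambda>u. - chebyshev_psi n / u - ln u) has_real_derivative (chebyshev_psi n / u ^ 2 - 1 / u)) (at u within ?I)"
      by (auto intro!: derivative_eq_intros simp: power2_eq_square divide_inverse)
    then show "((\<lambda>u. - chebyshev_psi n / u - ln u) has_vector_derivative (chebyshev_psi n / u ^ 2 - 1 / u)) (at u within ?I)"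
      by (simp add: has_real_derivative_iff_has_vector_derivative)
  qed simp
  moreover have "(- chebyshev_psi n / real (Suc n) - ln (real (Suc n))) - (- chebyshev_psi n / real n - ln (real n)) = psi_error n"
    by (simp add: psi_error_def right_diff_distrib)
  ultimately have "((\<lambda>u. chebyshev_psi n / u ^ 2 - 1 / u) has_integral psi_error n) ?I" by simp
  from has_integral_linear[OF this bounded_linear_of_real]
  have "((\<lambda>u. of_real (chebyshev_psi n / u ^ 2 - 1 / u) :: complex) has_integral of_real (psi_error n)) ?I"
    by (simp only: o_def)
  then have "((\<lambda>u. of_real (chebyshev_psi n - u) * exp (- (0 + 2) * of_real (ln u)) :: complex) has_integral of_real (psi_error n)) ?I"
  proof (rule has_integral_eq[rotated])
    fix u assume "u \<in> ?I"
    then have u: "u > 0" using n by simp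
    have "exp (- (0 + 2) * of_real (ln u) :: complex) = of_real (exp (- (2 * ln u)))"
      by (simp add: exp_of_real[symmetric])
    also have "exp (- (2 * ln u)) = 1 / u ^ 2"
      using u by (simp add: exp_minus exp_double divide_inverse)
    finally have e: "exp (- (0 + 2) * of_real (ln u) :: complex) = of_real (1 / u ^ 2)" .
    have "chebyshev_psi n / u ^ 2 - 1 / u = (chebyshev_psi n - u) * (1 / u ^ 2)"
      using u by (simp add: field_simps power2_eq_square)
    then show "of_real (chebyshev_psi n / u ^ 2 - 1 / u) = of_real (chebyshev_psi n - u) * exp (- (0 + 2) * of_real (ln u) :: complex)"
      by (simp only: e of_real_mult)
  qed
  then show ?thesis unfolding psi_error_term_def by (rule integral_unique)
qed

lemma summable_psi_error_Cauchy:
  assumes "e > 0"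
  obtains N0 where "\<And>M N. N0 \<le> M \<Longrightarrow> M \<le> N \<Longrightarrow> \<bar>\<Sum>n\<in>{M..<N}. psi_error n\<bar> < e"
proof -
  have "(\<lambda>N. \<Sum>n\<in>{1..N}. psi_error_term n 0) = (\<lambda>N. of_real (\<Sum>n\<in>{1..N}. psi_error n))"
    by (simp add: psi_error_term_at_0)
  with psi_error_terms_at_0_tendsto have "Cauchy (\<lambda>N. complex_of_real (\<Sum>n\<in>{1..N}. psi_error n))"
    using LIMSEQ_imp_Cauchy by metis
  then obtain N0 where N0: "\<And>M N. M \<ge> N0 \<Longrightarrow> N \<ge> N0 \<Longrightarrow> dist (complex_of_real (\<Sum>n\<in>{1..M}. psi_error n)) (complex_of_real (\<Sum>n\<in>{1..N}. psi_error n)) < e"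
    using assms unfolding Cauchy_def by blast
  show ?thesis
  proof (rule that[of "Suc N0"])
    fix M N assume MN: "Suc N0 \<le> M" "M \<le> N"
    have "{1..N - 1} = {1..M - 1} \<union> {M..<N}" using MN by auto
    then have "(\<Sum>n\<in>{1..N - 1}. psi_error n) = (\<Sum>n\<in>{1..M - 1}. psi_error n) + (\<Sum>n\<in>{M..<N}. psi_error n)"
      by (simp only:) (rule sum.union_disjoint; use MN in auto)
    moreover have "\<bar>(\<Sum>n\<in>{1..N - 1}. psi_error n) - (\<Sum>n\<in>{1..M - 1}. psi_error n)\<bar> < e"
      using N0[of "N - 1" "M - 1"] MN unfolding dist_norm of_real_diff[symmetric] norm_of_real by simp
    ultimately show "\<bar>\<Sum>n\<in>{M..<N}. psi_error n\<bar> < e" by simp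
  qed
qed

lemma sum_reciprocal_telescope:
  "M \<le> N \<Longrightarrow> (\<Sum>n\<in>{M..<N}. 1 / real n - 1 / real (Suc n)) = 1 / real M - 1 / real N"
  by (induction N rule: dec_induct) (simp_all del: of_nat_Suc)

lemma sum_ln_telescope:
  "M \<le> N \<Longrightarrow> (\<Sum>n\<in>{M..<N}. ln (real (Suc n)) - ln (real n)) = ln (real N) - ln (real M)"
  by (induction N rule: dec_induct) (simp_all del: of_nat_Suc)

text \<open>Monotonicity replaces psi by its value at the left end; the remaining sums telescope,
  and \<open>ln x \<le> x - 1\<close> makes the bound rational. \<open>sum_psi_error_le\<close> is
  the mirror image, with the right end.\<close>

lemma sum_psi_error_ge:
  assumes "0 < M" "M \<le> N"
  shows "(\<Sum>n\<in>{M..<N}. psi_error n) \<ge> chebyshev_psi M * (1 / real M - 1 / real N) - (real N / real M - 1)"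
proof -
  have "chebyshev_psi M * (1 / real M - 1 / real N) - (ln (real N) - ln (real M))
      = (\<Sum>n\<in>{M..<N}. chebyshev_psi M * (1 / real n - 1 / real (Suc n)) - (ln (real (Suc n)) - ln (real n)))"
    unfolding sum_subtractf[of "\<lambda>n. chebyshev_psi M * (1 / real n - 1 / real (Suc n))"] sum_ln_telescope[OF assms(2)]
      sum_distrib_left[symmetric] sum_reciprocal_telescope[OF assms(2)] ..
  also have "\<dots> \<le> (\<Sum>n\<in>{M..<N}. psi_error n)"
    unfolding psi_error_def
    by (intro sum_mono diff_right_mono mult_right_mono chebyshev_psi_mono) (use assms in \<open>auto simp: frac_le\<close>)
  finally have "chebyshev_psi M * (1 / real M - 1 / real N) - (ln (real N) - ln (real M)) \<le> (\<Sum>n\<in>{M..<N}. psi_error n)" .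
  moreover have "ln (real N) - ln (real M) \<le> real N / real M - 1"
    using ln_le_minus_one[of "real N / real M"] assms by (simp add: ln_div)
  ultimately show ?thesis by linarith
qed

lemma sum_psi_error_le:
  assumes "0 < M" "M \<le> N"
  shows "(\<Sum>n\<in>{M..<N}. psi_error n) \<le> chebyshev_psi N * (1 / real M - 1 / real N) - (1 - real M / real N)"
proof -
  have "(\<Sum>n\<in>{M..<N}. psi_error n) \<le> (\<Sum>n\<in>{M..<N}. chebyshev_psi N * (1 / real n - 1 / real (Suc n)) - (ln (real (Suc n)) - ln (real n)))"
    unfolding psi_error_def
    by (intro sum_mono diff_right_mono mult_right_mono chebyshev_psi_mono) (use assms in \<open>auto simp: frac_le\<close>)
  also have "\<dots> = chebyshev_psi N * (1 / real M - 1 / real N) - (ln (real N) - ln (real M))"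
    unfolding sum_subtractf[of "\<lambda>n. chebyshev_psi N * (1 / real n - 1 / real (Suc n))"] sum_ln_telescope[OF assms(2)]
      sum_distrib_left[symmetric] sum_reciprocal_telescope[OF assms(2)] ..
  finally have "(\<Sum>n\<in>{M..<N}. psi_error n) \<le> chebyshev_psi N * (1 / real M - 1 / real N) - (ln (real N) - ln (real M))" .
  moreover have "ln (real M) - ln (real N) \<le> real M / real N - 1"
    using ln_le_minus_one[of "real M / real N"] assms by (simp add: ln_div)
  ultimately show ?thesis by linarith
qed

theorem prime_number_theorem_psi:
  assumes "e > 0"
  shows "\<forall>\<^sub>F N in sequentially. \<bar>chebyshev_psi N - real N\<bar> \<le> e * real N"
proof -
  \<comment> \<open>The deviation of \<open>psi(N) / N\<close> from 1 will come out as at most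
    \<open>4 * \<delta>\<close>; the bound 1/8 keeps the blocks on either side of \<open>N\<close>
    no longer than \<open>N / 4\<close>.\<close>
  define \<delta> where "\<delta> = min (e / 5) (1 / 8)"
  have \<delta>: "\<delta> > 0" "\<delta> \<le> 1 / 8" "5 * \<delta> \<le> e" using assms by (auto simp: \<delta>_def)
  \<comment> \<open>A block of relative length \<open>\<delta>\<close> on which psi is off by a
    factor \<open>p\<close> contributes about \<open>(p - 1) * \<delta>\<close>. A Cauchy bound of
    \<open>\<delta>^2\<close> therefore forces \<open>p - 1 = O(\<delta>)\<close>.\<close>
  obtain N0 where N0: "\<And>M N. N0 \<le> M \<Longrightarrow> M \<le> N \<Longrightarrow> \<bar>\<Sum>n\<in>{M..<N}. psi_error n\<bar> < \<delta> ^ 2"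
    using summable_psi_error_Cauchy[of "\<delta> ^ 2"] \<delta> by auto
  show ?thesis
  proof (rule eventually_sequentiallyI)
    fix N assume N: "N \<ge> 2 * N0 + nat \<lceil>1 / \<delta>\<rceil> + 8"
    have "1 / \<delta> \<le> real N" using N by linarith
    then have N1: "1 \<le> \<delta> * real N" using \<delta> by (simp add: field_simps)
    define D where "D = nat \<lceil>\<delta> * real N\<rceil>"
    have D: "\<delta> * real N \<le> real D" "real D \<le> 2 * \<delta> * real N"
      using N1 unfolding D_def by linarith+
    have Npos: "real N > 0" using N by simp
    have Dpos: "real D > 0" using D(1) N1 by linarith
    have "2 * \<delta> * real N \<le> 2 * (1 / 8) * real N" using \<delta> Npos by (intro mult_right_mono) auto
    then have D4: "real D \<le> real N / 4" using D(2) by simp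
    define p where "p = chebyshev_psi N / real N"
    have psi: "chebyshev_psi N = p * real N" using Npos by (simp add: p_def)
    \<comment> \<open>The block after \<open>N\<close>, where psi is at least \<open>psi(N)\<close>,
      bounds \<open>p\<close> from above.\<close>
    have "chebyshev_psi N * (1 / real N - 1 / real (N + D)) - (real (N + D) / real N - 1) \<le> \<delta>^2"
      using sum_psi_error_ge[of N "N + D"] N0[of N "N + D"] N by linarith
    moreover have "chebyshev_psi N * (1 / real N - 1 / real (N + D)) - (real (N + D) / real N - 1) = p * (real D / real (N + D)) - real D / real N"
    proof -
      have "real N * (1 / real N - 1 / real (N + D)) = real D / real (N + D)"
      proof -
        have "x * (1 / x - 1 / y) = (y - x) / y" if "x > 0" "y > 0" for x y :: real
          using that by (simp add: field_simps)
        from this[of "real N" "real (N + D)"] show ?thesis using Npos by simp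
      qed
      moreover have "real (N + D) / real N - 1 = real D / real N"
        using Npos by (simp add: field_simps)
      ultimately show ?thesis by (simp only: psi mult.assoc)
    qed
    ultimately have "p * (real D / real (N + D)) \<le> real D / real N + \<delta>^2" by linarith
    then have "p * real D \<le> (real D / real N + \<delta>^2) * real (N + D)"
      using Npos by (simp add: field_simps)
    also have "\<dots> = real D + real D * (real D / real N) + \<delta> * (\<delta> * real N) + \<delta>^2 * real D"
      using Npos by (simp add: field_simps power2_eq_square)
    also have "\<dots> \<le> real D + real D * (2 * \<delta>) + \<delta> * real D + \<delta> * real D"
    proof -
      have "real D / real N \<le> 2 * \<delta>" using D(2) Npos by (simp add: field_simps)
      moreover have "\<delta>^2 * real D \<le> \<delta> * real D"
        using \<delta> by (intro mult_right_mono) (auto simp: power2_eq_square mult_le_cancel_left1)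
      ultimately show ?thesis using D(1) \<delta>
        by (intro add_mono mult_left_mono) auto
    qed
    also have "\<dots> = (1 + 4 * \<delta>) * real D" by (simp add: algebra_simps)
    finally have upper: "p \<le> 1 + 4 * \<delta>" using Dpos by simp
    have DN: "D \<le> N" "N0 \<le> N - D" "real (N - D) = real N - real D" "0 < N - D"
      using D4 N by linarith+
    \<comment> \<open>The block before \<open>N\<close>, where psi is at most \<open>psi(N)\<close>,
      bounds \<open>p\<close> from below.\<close>
    have "- (\<delta>^2) \<le> chebyshev_psi N * (1 / real (N - D) - 1 / real N) - (1 - real (N - D) / real N)"
      using sum_psi_error_le[of "N - D" N] N0[of "N - D" N] DN by linarith
    moreover have "chebyshev_psi N * (1 / real (N - D) - 1 / real N) - (1 - real (N - D) / real N) = p * (real D / (real N - real D)) - real D / real N"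
      using Npos DN by (simp add: psi field_simps)
    ultimately have "real D / real N - \<delta>^2 \<le> p * real D / (real N - real D)" by simp
    then have "(real D / real N - \<delta>^2) * (real N - real D) \<le> p * real D"
      using DN(3,4) by (simp add: pos_le_divide_eq)
    moreover have "(real D / real N - \<delta>^2) * (real N - real D) = real D - real D * (real D / real N) - \<delta> * (\<delta> * real N) + \<delta>^2 * real D"
      using Npos by (simp add: field_simps power2_eq_square)
    moreover have "real D - real D * (2 * \<delta>) - \<delta> * real D + 0 \<le> real D - real D * (real D / real N) - \<delta> * (\<delta> * real N) + \<delta>^2 * real D"
    proof -
      have "real D / real N \<le> 2 * \<delta>" using D(2) Npos by (simp add: field_simps)
      then show ?thesis using D(1) \<delta>
        by (intro add_mono diff_mono mult_left_mono) auto
    qed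
    ultimately have "(1 - 3 * \<delta>) * real D \<le> p * real D" by (simp add: algebra_simps)
    then have lower: "1 - 3 * \<delta> \<le> p" using Dpos by simp
    have "\<bar>p - 1\<bar> \<le> e" using upper lower \<delta> by linarith
    then have "\<bar>p - 1\<bar> * real N \<le> e * real N" by (intro mult_right_mono) auto
    also have "\<bar>p - 1\<bar> * real N = \<bar>(p - 1) * real N\<bar>" by (simp add: abs_mult)
    also have "(p - 1) * real N = chebyshev_psi N - real N" by (simp add: psi left_diff_distrib)
    finally show "\<bar>chebyshev_psi N - real N\<bar> \<le> e * real N" .
  qed
qed

section \<open>Brun's pure sieve\<close>

lemma card_cong_interval:
  fixes m c d :: int and l :: nat
  assumes d: "d > 0"
  shows "\<bar>real (card {n \<in> {m..<m + int l}. [n = c] (mod d)}) - real l / real_of_int d\<bar> \<le> 1"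
proof -
  \<comment> \<open>\<open>A\<close> and \<open>B\<close> are the least \<open>k\<close> for which
    \<open>c + d * k\<close> reaches \<open>m\<close> and \<open>m + l\<close>; the arguments of the
    two ceilings differ by exactly \<open>l / d\<close>.\<close>
  define A where "A = \<lceil>real_of_int (m - c) / real_of_int d\<rceil>"
  define B where "B = \<lceil>real_of_int (m - c) / real_of_int d + real l / real_of_int d\<rceil>"
  have dr: "real_of_int d > 0" using d by simp
  have "A \<le> B" unfolding A_def B_def using dr by (intro ceiling_mono) simp
  have A: "A \<le> k \<longleftrightarrow> m \<le> c + d * k" for k
  proof -
    have "A \<le> k \<longleftrightarrow> real_of_int (m - c) \<le> real_of_int (d * k)"
      unfolding A_def ceiling_le_iff using dr by (simp add: pos_divide_le_eq mult.commute)
    then show ?thesis by (simp only: of_int_le_iff) linarith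
  qed
  have B: "B \<le> k \<longleftrightarrow> m + int l \<le> c + d * k" for k
  proof -
    have "B \<le> k \<longleftrightarrow> real_of_int (m - c + int l) \<le> real_of_int (d * k)"
      unfolding B_def ceiling_le_iff using dr by (simp add: pos_divide_le_eq mult.commute flip: add_divide_distrib)
    then show ?thesis by (simp only: of_int_le_iff) linarith
  qed
  have "{n \<in> {m..<m + int l}. [n = c] (mod d)} = (\<lambda>k. c + d * k) ` {A..<B}"
  proof (intro equalityI subsetI)
    fix n assume n: "n \<in> {n \<in> {m..<m + int l}. [n = c] (mod d)}"
    then have "[c = n] (mod d)" by (simp add: cong_sym)
    then obtain k where k: "n = c + d * k" by (auto simp: cong_iff_lin)
    have "A \<le> k" "\<not> B \<le> k" using n by (auto simp: A B k)
    then show "n \<in> (\<lambda>k. c + d * k) ` {A..<B}" using k by auto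
  next
    fix n assume "n \<in> (\<lambda>k. c + d * k) ` {A..<B}"
    then obtain k where "n = c + d * k" "k \<in> {A..<B}" by blast
    then have k: "n = c + d * k" "A \<le> k" "\<not> B \<le> k" by auto
    then show "n \<in> {n \<in> {m..<m + int l}. [n = c] (mod d)}"
      by (auto simp: A B cong_def)
  qed
  moreover have "inj_on (\<lambda>k. c + d * k) {A..<B}" using d by (auto simp: inj_on_def)
  ultimately have "card {n \<in> {m..<m + int l}. [n = c] (mod d)} = nat (B - A)"
    by (simp add: card_image)
  then have "real (card {n \<in> {m..<m + int l}. [n = c] (mod d)}) = real_of_int B - real_of_int A"
    using \<open>A \<le> B\<close> by simp
  then show ?thesis unfolding A_def B_def by linarith
qed

lemma prod_primes_dvd_iff:
  assumes "finite U" "\<And>p. p \<in> U \<Longrightarrow> prime p"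
  shows "int (\<Prod>U) dvd n \<longleftrightarrow> (\<forall>p\<in>U. int p dvd n)"
  using assms
proof (induction U rule: finite_induct)
  case (insert p U)
  have "coprime p (\<Prod>U)"
    using insert by (intro prod_coprime_right primes_coprime) auto
  then have "coprime (int p) (int (\<Prod>U))" by (simp only: coprime_int_iff)
  then have "int p * int (\<Prod>U) dvd n \<longleftrightarrow> int p dvd n \<and> int (\<Prod>U) dvd n"
    by (metis divides_mult dvd_mult_left dvd_mult_right)
  then show ?case using insert by simp
qed simp

text \<open>By the Chinese remainder theorem the conditions single out one residue class modulo the
  product of all primes involved.\<close>

lemma card_dvd_pair_interval:
  fixes m h :: int and l :: nat
  assumes U: "finite U" "\<And>p. p \<in> U \<Longrightarrow> prime p" and V: "finite V" "\<And>p. p \<in> V \<Longrightarrow> prime p"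
    and disj: "U \<inter> V = {}"
  shows "\<bar>real (card {n \<in> {m..<m + int l}. (\<forall>p\<in>U. int p dvd n) \<and> (\<forall>p\<in>V. int p dvd n + h)}) - real l / real (\<Prod>(U \<union> V))\<bar> \<le> 1"
proof -
  have "coprime (\<Prod>U) (\<Prod>V)"
    using U V disj by (intro prod_coprime_left prod_coprime_right primes_coprime) auto
  then have cop: "coprime (int (\<Prod>U)) (int (\<Prod>V))" by (simp only: coprime_int_iff)
  then obtain c where c: "[c = 0] (mod int (\<Prod>U))" "[c = - h] (mod int (\<Prod>V))"
    using binary_chinese_remainder_int by blast
  have eq: "(\<forall>p\<in>U. int p dvd n) \<and> (\<forall>p\<in>V. int p dvd n + h) \<longleftrightarrow> [n = c] (mod int (\<Prod>(U \<union> V)))" for n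
  proof -
    have "(\<forall>p\<in>U. int p dvd n) \<and> (\<forall>p\<in>V. int p dvd n + h) \<longleftrightarrow> int (\<Prod>U) dvd n \<and> int (\<Prod>V) dvd n + h"
      by (simp only: prod_primes_dvd_iff[OF U] prod_primes_dvd_iff[OF V])
    also have "\<dots> \<longleftrightarrow> [n = 0] (mod int (\<Prod>U)) \<and> [n = - h] (mod int (\<Prod>V))"
      by (simp add: cong_iff_dvd_diff)
    also have "\<dots> \<longleftrightarrow> [n = c] (mod int (\<Prod>U)) \<and> [n = c] (mod int (\<Prod>V))"
      using cong_trans[OF _ c(1)] cong_trans[OF _ cong_sym[OF c(1)]] cong_trans[OF _ c(2)] cong_trans[OF _ cong_sym[OF c(2)]]
      by blast
    also have "\<dots> \<longleftrightarrow> [n = c] (mod int (\<Prod>U) * int (\<Prod>V))"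
    proof
      assume "[n = c] (mod int (\<Prod>U)) \<and> [n = c] (mod int (\<Prod>V))"
      then show "[n = c] (mod int (\<Prod>U) * int (\<Prod>V))"
        using cop by (intro coprime_cong_mult) auto
    next
      assume n: "[n = c] (mod int (\<Prod>U) * int (\<Prod>V))"
      then have "[n = c] (mod int (\<Prod>V) * int (\<Prod>U))" by (simp only: mult.commute)
      with n show "[n = c] (mod int (\<Prod>U)) \<and> [n = c] (mod int (\<Prod>V))"
        by (blast intro: cong_modulus_mult)
    qed
    also have "int (\<Prod>U) * int (\<Prod>V) = int (\<Prod>(U \<union> V))"
      by (simp only: prod.union_disjoint[OF U(1) V(1) disj] of_nat_mult)
    finally show ?thesis .
  qed
  have "\<Prod>(U \<union> V) > 0"
    using U V by (intro prod_pos) (auto dest: prime_gt_0_nat)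
  then have "int (\<Prod>(U \<union> V)) > 0" by (simp only: of_nat_0_less_iff)
  from card_cong_interval[OF this, of m l c] show ?thesis
    by (simp only: eq of_int_of_nat_eq)
qed

text \<open>A prime not dividing \<open>h\<close> divides at most one of \<open>n\<close> and
  \<open>n + h\<close>. Hence the \<open>n\<close> in question are split by the set \<open>U\<close>
  of those primes of \<open>T\<close> that divide \<open>n\<close>: \<open>2 ^ card T\<close>
  disjoint classes, each with an error of at most 1.\<close>

lemma card_dvd_product_interval:
  fixes m h :: int and l :: nat
  assumes T: "finite T" "\<And>p. p \<in> T \<Longrightarrow> prime p" "\<And>p. p \<in> T \<Longrightarrow> \<not> int p dvd h"
  shows "\<bar>real (card {n \<in> {m..<m + int l}. \<forall>p\<in>T. int p dvd n * (n + h)}) - real l * (\<Prod>p\<in>T. 2 / real p)\<bar> \<le> 2 ^ card T"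
proof -
  let ?N = "\<lambda>U. {n \<in> {m..<m + int l}. (\<forall>p\<in>U. int p dvd n) \<and> (\<forall>p\<in>T - U. int p dvd n + h)}"
  have not_both: "\<not> (int p dvd n \<and> int p dvd n + h)" if "p \<in> T" for p n
    using T(3)[OF that] by (metis add_diff_cancel_left' dvd_diff)
  have "{n \<in> {m..<m + int l}. \<forall>p\<in>T. int p dvd n * (n + h)} = (\<Union>U\<in>Pow T. ?N U)"
  proof (intro equalityI subsetI)
    fix n assume n: "n \<in> {n \<in> {m..<m + int l}. \<forall>p\<in>T. int p dvd n * (n + h)}"
    have "int p dvd n + h" if "p \<in> T" "\<not> int p dvd n" for p
      using n that T(2)[OF that(1)] prime_dvd_mult_iff[of "int p" n "n + h"] by auto
    then have "n \<in> ?N {p \<in> T. int p dvd n}" using n by auto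
    then show "n \<in> (\<Union>U\<in>Pow T. ?N U)"
      by (rule UN_I[rotated]) auto
  next
    fix n assume "n \<in> (\<Union>U\<in>Pow T. ?N U)"
    then obtain U where "U \<in> Pow T" and U: "n \<in> ?N U" by (rule UN_E)
    then have "int p dvd n * (n + h)" if "p \<in> T" for p
      using that by (cases "p \<in> U") auto
    then show "n \<in> {n \<in> {m..<m + int l}. \<forall>p\<in>T. int p dvd n * (n + h)}" using U by auto
  qed
  moreover have "card (\<Union>U\<in>Pow T. ?N U) = (\<Sum>U\<in>Pow T. card (?N U))"
  proof (rule card_UN_disjoint)
    show "\<forall>U\<in>Pow T. \<forall>V\<in>Pow T. U \<noteq> V \<longrightarrow> ?N U \<inter> ?N V = {}"
    proof (intro ballI impI)
      fix U V assume UV: "U \<in> Pow T" "V \<in> Pow T" "U \<noteq> V"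
      show "?N U \<inter> ?N V = {}"
      proof (rule equals0I)
        fix n assume n: "n \<in> ?N U \<inter> ?N V"
        have "W = {p \<in> T. int p dvd n}" if "W \<in> Pow T" "n \<in> ?N W" for W
          using that not_both[of _ n] by blast
        then have "U = V" using n UV by blast
        with UV show False by simp
      qed
    qed
    show "\<forall>U\<in>Pow T. finite (?N U)"
      by (rule ballI, rule finite_subset[of _ "{m..<m + int l}"]) auto
  qed (simp add: T(1))
  ultimately have card_eq: "real (card {n \<in> {m..<m + int l}. \<forall>p\<in>T. int p dvd n * (n + h)}) = (\<Sum>U\<in>Pow T. real (card (?N U)))"
    by (simp only: of_nat_sum)
  have "real l * (\<Prod>p\<in>T. 2 / real p) = (\<Sum>U\<in>Pow T. real l / real (\<Prod>T))"
    using T(1) by (simp add: card_Pow prod_dividef)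
  then have "\<bar>real (card {n \<in> {m..<m + int l}. \<forall>p\<in>T. int p dvd n * (n + h)}) - real l * (\<Prod>p\<in>T. 2 / real p)\<bar>
      = \<bar>\<Sum>U\<in>Pow T. real (card (?N U)) - real l / real (\<Prod>T)\<bar>"
    unfolding card_eq by (simp only: sum_subtractf)
  also have "\<dots> \<le> (\<Sum>U\<in>Pow T. \<bar>real (card (?N U)) - real l / real (\<Prod>T)\<bar>)"
    by (rule sum_abs)
  also have "\<dots> \<le> (\<Sum>U\<in>Pow T. 1)"
  proof (rule sum_mono)
    fix U assume "U \<in> Pow T"
    then have U: "U \<subseteq> T" "U \<union> (T - U) = T" "finite U" using T(1) finite_subset by auto
    show "\<bar>real (card (?N U)) - real l / real (\<Prod>T)\<bar> \<le> 1"
      using card_dvd_pair_interval[of U "T - U" m l h] T U by (auto simp: subset_iff)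
  qed
  also have "\<dots> = 2 ^ card T" using T(1) by (simp add: card_Pow)
  finally show ?thesis .
qed

text \<open>The alternating sum of binomial coefficients up to an even \<open>r\<close> is
  \<open>(card B - 1) gchoose r\<close>. For nonempty \<open>B\<close> this is an ordinary binomial
  coefficient, hence nonnegative; for empty \<open>B\<close> it is
  \<open>(-1) gchoose r = 1\<close>.\<close>

lemma bonferroni_truncated:
  assumes B: "finite B" and r: "even r"
  shows "(if B = {} then 1 else 0 :: real) \<le> (\<Sum>T\<in>{T \<in> Pow B. card T \<le> r}. (- 1) ^ card T)"
proof -
  have "(\<Sum>T\<in>{T \<in> Pow B. card T \<le> r}. (- 1) ^ card T) = (\<Sum>k\<in>{..r}. \<Sum>T | T \<in> {T \<in> Pow B. card T \<le> r} \<and> card T = k. (- 1 :: real) ^ card T)"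
    using B by (intro sum.group[symmetric]) auto
  also have "\<dots> = (\<Sum>k\<le>r. (real (card B) gchoose k) * (- 1) ^ k)"
  proof (rule sum.cong)
    fix k assume "k \<in> {..r}"
    then have "{T. T \<in> {T \<in> Pow B. card T \<le> r} \<and> card T = k} = {T. T \<subseteq> B \<and> card T = k}" by auto
    then show "(\<Sum>T | T \<in> {T \<in> Pow B. card T \<le> r} \<and> card T = k. (- 1 :: real) ^ card T) = (real (card B) gchoose k) * (- 1) ^ k"
      using n_subsets[OF B, of k] by (simp add: binomial_gbinomial)
  qed auto
  also have "\<dots> = (- 1) ^ r * (real (card B) - 1 gchoose r)"
    by (rule gbinomial_sum_lower_neg)
  also have "\<dots> \<ge> (if B = {} then 1 else 0)"
  proof (cases "B = {}")
    case True
    have "(- 1 :: real) gchoose r = (- 1) ^ r * (of_nat r gchoose r)"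
      using gbinomial_minus[of "1 :: real" r] by simp
    then show ?thesis using True r by (simp add: binomial_gbinomial[symmetric])
  next
    case False
    then have "real (card B) - 1 = real (card B - 1)"
      using B by (simp add: of_nat_diff Suc_le_eq card_gt_0_iff)
    then have "(real (card B) - 1) gchoose r = real ((card B - 1) choose r)"
      by (simp only: binomial_gbinomial)
    then show ?thesis using False r by simp
  qed
  finally show ?thesis .
qed

lemma sum_Pow_prod:
  fixes f :: "'a \<Rightarrow> real"
  assumes "finite Q"
  shows "(\<Sum>T\<in>Pow Q. \<Prod>p\<in>T. f p) = (\<Prod>p\<in>Q. 1 + f p)"
  using prod_add[OF assms, of f "\<lambda>_. 1"] by (simp add: add.commute)

lemma exp_1_less_3: "exp 1 < (3 :: real)"
  using e_less_272 by simp

text \<open>Both error sums of Brun's pure sieve are bounded by Rankin's trick: the indicator of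
  \<open>card T > r\<close> is at most \<open>exp (card T - r)\<close>, that of \<open>card T \<le> r\<close> at most \<open>y ^ r / y ^ card T\<close>.\<close>

theorem brun_pure_sieve:
  fixes m h :: int and l r :: nat and y :: real
  assumes Q: "finite Q" "\<And>p. p \<in> Q \<Longrightarrow> prime p" "\<And>p. p \<in> Q \<Longrightarrow> \<not> int p dvd h"
    and r: "even r" and y: "y \<ge> 1" "real (card Q) \<le> y"
  shows "real (card {n \<in> {m..<m + int l}. \<forall>p\<in>Q. \<not> int p dvd n * (n + h)})
    \<le> real l * ((\<Prod>p\<in>Q. 1 - 2 / real p) + exp (6 * (\<Sum>p\<in>Q. 1 / real p) - real r)) + 9 * y ^ r"
proof -
  let ?I = "{m..<m + int l}"
  define B where "B = (\<lambda>n. {p \<in> Q. int p dvd n * (n + h)})"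
  define P where "P = {T \<in> Pow Q. card T \<le> r}"
  define g where "g = (\<lambda>T. \<Prod>p\<in>T. 2 / real p)"
  have finP: "finite P" using Q by (simp add: P_def)
  have finT: "finite T" if "T \<in> Pow Q" for T using that Q finite_subset by auto
  have g_nonneg: "g T \<ge> 0" for T unfolding g_def by (intro prod_nonneg) simp
  have "real (card {n \<in> ?I. \<forall>p\<in>Q. \<not> int p dvd n * (n + h)}) = (\<Sum>n\<in>?I. if B n = {} then 1 else 0)"
    by (simp add: sum.If_cases B_def Int_def) (rule arg_cong[where f = card], auto)
  also have "\<dots> \<le> (\<Sum>n\<in>?I. \<Sum>T\<in>{T \<in> Pow (B n). card T \<le> r}. (- 1) ^ card T)"
    using Q(1) r by (intro sum_mono bonferroni_truncated) (auto simp: B_def)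
  also have "\<dots> = (\<Sum>n\<in>?I. \<Sum>T\<in>P. if T \<subseteq> B n then (- 1) ^ card T else 0)"
    by (intro sum.cong refl sum.mono_neutral_cong_left) (use finP in \<open>auto simp: P_def B_def\<close>)
  also have "\<dots> = (\<Sum>T\<in>P. \<Sum>n\<in>?I. if T \<subseteq> B n then (- 1) ^ card T else 0)"
    by (rule sum.swap)
  also have "\<dots> = (\<Sum>T\<in>P. (- 1) ^ card T * real (card {n \<in> ?I. \<forall>p\<in>T. int p dvd n * (n + h)}))"
  proof (rule sum.cong)
    fix T assume "T \<in> P"
    then have "{n \<in> ?I. T \<subseteq> B n} = {n \<in> ?I. \<forall>p\<in>T. int p dvd n * (n + h)}"
      by (auto simp: P_def B_def)
    then show "(\<Sum>n\<in>?I. if T \<subseteq> B n then (- 1) ^ card T else 0) = (- 1) ^ card T * real (card {n \<in> ?I. \<forall>p\<in>T. int p dvd n * (n + h)})"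
      by (simp add: sum.If_cases Int_def)
  qed simp
  also have "\<dots> \<le> (\<Sum>T\<in>P. (- 1) ^ card T * (real l * g T) + 2 ^ card T)"
  proof (rule sum_mono)
    fix T assume T: "T \<in> P"
    have signed_le: "s * a \<le> s * b + c" if "\<bar>a - b\<bar> \<le> c" "s = 1 \<or> s = - 1" for a b c s :: real
      using that by auto
    have "\<bar>real (card {n \<in> ?I. \<forall>p\<in>T. int p dvd n * (n + h)}) - real l * g T\<bar> \<le> 2 ^ card T"
      unfolding g_def by (rule card_dvd_product_interval) (use T Q finT in \<open>auto simp: P_def\<close>)
    moreover have "(- 1 :: real) ^ card T = 1 \<or> (- 1 :: real) ^ card T = - 1"
      by (cases "even (card T)") auto
    ultimately show "(- 1) ^ card T * real (card {n \<in> ?I. \<forall>p\<in>T. int p dvd n * (n + h)}) \<le> (- 1) ^ card T * (real l * g T) + 2 ^ card T"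
      by (rule signed_le)
  qed
  also have "\<dots> = real l * (\<Sum>T\<in>P. (- 1) ^ card T * g T) + (\<Sum>T\<in>P. 2 ^ card T)"
    by (simp add: sum.distrib sum_distrib_left mult.left_commute)
  also have "\<dots> \<le> real l * ((\<Prod>p\<in>Q. 1 - 2 / real p) + exp (6 * (\<Sum>p\<in>Q. 1 / real p) - real r)) + 9 * y ^ r"
  proof (intro add_mono mult_left_mono)
    have signed: "(- 1) ^ card T * g T = (\<Prod>p\<in>T. - (2 / real p))" if "T \<in> Pow Q" for T
      unfolding g_def prod_uminus ..
    \<comment> \<open>The sum over all subsets factorises into the sieve product; what the
      truncation leaves out is estimated in absolute value.\<close>
    have split: "(\<Sum>T\<in>P. (- 1) ^ card T * g T) = (\<Sum>T\<in>Pow Q. (- 1) ^ card T * g T) - (\<Sum>T\<in>Pow Q - P. (- 1) ^ card T * g T)"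
      using Q(1) by (subst sum_diff) (auto simp: P_def)
    have "(\<Sum>T\<in>Pow Q. (- 1) ^ card T * g T) = (\<Sum>T\<in>Pow Q. \<Prod>p\<in>T. - (2 / real p))"
      by (intro sum.cong refl signed)
    also have "\<dots> = (\<Prod>p\<in>Q. 1 - 2 / real p)"
      by (subst sum_Pow_prod[OF Q(1)]) simp
    finally have main: "(\<Sum>T\<in>Pow Q. (- 1) ^ card T * g T) = (\<Prod>p\<in>Q. 1 - 2 / real p)" .
    have "- (\<Sum>T\<in>Pow Q - P. (- 1) ^ card T * g T) \<le> (\<Sum>T\<in>Pow Q - P. g T)"
      unfolding sum_negf[symmetric]
    proof (rule sum_mono)
      show "- ((- 1) ^ card T * g T) \<le> g T" for T
        using g_nonneg[of T] by (cases "even (card T)") auto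
    qed
    also have "\<dots> \<le> (\<Sum>T\<in>Pow Q - P. exp (- real r) * (\<Prod>p\<in>T. exp 1 * (2 / real p)))"
    proof (rule sum_mono)
      fix T assume "T \<in> Pow Q - P"
      then have "card T > r" by (auto simp: P_def)
      then have "1 * g T \<le> (exp (- real r) * exp 1 ^ card T) * g T"
        using g_nonneg by (intro mult_right_mono) (auto simp flip: exp_of_nat_mult exp_add)
      then show "g T \<le> exp (- real r) * (\<Prod>p\<in>T. exp 1 * (2 / real p))"
        by (simp only: g_def prod.distrib prod_constant mult.assoc mult_1_left)
    qed
    also have "\<dots> \<le> (\<Sum>T\<in>Pow Q. exp (- real r) * (\<Prod>p\<in>T. exp 1 * (2 / real p)))"
      using Q(1) by (intro sum_mono2) (auto intro!: mult_nonneg_nonneg prod_nonneg)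
    also have "\<dots> = exp (- real r) * (\<Prod>p\<in>Q. 1 + exp 1 * (2 / real p))"
      by (simp only: sum_distrib_left[symmetric] sum_Pow_prod[OF Q(1)])
    \<comment> \<open>The constant 6 of the statement bounds \<open>2 * exp 1\<close>.\<close>
    also have "(\<Prod>p\<in>Q. 1 + exp 1 * (2 / real p)) \<le> (\<Prod>p\<in>Q. exp (6 * (1 / real p)))"
    proof (rule prod_mono)
      fix p assume "p \<in> Q"
      have "exp 1 * (2 / real p) \<le> 3 * (2 / real p)"
        using exp_1_less_3 by (intro mult_right_mono) auto
      then have "1 + exp 1 * (2 / real p) \<le> 1 + 6 * (1 / real p)" by simp
      also have "\<dots> \<le> exp (6 * (1 / real p))" by (rule exp_ge_add_one_self)
      finally show "0 \<le> 1 + exp 1 * (2 / real p) \<and> 1 + exp 1 * (2 / real p) \<le> exp (6 * (1 / real p))"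
        by (simp add: add_nonneg_nonneg)
    qed
    also have "\<dots> = exp (6 * (\<Sum>p\<in>Q. 1 / real p))"
      by (simp only: exp_sum[OF Q(1)] sum_distrib_left)
    also have "exp (- real r) * exp (6 * (\<Sum>p\<in>Q. 1 / real p)) = exp (6 * (\<Sum>p\<in>Q. 1 / real p) - real r)"
      by (simp add: exp_add[symmetric])
    finally show "(\<Sum>T\<in>P. (- 1) ^ card T * g T) \<le> (\<Prod>p\<in>Q. 1 - 2 / real p) + exp (6 * (\<Sum>p\<in>Q. 1 / real p) - real r)"
      using split main by simp
  next
    have "(\<Sum>T\<in>P. (2::real) ^ card T) \<le> (\<Sum>T\<in>P. y ^ r * (\<Prod>p\<in>T. 2 / y))"
    proof (rule sum_mono)
      fix T assume "T \<in> P"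
      then have "y ^ card T \<le> y ^ r" using y by (auto simp: P_def intro: power_increasing)
      then have "2 ^ card T * y ^ card T \<le> y ^ r * 2 ^ card T" by (simp add: mult.commute)
      then show "2 ^ card T \<le> y ^ r * (\<Prod>p\<in>T. 2 / y)"
        using y by (simp add: power_divide field_simps)
    qed
    also have "\<dots> \<le> (\<Sum>T\<in>Pow Q. y ^ r * (\<Prod>p\<in>T. 2 / y))"
      using Q(1) y by (intro sum_mono2) (auto simp: P_def)
    also have "\<dots> = y ^ r * (1 + 2 / y) ^ card Q"
      by (simp only: sum_distrib_left[symmetric] sum_Pow_prod[OF Q(1)]) simp
    \<comment> \<open>As \<open>card Q \<le> y\<close>, this is at most \<open>exp 2\<close>, and 9
      is a bound for that.\<close>
    also have "(1 + 2 / y) ^ card Q \<le> exp (2 / y) ^ card Q"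
      using y by (intro power_mono exp_ge_add_one_self) auto
    also have "exp (2 / y) ^ card Q = exp (real (card Q) * (2 / y))"
      by (rule exp_of_nat_mult[symmetric])
    also have "\<dots> \<le> exp 2"
      using y by (simp add: field_simps)
    also have "exp 2 = exp 1 * exp (1 :: real)" by (simp flip: exp_add)
    also have "\<dots> \<le> 3 * 3" using exp_1_less_3 by (intro mult_mono) auto
    finally show "(\<Sum>T\<in>P. (2::real) ^ card T) \<le> 9 * y ^ r"
      using y by (simp add: mult_left_mono mult.commute)
  qed simp
  finally show ?thesis .
qed

section \<open>Sparseness of prime pairs\<close>

lemma inverse_nat_le_1: "1 / real n \<le> 1"
  by (cases n) auto

text \<open>One direction of Euler's product, without geometric series: a number counted for
  \<open>insert p Q\<close> that is divisible by \<open>p\<close> is \<open>p\<close> times another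
  such number, so the sum \<open>s\<close> satisfies
  \<open>s (insert p Q) \<le> s Q + s (insert p Q) / p\<close>. The cut-off at \<open>N\<close>
  survives the division by \<open>p\<close>.\<close>

lemma sum_reciprocals_smooth_le:
  assumes "finite Q" "\<And>p. p \<in> Q \<Longrightarrow> prime p"
  shows "(\<Sum>n\<in>{n \<in> {1..N}. prime_factors n \<subseteq> Q}. 1 / real n) * (\<Prod>p\<in>Q. 1 - 1 / real p) \<le> 1"
  using assms
proof (induction Q arbitrary: N rule: finite_induct)
  case empty
  have "{n \<in> {1..N}. prime_factors n \<subseteq> {}} \<subseteq> {1 :: nat}"
    by (auto simp: prime_factorization_empty_iff)
  then have "(\<Sum>n\<in>{n \<in> {1..N}. prime_factors n \<subseteq> {}}. 1 / real n) \<le> (\<Sum>n\<in>{1}. 1 / real n)"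
    by (intro sum_mono2) auto
  then show ?case by simp
next
  case (insert p Q)
  have p: "prime p" "p > 1" using insert.prems[of p] prime_gt_1_nat by auto
  define W where "W = (\<lambda>Q. {n \<in> {1..N}. prime_factors n \<subseteq> Q})"
  define s where "s = (\<lambda>Q. \<Sum>n\<in>W Q. 1 / real n)"
  have fin: "finite (W R)" for R unfolding W_def by simp
  have "W (insert p Q) \<subseteq> W Q \<union> (\<lambda>m. p * m) ` W (insert p Q)"
  proof
    fix n assume n: "n \<in> W (insert p Q)"
    show "n \<in> W Q \<union> (\<lambda>m. p * m) ` W (insert p Q)"
    proof (cases "p dvd n")
      case True
      then obtain m where m: "n = p * m" by auto
      have "m \<noteq> 0" using n m by (auto simp: W_def)
      then have "prime_factors m \<subseteq> prime_factors n" "m \<le> n" "m \<ge> 1"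
        using m p by (auto simp: prime_factors_product)
      then have "m \<in> W (insert p Q)" using n by (auto simp: W_def)
      then show ?thesis using m by auto
    next
      case False
      then have "p \<notin> prime_factors n" by (auto simp: prime_factors_dvd)
      then show ?thesis using n by (auto simp: W_def)
    qed
  qed
  then have "s (insert p Q) \<le> (\<Sum>n\<in>W Q \<union> (\<lambda>m. p * m) ` W (insert p Q). 1 / real n)"
    unfolding s_def using fin by (intro sum_mono2) auto
  also have "\<dots> \<le> s Q + (\<Sum>n\<in>(\<lambda>m. p * m) ` W (insert p Q). 1 / real n)"
    unfolding s_def using fin by (subst sum_Un) (auto intro: sum_nonneg)
  also have "(\<Sum>n\<in>(\<lambda>m. p * m) ` W (insert p Q). 1 / real n) = (\<Sum>m\<in>W (insert p Q). 1 / real (p * m))"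
    using p by (subst sum.reindex) (auto simp: inj_on_def)
  also have "\<dots> = s (insert p Q) / real p"
    by (simp add: s_def sum_divide_distrib mult.commute)
  finally have "s (insert p Q) * (1 - 1 / real p) \<le> s Q" by (simp add: right_diff_distrib)
  moreover have "(\<Prod>p\<in>Q. 1 - 1 / real p) \<ge> 0"
    by (intro prod_nonneg) (simp add: inverse_nat_le_1)
  ultimately have "s (insert p Q) * (1 - 1 / real p) * (\<Prod>p\<in>Q. 1 - 1 / real p) \<le> s Q * (\<Prod>p\<in>Q. 1 - 1 / real p)"
    by (rule mult_right_mono)
  also have "\<dots> \<le> 1" using insert.IH[of N] insert.prems by (simp add: s_def W_def)
  finally show ?case using insert.hyps by (simp add: s_def W_def mult.assoc)
qed

text \<open>Every \<open>n \<le> N\<close> has all its prime factors up to \<open>N\<close>, so the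
  harmonic sum is one of those controlled by the Euler product.\<close>

lemma prod_primes_le_inverse_ln:
  "(\<Prod>p\<in>{p. prime p \<and> p \<le> N}. 1 - 1 / real p) * ln (real (Suc N)) \<le> 1"
proof -
  let ?Q = "{p :: nat. prime p \<and> p \<le> N}"
  have nonneg: "(\<Prod>p\<in>?Q. 1 - 1 / real p) \<ge> 0"
    by (intro prod_nonneg) (simp add: inverse_nat_le_1)
  have eq: "{n \<in> {1..N}. prime_factors n \<subseteq> ?Q} = {1..N}"
    by (auto simp: prime_factors_dvd dest!: dvd_imp_le)
  have "(\<Sum>n\<in>{n \<in> {1..N}. prime_factors n \<subseteq> ?Q}. 1 / real n) * (\<Prod>p\<in>?Q. 1 - 1 / real p) \<le> 1"
    by (rule sum_reciprocals_smooth_le) auto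
  then have "(\<Sum>n\<in>{1..N}. 1 / real n) * (\<Prod>p\<in>?Q. 1 - 1 / real p) \<le> 1"
    by (simp only: eq)
  then have *: "(\<Prod>p\<in>?Q. 1 - 1 / real p) * (\<Sum>n\<in>{1..N}. 1 / real n) \<le> 1"
    by (simp only: mult.commute)
  have "ln (real (Suc N)) \<le> (\<Sum>n\<in>{1..N}. 1 / real n)"
    using ln_le_harm[of N] by (simp add: harm_def divide_inverse add.commute)
  then have "(\<Prod>p\<in>?Q. 1 - 1 / real p) * ln (real (Suc N)) \<le> (\<Prod>p\<in>?Q. 1 - 1 / real p) * (\<Sum>n\<in>{1..N}. 1 / real n)"
    using nonneg by (rule mult_left_mono)
  then show ?thesis using * by (rule order_trans)
qed

text \<open>By dyadic blocks: Chebyshev's bound gives at most \<open>16 / J\<close> for the primes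
  between \<open>2 ^ J\<close> and \<open>2 ^ (J + 1)\<close>, and
  \<open>16 / J \<le> 32 / (J + 1) \<le> 32 * (ln (J + 1) - ln J)\<close>. The true constant would
  be 1, but a larger one only multiplies the depth of the sieve.\<close>

lemma sum_reciprocal_primes_dyadic_le:
  assumes "J > 0"
  shows "(\<Sum>p\<in>{p :: nat. prime p \<and> p \<le> 2 ^ J}. 1 / real p) \<le> 1 + 32 * ln (real J)"
  using assms
proof (induction J rule: nat_induct_non_zero)
  case 1
  have "{p :: nat. prime p \<and> p \<le> 2 ^ 1} = {2}"
    using prime_ge_2_nat by (auto simp: le_antisym)
  then show ?case by simp
next
  case (Suc J)
  let ?D = "{p :: nat. prime p \<and> p \<in> {2 ^ J<..2 ^ Suc J}}"
  have "(\<Sum>p\<in>?D. 1 / real p) \<le> (\<Sum>p\<in>?D. mangoldt p / (2 ^ J * (real J * ln 2)))"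
  proof (rule sum_mono)
    fix p assume p: "p \<in> ?D"
    then have "2 ^ J < real p" using of_nat_less_iff[of "2 ^ J" p, where ?'a = real] by simp
    moreover from this have "real J * ln 2 \<le> ln (real p)"
      by (subst ln_realpow[symmetric]) auto
    moreover have "0 < real J * ln 2" using Suc.hyps by simp
    ultimately have "2 ^ J * (real J * ln 2) \<le> real p * ln (real p)"
      by (intro mult_mono) auto
    then show "1 / real p \<le> mangoldt p / (2 ^ J * (real J * ln 2))"
      using p Suc.hyps \<open>2 ^ J < real p\<close> by (simp add: field_simps)
  qed
  also have "\<dots> = (\<Sum>p\<in>?D. mangoldt p) / (2 ^ J * (real J * ln 2))"
    by (rule sum_divide_distrib[symmetric])
  also have "\<dots> \<le> (4 * 2 ^ Suc J) / (2 ^ J * (real J * ln 2))"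
  proof (rule divide_right_mono)
    have "(\<Sum>p\<in>?D. mangoldt p) \<le> chebyshev_psi (2 ^ Suc J)"
      unfolding chebyshev_psi_def by (intro sum_mono2) (auto simp: mangoldt_nonneg)
    also have "\<dots> \<le> 4 * 2 ^ Suc J" using chebyshev_psi_le[of "2 ^ Suc J"] by simp
    finally show "(\<Sum>p\<in>?D. mangoldt p) \<le> 4 * (2 ^ Suc J :: real)" .
  qed simp
  also have "\<dots> = 8 / (real J * ln 2)" by simp
  also have "\<dots> \<le> 16 / real J"
  proof -
    have "ln (2 :: real) \<ge> 1 / 2" using ln_le_minus_one[of "1 / 2 :: real"] by (simp add: ln_div)
    then have "real J * (1 / 2) \<le> real J * ln 2" by (intro mult_left_mono) auto
    then show ?thesis using Suc.hyps by (simp add: field_simps)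
  qed
  also have "\<dots> \<le> 32 * (1 / real (Suc J))"
    using Suc.hyps by (simp add: field_simps)
  also have "\<dots> \<le> 32 * (ln (real (Suc J)) - ln (real J))"
    using ln_le_minus_one[of "real J / real (Suc J)"] Suc.hyps by (simp add: ln_div field_simps)
  finally have "(\<Sum>p\<in>?D. 1 / real p) \<le> 32 * (ln (real (Suc J)) - ln (real J))" .
  moreover have "{p :: nat. prime p \<and> p \<le> 2 ^ Suc J} = {p. prime p \<and> p \<le> 2 ^ J} \<union> ?D" by auto
  then have "(\<Sum>p\<in>{p :: nat. prime p \<and> p \<le> 2 ^ Suc J}. 1 / real p) = (\<Sum>p\<in>{p :: nat. prime p \<and> p \<le> 2 ^ J}. 1 / real p) + (\<Sum>p\<in>?D. 1 / real p)"
    by (simp only:) (rule sum.union_disjoint; auto)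
  ultimately show ?case using Suc.IH by (simp only: right_diff_distrib)
qed

text \<open>\<open>1 - 2 / p \<le> (1 - 1 / p)^2\<close> reduces this to the square of the Mertens
  product. The primes dividing \<open>2 * h\<close> are finite in number, and leaving them out costs
  the constant factor \<open>c\<close>.\<close>

lemma prod_sieve_factors_le:
  fixes h :: int
  assumes h: "h \<noteq> 0"
  obtains C where "C > 0"
    "\<And>J. J > 0 \<Longrightarrow> (\<Prod>p\<in>{p. prime p \<and> p \<le> 2 ^ J \<and> \<not> int p dvd 2 * h}. 1 - 2 / real p) \<le> C / (real J)\<^sup>2"
proof -
  let ?E = "{p :: nat. prime p \<and> int p dvd 2 * h}"
  let ?f = "\<lambda>p. 1 - 1 / real p"
  have f: "0 < ?f p" "?f p \<le> 1" if "prime p" for p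
    using prime_gt_1_nat[OF that] by auto
  have "?E \<subseteq> {..nat \<bar>2 * h\<bar>}"
  proof
    fix p assume "p \<in> ?E"
    then have "\<bar>int p\<bar> \<le> \<bar>2 * h\<bar>" using h by (intro dvd_imp_le_int) auto
    then show "p \<in> {..nat \<bar>2 * h\<bar>}" by (simp add: nat_le_eq_zle le_nat_iff)
  qed
  then have finE: "finite ?E" by (rule finite_subset) simp
  define c where "c = prod ?f ?E"
  have c: "c > 0" unfolding c_def by (intro prod_pos) (use f in auto)
  show ?thesis
  proof (rule that[of "1 / (c * ln 2)\<^sup>2"])
    fix J :: nat assume J: "J > 0"
    let ?Q = "{p :: nat. prime p \<and> p \<le> 2 ^ J \<and> \<not> int p dvd 2 * h}"
    let ?P = "{p :: nat. prime p \<and> p \<le> 2 ^ J}"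
    let ?E' = "{p \<in> ?E. p \<le> 2 ^ J}"
    have "prod ?f ?E = prod ?f ?E' * prod ?f (?E - ?E')"
      using finE by (subst mult.commute, intro prod.subset_diff) auto
    also have "\<dots> \<le> prod ?f ?E' * 1"
      using f by (intro mult_left_mono prod_le_1 prod_nonneg) (auto intro: less_imp_le)
    finally have "c \<le> prod ?f ?E'" by (simp add: c_def)
    moreover have Qnn: "0 \<le> prod ?f ?Q" using f by (intro prod_nonneg) (auto intro: less_imp_le)
    ultimately have "prod ?f ?Q * c \<le> prod ?f ?Q * prod ?f ?E'" by (intro mult_left_mono)
    also have "\<dots> = prod ?f ?P"
      by (subst prod.union_disjoint[symmetric]) (auto intro!: prod.cong)
    finally have le: "prod ?f ?Q * c \<le> prod ?f ?P" .
    have "ln (2 ^ J) \<le> ln (real (Suc (2 ^ J)))"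
      by (subst ln_le_cancel_iff) (auto intro: add_pos_pos)
    then have "real J * ln 2 \<le> ln (real (Suc (2 ^ J)))"
      by (simp only: ln_realpow)
    then have "(prod ?f ?Q * c) * (real J * ln 2) \<le> prod ?f ?P * ln (real (Suc (2 ^ J)))"
      using le c J Qnn by (intro mult_mono) (auto intro!: prod_nonneg simp: inverse_nat_le_1)
    also have "\<dots> \<le> 1" by (rule prod_primes_le_inverse_ln)
    finally have "prod ?f ?Q \<le> 1 / (c * ln 2) / real J"
      using c J by (simp add: field_simps)
    then have "(prod ?f ?Q)\<^sup>2 \<le> (1 / (c * ln 2) / real J)\<^sup>2"
      using Qnn by (rule power_mono)
    moreover have "(\<Prod>p\<in>?Q. 1 - 2 / real p) \<le> (prod ?f ?Q)\<^sup>2"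
      unfolding prod_power_distrib
    proof (rule prod_mono)
      fix p assume p: "p \<in> ?Q"
      then have "p \<ge> 2" by (auto dest: prime_ge_2_nat)
      then show "0 \<le> 1 - 2 / real p \<and> 1 - 2 / real p \<le> (1 - 1 / real p)\<^sup>2"
        by (simp add: power2_eq_square algebra_simps)
    qed
    ultimately show "(\<Prod>p\<in>?Q. 1 - 2 / real p) \<le> 1 / (c * ln 2)\<^sup>2 / (real J)\<^sup>2"
      by (simp add: power_divide power_mult_distrib)
  qed (use c in simp)
qed

text \<open>Even, and at least \<open>6 + 194 * ln J\<close>: as the reciprocals of the sifting
  primes sum to at most \<open>1 + 32 * ln J\<close> and \<open>194 = 6 * 32 + 2\<close>, the
  exponential term of the sieve drops to \<open>1 / J ^ 2\<close>.\<close>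

definition sieve_depth :: "nat \<Rightarrow> nat" where
  "sieve_depth J = 2 * (nat \<lceil>97 * ln (real J)\<rceil> + 3)"

lemma card_prime_pairs_le:
  fixes h :: int
  assumes h: "h \<noteq> 0"
  obtains C where "C > 0"
    "\<And>J m l. J > 0 \<Longrightarrow> real (card {n \<in> {m..<m + int l}. prime (nat \<bar>n\<bar>) \<and> prime (nat \<bar>n + h\<bar>)})
      \<le> C * real l / (real J)\<^sup>2 + 15 * 2 ^ (J * sieve_depth J)"
proof -
  obtain C where C: "C > 0"
    "\<And>J. J > 0 \<Longrightarrow> (\<Prod>p\<in>{p. prime p \<and> p \<le> 2 ^ J \<and> \<not> int p dvd 2 * h}. 1 - 2 / real p) \<le> C / (real J)\<^sup>2"
    by (rule prod_sieve_factors_le[OF h]) (rule that)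
  show ?thesis
  proof (rule that[of "C + 1"])
    fix J :: nat and m :: int and l :: nat assume J: "J > 0"
    let ?I = "{m..<m + int l}" and ?z = "2 ^ J :: int" and ?r = "sieve_depth J"
    let ?Q = "{p :: nat. prime p \<and> p \<le> 2 ^ J \<and> \<not> int p dvd 2 * h}"
    let ?N = "{n \<in> ?I. prime (nat \<bar>n\<bar>) \<and> prime (nat \<bar>n + h\<bar>)}"
    let ?S = "{n \<in> ?I. \<forall>p\<in>?Q. \<not> int p dvd n * (n + h)}"
    \<comment> \<open>A prime pair survives the sifting unless \<open>n\<close> or
      \<open>n + h\<close> is, up to sign, one of the sifting primes itself; such \<open>n\<close>
      lie in two intervals around 0 and \<open>- h\<close>.\<close>
    have "?N \<subseteq> ?S \<union> ({- ?z..?z} \<union> {- ?z - h..?z - h})"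
    proof
      fix n assume n: "n \<in> ?N"
      show "n \<in> ?S \<union> ({- ?z..?z} \<union> {- ?z - h..?z - h})"
      proof (cases "n \<in> ?S")
        case False
        then obtain p where p: "prime p" "p \<le> 2 ^ J" "int p dvd n * (n + h)"
          using n by blast
        have small: "\<bar>k\<bar> \<le> ?z" if "int p dvd k" "prime (nat \<bar>k\<bar>)" for k
        proof -
          have "p dvd nat \<bar>k\<bar>" using that(1) by (simp add: nat_abs_dvd_iff flip: int_dvd_int_iff)
          then have "p = nat \<bar>k\<bar>" using p(1) that(2) by (metis primes_dvd_imp_eq)
          then have "\<bar>k\<bar> = int p" by simp
          also have "\<dots> \<le> int (2 ^ J)" using p(2) by (simp only: of_nat_le_iff)
          finally show ?thesis by simp
        qed
        have "int p dvd n \<or> int p dvd n + h"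
          using p by (simp add: prime_dvd_mult_iff)
        then have "\<bar>n\<bar> \<le> ?z \<or> \<bar>n + h\<bar> \<le> ?z" using small n by blast
        then show ?thesis by auto
      qed simp
    qed
    moreover have "finite ?S" by (rule finite_subset[of _ ?I]) auto
    ultimately have "card ?N \<le> card (?S \<union> ({- ?z..?z} \<union> {- ?z - h..?z - h}))"
      by (intro card_mono) auto
    also have "\<dots> \<le> card ?S + (card {- ?z..?z} + card {- ?z - h..?z - h})"
      by (intro order_trans[OF card_Un_le] add_left_mono card_Un_le)
    finally have "real (card ?N) \<le> real (card ?S) + (real (card {- ?z..?z}) + real (card {- ?z - h..?z - h}))"
      by linarith
    also have "real (card {- ?z..?z}) + real (card {- ?z - h..?z - h}) = 4 * 2 ^ J + 2"
      by simp
    \<comment> \<open>With the 9 from the sieve this makes up the constant 15.\<close>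
    also have "\<dots> \<le> 6 * 2 ^ (J * ?r)"
    proof -
      have "(2 :: real) ^ J \<le> 2 ^ (J * ?r)"
        by (intro power_increasing) (auto simp: sieve_depth_def)
      moreover have "(1 :: real) \<le> 2 ^ (J * ?r)" by simp
      ultimately show ?thesis by linarith
    qed
    finally have total: "real (card ?N) \<le> real (card ?S) + 6 * 2 ^ (J * ?r)"
      by simp
    have "real (card ?S) \<le> real l * ((\<Prod>p\<in>?Q. 1 - 2 / real p) + exp (6 * (\<Sum>p\<in>?Q. 1 / real p) - real ?r)) + 9 * (2 ^ J) ^ ?r"
    proof (rule brun_pure_sieve)
      have sub: "?Q \<subseteq> {1..2 ^ J}" by (auto dest: prime_ge_1_nat)
      then show "finite ?Q" by (rule finite_subset) simp
      show "even ?r" by (simp add: sieve_depth_def)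
      show "\<not> int p dvd h" if "p \<in> ?Q" for p using that by (auto intro: dvd_mult)
      have "card ?Q \<le> card {1..2 ^ J :: nat}" using sub by (intro card_mono) auto
      then have "card ?Q \<le> 2 ^ J" by simp
      then have "real (card ?Q) \<le> real (2 ^ J)" by (simp only: of_nat_le_iff)
      then show "real (card ?Q) \<le> 2 ^ J" by simp
    qed auto
    also have "(2 ^ J :: real) ^ ?r = 2 ^ (J * ?r)" by (rule power_mult[symmetric])
    finally have sifted: "real (card ?S) \<le> real l * ((\<Prod>p\<in>?Q. 1 - 2 / real p) + exp (6 * (\<Sum>p\<in>?Q. 1 / real p) - real ?r)) + 9 * 2 ^ (J * ?r)" .
    have "exp (6 * (\<Sum>p\<in>?Q. 1 / real p) - real ?r) \<le> 1 / (real J)\<^sup>2"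
    proof -
      have "(\<Sum>p\<in>?Q. 1 / real p) \<le> (\<Sum>p\<in>{p. prime p \<and> p \<le> 2 ^ J}. 1 / real p)"
        by (intro sum_mono2) auto
      also have "\<dots> \<le> 1 + 32 * ln (real J)" by (rule sum_reciprocal_primes_dyadic_le[OF J])
      finally have "6 * (\<Sum>p\<in>?Q. 1 / real p) \<le> 6 + 192 * ln (real J)" by simp
      moreover have "real ?r \<ge> 194 * ln (real J) + 6" unfolding sieve_depth_def by simp linarith
      ultimately have "6 * (\<Sum>p\<in>?Q. 1 / real p) - real ?r \<le> - (ln (real J) + ln (real J))" by linarith
      then have "exp (6 * (\<Sum>p\<in>?Q. 1 / real p) - real ?r) \<le> exp (- (ln (real J) + ln (real J)))" by simp
      also have "\<dots> = 1 / (real J)\<^sup>2"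
        using J by (simp only: exp_minus exp_add) (simp add: power2_eq_square divide_inverse)
      finally show ?thesis .
    qed
    then have "(\<Prod>p\<in>?Q. 1 - 2 / real p) + exp (6 * (\<Sum>p\<in>?Q. 1 / real p) - real ?r) \<le> (C + 1) / (real J)\<^sup>2"
      using C(2)[OF J] by (simp add: add_divide_distrib)
    then have "real l * ((\<Prod>p\<in>?Q. 1 - 2 / real p) + exp (6 * (\<Sum>p\<in>?Q. 1 / real p) - real ?r)) \<le> real l * ((C + 1) / (real J)\<^sup>2)"
      by (rule mult_left_mono) simp
    also have "\<dots> = (C + 1) * real l / (real J)\<^sup>2" by simp
    finally show "real (card ?N) \<le> (C + 1) * real l / (real J)\<^sup>2 + 15 * 2 ^ (J * ?r)"
      using total sifted by linarith
  qed (use C in simp)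
qed

theorem card_prime_pairs_little_o:
  fixes h :: int and e :: real
  assumes h: "h \<noteq> 0" and e: "e > 0"
  shows "\<forall>\<^sub>F L in at_top. \<forall>m l. real l \<le> L \<longrightarrow>
     real (card {n \<in> {m..<m + int l}. prime (nat \<bar>n\<bar>) \<and> prime (nat \<bar>n + h\<bar>)}) \<le> e * (L / ln L)"
proof -
  obtain C where C: "C > 0"
    "\<And>J m l. J > 0 \<Longrightarrow> real (card {n \<in> {m..<m + int l}. prime (nat \<bar>n\<bar>) \<and> prime (nat \<bar>n + h\<bar>)})
      \<le> C * real l / (real J)\<^sup>2 + 15 * 2 ^ (J * sieve_depth J)"
    by (rule card_prime_pairs_le[OF h]) (rule that)
  \<comment> \<open>The sieve bound relative to \<open>L / ln L\<close>, for \<open>J\<close> the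
    integer part of \<open>y = ln L powr (3/4)\<close>: \<open>y - 1\<close> bounds \<open>J\<close>
    from below, \<open>194 * ln y + 8\<close> bounds \<open>sieve_depth J\<close> from above
    including its ceiling, and powers of 2 are replaced by powers of \<open>exp 1\<close>.\<close>
  define G where "G = (\<lambda>L. C / (ln L powr (3/4) - 1)\<^sup>2 * ln L
     + 15 * exp (ln L powr (3/4) * (194 * ln (ln L powr (3/4)) + 8)) * ln L / L)"
  have "(G \<longlongrightarrow> 0) at_top"
    unfolding G_def using C(1) by real_asymp
  then have "\<forall>\<^sub>F L in at_top. G L < e" using e by (rule order_tendstoD(2))
  moreover have "\<forall>\<^sub>F L::real in at_top. ln L powr (3/4) > 2" by real_asymp
  moreover have "\<forall>\<^sub>F L::real in at_top. L > 1" by (rule eventually_gt_at_top)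
  ultimately show ?thesis
  proof eventually_elim
    case (elim L)
    show ?case
    proof (intro allI impI)
      fix m :: int and l :: nat assume l: "real l \<le> L"
      let ?N = "{n \<in> {m..<m + int l}. prime (nat \<bar>n\<bar>) \<and> prime (nat \<bar>n + h\<bar>)}"
      define y where "y = ln L powr (3/4)"
      define J where "J = nat \<lfloor>y\<rfloor>"
      have y: "y > 2" using elim by (simp add: y_def)
      have J: "J > 0" "real J \<le> y" "y - 1 \<le> real J" using y unfolding J_def by linarith+
      have lnL: "ln L > 0" using elim by simp
      have "real (sieve_depth J) \<le> 194 * ln (real J) + 8"
      proof -
        have "ln (real J) \<ge> 0" using J by simp
        then show ?thesis unfolding sieve_depth_def by simp linarith
      qed
      also have "\<dots> \<le> 194 * ln y + 8" using J y by simp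
      finally have "real J * real (sieve_depth J) \<le> y * (194 * ln y + 8)"
        using J y by (intro mult_mono) auto
      moreover have "real (J * sieve_depth J) * ln 2 \<le> real (J * sieve_depth J) * 1"
        using ln_2_less_1 by (intro mult_left_mono) auto
      ultimately have "real (J * sieve_depth J) * ln 2 \<le> y * (194 * ln y + 8)" by simp
      then have "exp (real (J * sieve_depth J) * ln 2) \<le> exp (y * (194 * ln y + 8))" by simp
      moreover have "exp (real (J * sieve_depth J) * ln 2) = 2 ^ (J * sieve_depth J)"
        by (simp only: exp_of_nat_mult) simp
      ultimately have pow: "2 ^ (J * sieve_depth J) \<le> exp (y * (194 * ln y + 8))" by (simp only:)
      have "real (card ?N)
          \<le> C * real l / (real J)\<^sup>2 + 15 * 2 ^ (J * sieve_depth J)"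
        by (rule C(2)[OF J(1)])
      also have "\<dots> \<le> C * L / (y - 1)\<^sup>2 + 15 * exp (y * (194 * ln y + 8))"
        using C(1) l J y pow elim by (intro add_mono frac_le mult_left_mono power_mono) auto
      also have "\<dots> = G L * (L / ln L)"
        using lnL elim by (simp add: G_def y_def field_simps)
      also have "\<dots> \<le> e * (L / ln L)"
        using lnL elim by (intro mult_right_mono) auto
      finally show "real (card ?N) \<le> e * (L / ln L)" .
    qed
  qed
qed

section \<open>Plancherel for continuous functions of compact support\<close>

lemma CcD:
  assumes "g \<in> Cc"
  shows Cc_continuous: "continuous_on UNIV g"
    and Cc_measurable: "g \<in> borel_measurable borel"
    and Cc_integrable: "integrable lborel g"
    and Cc_bounded: "\<exists>B\<ge>0. \<forall>x. cmod (g x) \<le> B"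
proof -
  from assms obtain K where cont: "continuous_on UNIV g" and K: "compact K" "\<And>x. x \<notin> K \<Longrightarrow> g x = 0"
    by (auto simp: Cc_def)
  have contK: "continuous_on K g" using cont continuous_on_subset by blast
  have "(\<lambda>x. indicator K x *\<^sub>R g x) = g" using K by (auto simp: indicator_def fun_eq_iff)
  then have int: "integrable lborel g"
    using borel_integrable_compact[OF K(1) contK] by simp
  have "bounded (g ` K)" using compact_continuous_image[OF contK K(1)] compact_imp_bounded by blast
  then obtain B where B: "B > 0" "\<And>x. x \<in> K \<Longrightarrow> cmod (g x) \<le> B"
    unfolding bounded_pos by blast
  have "cmod (g x) \<le> B" for x using B K(2)[of x] by (cases "x \<in> K") auto
  then show "\<exists>B\<ge>0. \<forall>x. cmod (g x) \<le> B" using B(1) by (intro exI[of _ B]) auto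
  show "continuous_on UNIV g" "g \<in> borel_measurable borel" "integrable lborel g"
    using cont int borel_measurable_continuous_onI[OF cont] by auto
qed

lemma cis_measurable [measurable]: "cis \<in> borel_measurable borel"
  by (intro borel_measurable_continuous_onI continuous_intros)

lemma cnj_measurable [measurable]: "cnj \<in> borel_measurable borel"
  by (intro borel_measurable_continuous_onI continuous_intros)

lemma integrable_translate:
  fixes f :: "real \<Rightarrow> 'a :: {banach, second_countable_topology}"
  shows "integrable lborel f \<Longrightarrow> integrable lborel (\<lambda>x. f (x + t))"
  using lborel_integrable_real_affine[of f 1 t] by (simp add: add.commute)

lemma integral_translate:
  fixes f :: "real \<Rightarrow> 'a :: {banach, second_countable_topology}"
  shows "(LINT x|lborel. f (x + t)) = (LINT x|lborel. f x)"
  using lborel_integral_real_affine[of 1 f t] by (simp add: add.commute)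

text \<open>By translation invariance the double integral of \<open>|g (u + t) * cnj (g t)|\<close>
  is the square of the integral of \<open>|g|\<close>, so Fubini applies; boundedness and continuity
  at 0 come from domination by \<open>B * |g|\<close>.\<close>

lemma conv_tilde_properties:
  assumes g: "g \<in> Cc"
  shows conv_tilde_measurable: "conv_tilde g \<in> borel_measurable borel"
    and conv_tilde_integrable: "integrable lborel (conv_tilde g)"
    and conv_tilde_bounded: "\<exists>D. \<forall>x. cmod (conv_tilde g x) \<le> D"
    and conv_tilde_tendsto_0: "\<And>X. X \<longlonglongrightarrow> 0 \<Longrightarrow> (\<lambda>n. conv_tilde g (X n)) \<longlonglongrightarrow> conv_tilde g 0"
    and conv_tilde_fourier: "\<And>\<xi>. (LINT u|lborel. conv_tilde g u * cis (2 * pi * u * \<xi>)) = of_real ((cmod (inv_fourier g \<xi>))\<^sup>2)"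
proof -
  note cont = Cc_continuous[OF g] and [measurable] = Cc_measurable[OF g] and int = Cc_integrable[OF g]
  obtain B where B: "B \<ge> 0" "\<And>x. cmod (g x) \<le> B"
    using Cc_bounded[OF g] by blast
  have int_cnj: "integrable lborel (\<lambda>t. cnj (g t))" using int by simp
  have int_norm: "integrable lborel (\<lambda>t. cmod (g t))" using int by simp
  have meas: "conv_tilde g \<in> borel_measurable borel"
    unfolding conv_tilde_def[abs_def] by measurable
  have prod_int: "integrable (lborel \<Otimes>\<^sub>M lborel) (\<lambda>(t, u). g (u + t) * cnj (g t) * cis (2 * pi * u * \<xi>))" for \<xi>
  proof (rule lborel_pair.Fubini_integrable)
    show "(\<lambda>(t, u). g (u + t) * cnj (g t) * cis (2 * pi * u * \<xi>)) \<in> borel_measurable (lborel \<Otimes>\<^sub>M lborel)"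
      by measurable
    have "(\<lambda>t. LINT u|lborel. cmod (g (u + t) * cnj (g t) * cis (2 * pi * u * \<xi>))) = (\<lambda>t. (LINT u|lborel. cmod (g u)) * cmod (g t))"
    proof
      fix t
      have "(LINT u|lborel. cmod (g (u + t) * cnj (g t) * cis (2 * pi * u * \<xi>))) = (LINT u|lborel. cmod (g (u + t)) * cmod (g t))"
        by (simp add: norm_mult)
      also have "\<dots> = (LINT u|lborel. cmod (g (u + t))) * cmod (g t)"
        by simp
      also have "(LINT u|lborel. cmod (g (u + t))) = (LINT u|lborel. cmod (g u))"
        by (rule integral_translate)
      finally show "(LINT u|lborel. cmod (g (u + t) * cnj (g t) * cis (2 * pi * u * \<xi>))) = (LINT u|lborel. cmod (g u)) * cmod (g t)" .
    qed
    then show "integrable lborel (\<lambda>t. LINT u|lborel. cmod (case (t, u) of (t, u) \<Rightarrow> g (u + t) * cnj (g t) * cis (2 * pi * u * \<xi>)))"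
      using int_norm by simp
    show "AE t in lborel. integrable lborel (\<lambda>u. case (t, u) of (t, u) \<Rightarrow> g (u + t) * cnj (g t) * cis (2 * pi * u * \<xi>))"
    proof (rule AE_I2)
      fix t
      have "integrable lborel (\<lambda>u. cmod (g (u + t)) * B)"
        by (intro integrable_mult_left integrable_translate[OF int_norm])
      then have "integrable lborel (\<lambda>u. g (u + t) * cnj (g t) * cis (2 * pi * u * \<xi>))"
        by (rule Bochner_Integration.integrable_bound)
          (use B in \<open>auto simp: norm_mult intro!: AE_I2 mult_left_mono\<close>)
      then show "integrable lborel (\<lambda>u. case (t, u) of (t, u) \<Rightarrow> g (u + t) * cnj (g t) * cis (2 * pi * u * \<xi>))"
        by simp
    qed
  qed
  have conv_int: "(LINT t|lborel. g (u + t) * cnj (g t) * cis (2 * pi * u * \<xi>)) = conv_tilde g u * cis (2 * pi * u * \<xi>)" for u \<xi>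
    by (simp add: conv_tilde_def)
  have "integrable lborel (\<lambda>u. LINT t|lborel. g (u + t) * cnj (g t) * cis (2 * pi * u * 0))"
    by (rule lborel_pair.integrable_snd[OF prod_int])
  then have integrable: "integrable lborel (conv_tilde g)"
    unfolding conv_int by simp
  have fourier: "(LINT u|lborel. conv_tilde g u * cis (2 * pi * u * \<xi>)) = of_real ((cmod (inv_fourier g \<xi>))\<^sup>2)" for \<xi>
  proof -
    have "(LINT u|lborel. conv_tilde g u * cis (2 * pi * u * \<xi>)) = (LINT u|lborel. LINT t|lborel. g (u + t) * cnj (g t) * cis (2 * pi * u * \<xi>))"
      by (simp only: conv_int)
    also have "\<dots> = (LINT t|lborel. LINT u|lborel. g (u + t) * cnj (g t) * cis (2 * pi * u * \<xi>))"
      by (rule lborel_pair.Fubini_integral[OF prod_int])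
    also have "\<dots> = (LINT t|lborel. inv_fourier g \<xi> * cnj (g t * cis (2 * pi * t * \<xi>)))"
    proof (rule Bochner_Integration.integral_cong)
      fix t
      \<comment> \<open>Splitting the character along \<open>u = (u + t) - t\<close> separates the
        two factors after a translation by \<open>t\<close>.\<close>
      have "cis (2 * pi * u * \<xi>) = cis (2 * pi * (u + t) * \<xi>) * cnj (cis (2 * pi * t * \<xi>))" for u
        by (simp add: cis_cnj cis_mult algebra_simps)
      then have "(LINT u|lborel. g (u + t) * cnj (g t) * cis (2 * pi * u * \<xi>)) =
        (LINT u|lborel. (g (u + t) * cis (2 * pi * (u + t) * \<xi>)) * cnj (g t * cis (2 * pi * t * \<xi>)))"
        by (simp only: complex_cnj_mult mult_ac)
      also have "\<dots> = (LINT u|lborel. g (u + t) * cis (2 * pi * (u + t) * \<xi>)) * cnj (g t * cis (2 * pi * t * \<xi>))"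
        by simp
      also have "(LINT u|lborel. g (u + t) * cis (2 * pi * (u + t) * \<xi>)) = inv_fourier g \<xi>"
        unfolding inv_fourier_def by (rule integral_translate)
      finally show "(LINT u|lborel. g (u + t) * cnj (g t) * cis (2 * pi * u * \<xi>)) = inv_fourier g \<xi> * cnj (g t * cis (2 * pi * t * \<xi>))" .
    qed simp
    also have "\<dots> = inv_fourier g \<xi> * (LINT t|lborel. cnj (g t * cis (2 * pi * t * \<xi>)))" by simp
    also have "(LINT t|lborel. cnj (g t * cis (2 * pi * t * \<xi>))) = cnj (inv_fourier g \<xi>)"
      unfolding inv_fourier_def by (rule Bochner_Integration.integral_cnj)
    finally show ?thesis by (simp only: complex_norm_square)
  qed
  have bound: "cmod (conv_tilde g x) \<le> B * (LINT t|lborel. cmod (g t))" for x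
  proof -
    have "cmod (conv_tilde g x) \<le> (LINT t|lborel. B * cmod (g t))"
      unfolding conv_tilde_def
    proof (rule Bochner_Integration.integral_norm_bound_integral)
      show int1: "integrable lborel (\<lambda>t. B * cmod (g t))" using int_norm by simp
      show "integrable lborel (\<lambda>t. g (x + t) * cnj (g t))"
        by (rule Bochner_Integration.integrable_bound[OF int1])
          (use B in \<open>auto simp: norm_mult intro!: AE_I2 mult_right_mono\<close>)
    qed (use B in \<open>auto simp: norm_mult intro!: mult_right_mono\<close>)
    then show ?thesis by simp
  qed
  have lim: "(\<lambda>n. conv_tilde g (X n)) \<longlonglongrightarrow> conv_tilde g 0" if X: "X \<longlonglongrightarrow> 0" for X
    unfolding conv_tilde_def
  proof (rule integral_dominated_convergence[where w = "\<lambda>t. B * cmod (g t)"])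
    show "AE t in lborel. (\<lambda>n. g (X n + t) * cnj (g t)) \<longlonglongrightarrow> g (0 + t) * cnj (g t)"
    proof (intro AE_I2 tendsto_mult tendsto_const)
      fix t
      have "isCont g (0 + t)" using cont by (simp add: continuous_on_eq_continuous_at)
      then show "(\<lambda>n. g (X n + t)) \<longlonglongrightarrow> g (0 + t)"
        by (rule isCont_tendsto_compose) (intro tendsto_add X tendsto_const)
    qed
    show "AE t in lborel. cmod (g (X n + t) * cnj (g t)) \<le> B * cmod (g t)" for n
      using B by (auto simp: norm_mult intro!: mult_right_mono)
  qed (use int_norm in auto)
  show "conv_tilde g \<in> borel_measurable borel" "integrable lborel (conv_tilde g)"
    "\<exists>D. \<forall>x. cmod (conv_tilde g x) \<le> D"
    using meas integrable bound by blast+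
  show "\<And>X. X \<longlonglongrightarrow> 0 \<Longrightarrow> (\<lambda>n. conv_tilde g (X n)) \<longlonglongrightarrow> conv_tilde g 0"
    by (rule lim)
  show "\<And>\<xi>. (LINT u|lborel. conv_tilde g u * cis (2 * pi * u * \<xi>)) = of_real ((cmod (inv_fourier g \<xi>))\<^sup>2)"
    by (rule fourier)
qed

lemma std_normal_density_mult_cis:
  "(LINT x|lborel. of_real (std_normal_density x) * cis (t * x)) = of_real (exp (- (t\<^sup>2) / 2))"
proof -
  have "of_real (exp (- (t\<^sup>2) / 2)) = char std_normal_distribution t"
    by (simp add: char_std_normal_distribution)
  also have "\<dots> = (LINT x|lborel. std_normal_density x *\<^sub>R iexp (t * x))"
    unfolding char_def by (rule integral_density) auto
  finally show ?thesis by (simp add: scaleR_conv_of_real cis_conv_exp)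
qed

text \<open>Regularising with a Gaussian \<open>W\<close> of small width parameter \<open>s\<close> makes Fubini applicable, and
  the Fourier transform of \<open>W\<close> is an approximate identity.\<close>

lemma gaussian_regularisation:
  assumes g: "g \<in> Cc" and s: "s > 0"
  defines "W \<equiv> (\<lambda>\<xi>. exp (- (2 * pi * s * \<xi>)\<^sup>2 / 2))"
  shows "integrable lborel (\<lambda>\<xi>. W \<xi> * (cmod (inv_fourier g \<xi>))\<^sup>2)"
    and "of_real (LINT \<xi>|lborel. W \<xi> * (cmod (inv_fourier g \<xi>))\<^sup>2)
      = (LINT v|lborel. of_real (std_normal_density v) * conv_tilde g (s * v))"
proof -
  note [measurable] = conv_tilde_measurable[OF g] and int = conv_tilde_integrable[OF g]
    and fourier = conv_tilde_fourier[OF g]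
  \<comment> \<open>The summand 0 gives the argument the shape of the affine substitution rules for
    \<open>lborel\<close>.\<close>
  have W_eq: "W \<xi> = sqrt (2 * pi) * std_normal_density (0 + 2 * pi * s * \<xi>)" for \<xi>
    by (simp add: W_def std_normal_density_def)
  have [measurable]: "W \<in> borel_measurable borel" unfolding W_def by measurable
  have W_int: "integrable lborel W"
    unfolding W_eq[abs_def] using s
    by (intro integrable_mult_right lborel_integrable_real_affine) auto
  have W_nonneg: "W \<xi> \<ge> 0" for \<xi> by (simp add: W_def)
  \<comment> \<open>The transform of \<open>W\<close> is the density of the centred normal
    distribution of deviation \<open>s\<close>, obtained from the characteristic function at
    \<open>u / s\<close>.\<close>
  have W_fourier: "(LINT \<xi>|lborel. of_real (W \<xi>) * cis (2 * pi * u * \<xi>)) = of_real (std_normal_density (u / s) / s)" for u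
  proof -
    have "of_real (exp (- ((u / s)\<^sup>2) / 2)) = (LINT x|lborel. of_real (std_normal_density x) * cis (u / s * x))"
      by (rule std_normal_density_mult_cis[symmetric])
    also have "\<dots> = \<bar>2 * pi * s\<bar> *\<^sub>R (LINT \<xi>|lborel. of_real (std_normal_density (0 + 2 * pi * s * \<xi>)) * cis (u / s * (0 + 2 * pi * s * \<xi>)))"
      using s by (intro lborel_integral_real_affine) auto
    also have "(LINT \<xi>|lborel. of_real (std_normal_density (0 + 2 * pi * s * \<xi>)) * cis (u / s * (0 + 2 * pi * s * \<xi>)))
        = (LINT \<xi>|lborel. of_real (1 / sqrt (2 * pi)) * (of_real (W \<xi>) * cis (2 * pi * u * \<xi>)))"
    proof (rule Bochner_Integration.integral_cong)
      fix \<xi>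
      have "u / s * (0 + 2 * pi * s * \<xi>) = 2 * pi * u * \<xi>" using s by simp
      moreover have "std_normal_density (0 + 2 * pi * s * \<xi>) = 1 / sqrt (2 * pi) * W \<xi>" by (simp add: W_eq)
      ultimately show "of_real (std_normal_density (0 + 2 * pi * s * \<xi>)) * cis (u / s * (0 + 2 * pi * s * \<xi>))
        = of_real (1 / sqrt (2 * pi)) * (of_real (W \<xi>) * cis (2 * pi * u * \<xi>))"
        by (simp only: of_real_mult mult.assoc)
    qed simp
    also have "\<dots> = of_real (1 / sqrt (2 * pi)) * (LINT \<xi>|lborel. of_real (W \<xi>) * cis (2 * pi * u * \<xi>))"
      by (rule integral_mult_right_zero)
    finally have "of_real (exp (- ((u / s)\<^sup>2) / 2)) = of_real (2 * pi * s / sqrt (2 * pi)) * (LINT \<xi>|lborel. of_real (W \<xi>) * cis (2 * pi * u * \<xi>))"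
      using s by (simp add: scaleR_conv_of_real)
    also have "2 * pi * s / sqrt (2 * pi) = s * sqrt (2 * pi)"
    proof -
      have "2 * pi / sqrt (2 * pi) = sqrt (2 * pi)" by (rule real_div_sqrt) simp
      moreover have "2 * pi * s / sqrt (2 * pi) = s * (2 * pi / sqrt (2 * pi))" by simp
      ultimately show ?thesis by (simp only:)
    qed
    finally have "of_real (exp (- ((u / s)\<^sup>2) / 2)) / of_real (s * sqrt (2 * pi)) = (LINT \<xi>|lborel. of_real (W \<xi>) * cis (2 * pi * u * \<xi>))"
      using s by simp
    moreover have "std_normal_density (u / s) / s = exp (- ((u / s)\<^sup>2) / 2) / (s * sqrt (2 * pi))"
      by (simp add: std_normal_density_def)
    ultimately show ?thesis by (simp only: of_real_divide)
  qed
  have prod_int: "integrable (lborel \<Otimes>\<^sub>M lborel) (\<lambda>(\<xi>, u). of_real (W \<xi>) * (conv_tilde g u * cis (2 * pi * u * \<xi>)))"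
  proof (rule lborel_pair.Fubini_integrable)
    show "(\<lambda>(\<xi>, u). of_real (W \<xi>) * (conv_tilde g u * cis (2 * pi * u * \<xi>))) \<in> borel_measurable (lborel \<Otimes>\<^sub>M lborel)"
      by measurable
    have "integrable lborel (\<lambda>\<xi>. W \<xi> * (LINT u|lborel. cmod (conv_tilde g u)))"
      using W_int by simp
    then show "integrable lborel (\<lambda>\<xi>. LINT u|lborel. cmod (case (\<xi>, u) of (\<xi>, u) \<Rightarrow> of_real (W \<xi>) * (conv_tilde g u * cis (2 * pi * u * \<xi>))))"
      by (simp add: norm_mult W_nonneg)
    have "integrable lborel (\<lambda>u. conv_tilde g u * cis (2 * pi * u * \<xi>))" for \<xi>
      by (rule Bochner_Integration.integrable_bound[OF int]) (auto simp: norm_mult)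
    then show "AE \<xi> in lborel. integrable lborel (\<lambda>u. case (\<xi>, u) of (\<xi>, u) \<Rightarrow> of_real (W \<xi>) * (conv_tilde g u * cis (2 * pi * u * \<xi>)))"
      by simp
  qed
  have inner: "(LINT u|lborel. of_real (W \<xi>) * (conv_tilde g u * cis (2 * pi * u * \<xi>))) = of_real (W \<xi> * (cmod (inv_fourier g \<xi>))\<^sup>2)" for \<xi>
    by (simp only: integral_mult_right_zero fourier of_real_mult)
  have "integrable lborel (\<lambda>\<xi>. complex_of_real (W \<xi> * (cmod (inv_fourier g \<xi>))\<^sup>2))"
    using lborel_pair.integrable_fst[OF prod_int] by (simp only: inner)
  then show "integrable lborel (\<lambda>\<xi>. W \<xi> * (cmod (inv_fourier g \<xi>))\<^sup>2)"
    using integrable_Re by fastforce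
  have "of_real (LINT \<xi>|lborel. W \<xi> * (cmod (inv_fourier g \<xi>))\<^sup>2)
      = (LINT \<xi>|lborel. complex_of_real (W \<xi> * (cmod (inv_fourier g \<xi>))\<^sup>2))"
    by (rule integral_complex_of_real[symmetric])
  also have "\<dots> = (LINT \<xi>|lborel. LINT u|lborel. of_real (W \<xi>) * (conv_tilde g u * cis (2 * pi * u * \<xi>)))"
    by (simp only: inner)
  also have "\<dots> = (LINT u|lborel. LINT \<xi>|lborel. of_real (W \<xi>) * (conv_tilde g u * cis (2 * pi * u * \<xi>)))"
    by (rule lborel_pair.Fubini_integral[OF prod_int, symmetric])
  also have "\<dots> = (LINT u|lborel. of_real (std_normal_density (u / s) / s) * conv_tilde g u)"
  proof (rule Bochner_Integration.integral_cong)
    fix u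
    have "(LINT \<xi>|lborel. of_real (W \<xi>) * (conv_tilde g u * cis (2 * pi * u * \<xi>)))
        = (LINT \<xi>|lborel. (of_real (W \<xi>) * cis (2 * pi * u * \<xi>)) * conv_tilde g u)"
      by (simp only: mult_ac)
    also have "\<dots> = (LINT \<xi>|lborel. of_real (W \<xi>) * cis (2 * pi * u * \<xi>)) * conv_tilde g u"
      by (rule integral_mult_left_zero)
    finally show "(LINT \<xi>|lborel. of_real (W \<xi>) * (conv_tilde g u * cis (2 * pi * u * \<xi>))) = of_real (std_normal_density (u / s) / s) * conv_tilde g u"
      by (simp only: W_fourier)
  qed simp
  \<comment> \<open>The substitution \<open>u = s * v\<close> moves \<open>s\<close> out of the
    density and into \<open>conv_tilde\<close>, whose continuity at 0 will govern the limit.\<close>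
  also have "\<dots> = \<bar>s\<bar> *\<^sub>R (LINT v|lborel. of_real (std_normal_density ((0 + s * v) / s) / s) * conv_tilde g (0 + s * v))"
    using s by (intro lborel_integral_real_affine) auto
  also have "\<dots> = (LINT v|lborel. of_real s * (of_real (std_normal_density v / s) * conv_tilde g (s * v)))"
    using s by (simp add: scaleR_conv_of_real)
  also have "\<dots> = (LINT v|lborel. of_real (std_normal_density v) * conv_tilde g (s * v))"
    using s by (intro Bochner_Integration.integral_cong) auto
  finally show "of_real (LINT \<xi>|lborel. W \<xi> * (cmod (inv_fourier g \<xi>))\<^sup>2)
      = (LINT v|lborel. of_real (std_normal_density v) * conv_tilde g (s * v))" .
qed

text \<open>As \<open>s\<close> decreases to 0, the weights on \<open>|inv_fourier g|^2\<close>
  increase to 1, while the other side of the regularised identity tends to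
  \<open>conv_tilde g 0\<close> by dominated convergence. Monotone convergence then yields
  integrability together with the value.\<close>

theorem plancherel_Cc:
  assumes g: "g \<in> Cc"
  shows "has_bochner_integral lborel (\<lambda>\<xi>. (cmod (inv_fourier g \<xi>))\<^sup>2) (Re (conv_tilde g 0))"
    and "of_real (Re (conv_tilde g 0)) = conv_tilde g 0"
proof -
  note [measurable] = Cc_measurable[OF g] conv_tilde_measurable[OF g]
    and lim = conv_tilde_tendsto_0[OF g]
  obtain D where D: "\<And>x. cmod (conv_tilde g x) \<le> D"
    using conv_tilde_bounded[OF g] by blast
  define s where "s = (\<lambda>n. inverse (real (Suc n)))"
  have s: "s n > 0" "s \<longlonglongrightarrow> 0" for n
    unfolding s_def using LIMSEQ_inverse_real_of_nat by auto
  have s_antimono: "s n \<le> s m" if "m \<le> n" for m n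
    using that by (simp add: s_def)
  have meas [measurable]: "inv_fourier g \<in> borel_measurable borel"
    unfolding inv_fourier_def[abs_def] by measurable
  have "(\<lambda>n. LINT v|lborel. of_real (std_normal_density v) * conv_tilde g (s n * v)) \<longlonglongrightarrow> (LINT v|lborel. of_real (std_normal_density v) * conv_tilde g 0)"
  proof (rule integral_dominated_convergence[where w = "\<lambda>v. std_normal_density v * D"])
    show "AE v in lborel. (\<lambda>n. of_real (std_normal_density v) * conv_tilde g (s n * v)) \<longlonglongrightarrow> of_real (std_normal_density v) * conv_tilde g 0"
    proof (intro AE_I2 tendsto_mult tendsto_const lim)
      show "(\<lambda>n. s n * v) \<longlonglongrightarrow> 0" for v using tendsto_mult_left_zero[OF s(2)] .
    qed
    show "AE v in lborel. cmod (of_real (std_normal_density v) * conv_tilde g (s n * v)) \<le> std_normal_density v * D" for n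
      using D by (auto simp: norm_mult intro!: mult_left_mono)
  qed auto
  also have "(LINT v|lborel. of_real (std_normal_density v) * conv_tilde g 0) = conv_tilde g 0"
  proof -
    have "(LINT v|lborel. of_real (std_normal_density v) * conv_tilde g 0) = (LINT v|lborel. of_real (std_normal_density v)) * conv_tilde g 0"
      by (rule integral_mult_left_zero)
    also have "(LINT v|lborel. complex_of_real (std_normal_density v)) = of_real (LINT v|lborel. std_normal_density v)"
      by (rule integral_complex_of_real)
    finally show ?thesis by simp
  qed
  finally have limit: "(\<lambda>n. complex_of_real (LINT \<xi>|lborel. exp (- (2 * pi * s n * \<xi>)\<^sup>2 / 2) * (cmod (inv_fourier g \<xi>))\<^sup>2)) \<longlonglongrightarrow> conv_tilde g 0"
    by (simp only: gaussian_regularisation(2)[OF g s(1)])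
  have "(\<lambda>n. LINT \<xi>|lborel. exp (- (2 * pi * s n * \<xi>)\<^sup>2 / 2) * (cmod (inv_fourier g \<xi>))\<^sup>2) \<longlonglongrightarrow> Re (conv_tilde g 0)"
    using tendsto_Re[OF limit] by simp
  then show "has_bochner_integral lborel (\<lambda>\<xi>. (cmod (inv_fourier g \<xi>))\<^sup>2) (Re (conv_tilde g 0))"
  proof (rule has_bochner_integral_monotone_convergence[rotated 3])
    show "integrable lborel (\<lambda>\<xi>. exp (- (2 * pi * s n * \<xi>)\<^sup>2 / 2) * (cmod (inv_fourier g \<xi>))\<^sup>2)" for n
      by (rule gaussian_regularisation(1)[OF g s(1)])
    show "AE \<xi> in lborel. mono (\<lambda>n. exp (- (2 * pi * s n * \<xi>)\<^sup>2 / 2) * (cmod (inv_fourier g \<xi>))\<^sup>2)"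
    proof (intro AE_I2 monoI mult_right_mono)
      fix \<xi> and m n :: nat assume "m \<le> n"
      then have "(s n)\<^sup>2 \<le> (s m)\<^sup>2" using s_antimono s(1) by (intro power_mono) (auto intro: less_imp_le)
      then have "(2 * pi * \<xi>)\<^sup>2 * (s n)\<^sup>2 \<le> (2 * pi * \<xi>)\<^sup>2 * (s m)\<^sup>2" by (intro mult_left_mono) auto
      then show "exp (- (2 * pi * s m * \<xi>)\<^sup>2 / 2) \<le> exp (- (2 * pi * s n * \<xi>)\<^sup>2 / 2)"
        by (simp add: power_mult_distrib mult_ac)
    qed simp
    show "AE \<xi> in lborel. (\<lambda>n. exp (- (2 * pi * s n * \<xi>)\<^sup>2 / 2) * (cmod (inv_fourier g \<xi>))\<^sup>2) \<longlonglongrightarrow> (cmod (inv_fourier g \<xi>))\<^sup>2"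
    proof (intro AE_I2)
      fix \<xi>
      have "(\<lambda>n. exp (- (2 * pi * s n * \<xi>)\<^sup>2 / 2) * (cmod (inv_fourier g \<xi>))\<^sup>2) \<longlonglongrightarrow> exp (- (2 * pi * 0 * \<xi>)\<^sup>2 / 2) * (cmod (inv_fourier g \<xi>))\<^sup>2"
        by (intro tendsto_intros s(2)) simp
      then show "(\<lambda>n. exp (- (2 * pi * s n * \<xi>)\<^sup>2 / 2) * (cmod (inv_fourier g \<xi>))\<^sup>2) \<longlonglongrightarrow> (cmod (inv_fourier g \<xi>))\<^sup>2"
        by simp
    qed
  qed measurable
  \<comment> \<open>At 0 the convolution is the integral of \<open>|g|^2\<close>, hence
    real.\<close>
  have "conv_tilde g 0 = (LINT t|lborel. of_real ((cmod (g t))\<^sup>2))"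
    by (simp only: conv_tilde_def complex_norm_square add_0_left)
  also have "\<dots> = of_real (LINT t|lborel. (cmod (g t))\<^sup>2)"
    by (rule integral_complex_of_real)
  finally show "of_real (Re (conv_tilde g 0)) = conv_tilde g 0" by simp
qed

lemma locally_finite_borel_lborel: "locally_finite_borel lborel"
  using emeasure_compact_finite unfolding locally_finite_borel_def by auto

lemma locally_finite_borel_return: "locally_finite_borel (return borel 0)"
  by (auto simp: locally_finite_borel_def compact_imp_closed borel_closed indicator_def)

text \<open>Integration against the Dirac measure evaluates \<open>conv_tilde g\<close> at 0, which
  turns the defining identity into Plancherel's.\<close>

theorem fourier_transform_dirac: "is_fourier_transform (return borel 0) lborel"
  unfolding is_fourier_transform_def
proof (intro conjI ballI locally_finite_borel_lborel)
  fix g assume g: "g \<in> Cc"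
  note meas = conv_tilde_measurable[OF g]
  note P = plancherel_Cc[OF g]
  show "integrable lborel (\<lambda>\<xi>. (cmod (inv_fourier g \<xi>))\<^sup>2)"
    using P(1) by (simp add: has_bochner_integral_iff)
  have "(LINT x|return borel 0. conv_tilde g x) = conv_tilde g 0"
    by (rule integral_return) (use meas in auto)
  moreover have "(LINT \<xi>|lborel. (cmod (inv_fourier g \<xi>))\<^sup>2) = Re (conv_tilde g 0)"
    using P(1) by (simp add: has_bochner_integral_iff)
  ultimately show "complex_of_real (LINT \<xi>|lborel. (cmod (inv_fourier g \<xi>))\<^sup>2) = (LINT x|return borel 0. conv_tilde g x)"
    using P(2) by simp
qed

section \<open>Autocorrelation of the primes\<close>

text \<open>The additive constant makes the estimate usable at every \<open>N\<close>, in particular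
  at the lower end of an interval, which may stay small while the length grows.\<close>

lemma chebyshev_psi_uniform:
  assumes "e > 0"
  obtains c where "\<And>N. \<bar>chebyshev_psi N - real N\<bar> \<le> e * real N + c"
proof -
  obtain N0 where N0: "\<And>N. N \<ge> N0 \<Longrightarrow> \<bar>chebyshev_psi N - real N\<bar> \<le> e * real N"
    using prime_number_theorem_psi[OF assms] by (auto simp: eventually_sequentially)
  show ?thesis
  proof (rule that[of "4 * real N0"])
    fix N
    show "\<bar>chebyshev_psi N - real N\<bar> \<le> e * real N + 4 * real N0"
    proof (cases "N \<ge> N0")
      case True
      then show ?thesis using N0[of N] by simp
    next
      case False
      then have "\<bar>chebyshev_psi N - real N\<bar> \<le> 4 * real N0"
        using chebyshev_psi_le[of N] chebyshev_psi_nonneg[of N] by simp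
      moreover have "e * real N \<ge> 0" using assms by simp
      ultimately show ?thesis by linarith
    qed
  qed
qed

text \<open>A proper prime power \<open>p ^ j \<le> n\<close> has \<open>p \<le> sqrt n\<close> and
  \<open>2 ^ j \<le> n\<close>, hence \<open>j \<le> 2 * ln n\<close> because
  \<open>ln 2 \<ge> 1 / 2\<close>. So there are few of them, and every other term of the sum belongs
  to a prime or is 0.\<close>

lemma sum_mangoldt_le_card_primes:
  "(\<Sum>k\<in>{m<..n}. mangoldt k) \<le> (real (card {p. prime p \<and> m < p \<and> p \<le> n}) + sqrt (real n) * (2 * ln (real n))) * ln (real n)"
proof (cases "n = 0")
  case False
  let ?P = "{p. prime p \<and> m < p \<and> p \<le> n}"
  let ?Q = "{k. primepow k \<and> \<not> prime k \<and> k \<le> n}"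
  let ?A = "{..nat \<lfloor>sqrt (real n)\<rfloor>} - {0}" and ?B = "{..nat \<lfloor>2 * ln (real n)\<rfloor>} - {0}"
  have ln_nonneg: "ln (real n) \<ge> 0" using False by simp
  have finite: "finite ?P" "finite ?Q"
    by (rule finite_subset[of _ "{..n}"]; force)+
  have "?Q \<subseteq> (\<lambda>(p, j). p ^ j) ` (?A \<times> ?B)"
  proof
    fix k assume k: "k \<in> ?Q"
    then obtain p j where pj: "prime p" "j > 0" "k = p ^ j" by (auto simp: primepow_def)
    have "j \<noteq> 1" using k pj by auto
    then have "j \<ge> 2" using pj by simp
    have p2: "p \<ge> 2" using pj prime_ge_2_nat by blast
    have "p ^ 2 \<le> p ^ j" using \<open>j \<ge> 2\<close> p2 by (intro power_increasing) auto
    also have pj_n: "p ^ j \<le> n" using k pj by simp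
    finally have "real (p ^ 2) \<le> real n" by (rule of_nat_mono)
    then have "real p \<le> sqrt (real n)" by (intro real_le_rsqrt) simp
    then have pA: "p \<in> ?A" using p2 by (simp add: le_nat_floor)
    have "2 ^ j \<le> p ^ j" using p2 by (intro power_mono) auto
    also note pj_n
    finally have "real (2 ^ j) \<le> real n" by (rule of_nat_mono)
    then have "ln (2 ^ j) \<le> ln (real n)" using False by (subst ln_le_cancel_iff) auto
    then have "real j * ln 2 \<le> ln (real n)" by (simp add: ln_realpow)
    moreover have "ln (2 :: real) \<ge> 1 / 2" using ln_le_minus_one[of "1 / 2 :: real"] by (simp add: ln_div)
    then have "real j * (1 / 2) \<le> real j * ln 2" by (intro mult_left_mono) auto
    ultimately have "real j \<le> 2 * ln (real n)" by linarith
    then have jB: "j \<in> ?B" using pj by (simp add: le_nat_floor)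
    show "k \<in> (\<lambda>(p, j). p ^ j) ` (?A \<times> ?B)" using pA jB pj by auto
  qed
  then have "card ?Q \<le> card (?A \<times> ?B)"
    by (rule surj_card_le[rotated]) auto
  also have "\<dots> = nat \<lfloor>sqrt (real n)\<rfloor> * nat \<lfloor>2 * ln (real n)\<rfloor>"
    by (simp add: card_cartesian_product card_Diff_singleton)
  finally have "real (card ?Q) \<le> real (nat \<lfloor>sqrt (real n)\<rfloor>) * real (nat \<lfloor>2 * ln (real n)\<rfloor>)"
    by (simp only: of_nat_mult[symmetric] of_nat_le_iff)
  also have "\<dots> \<le> sqrt (real n) * (2 * ln (real n))"
    using ln_nonneg by (intro mult_mono) auto
  finally have cardQ: "real (card ?Q) \<le> sqrt (real n) * (2 * ln (real n))" .
  have "(\<Sum>k\<in>{m<..n}. mangoldt k) = (\<Sum>k\<in>{k \<in> {m<..n}. primepow k}. mangoldt k :: real)"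
    by (intro sum.mono_neutral_right) (auto simp: mangoldt_def)
  also have "\<dots> \<le> (\<Sum>k\<in>?P \<union> ?Q. mangoldt k)"
    using finite by (intro sum_mono2) (auto simp: mangoldt_nonneg)
  also have "\<dots> \<le> (\<Sum>k\<in>?P \<union> ?Q. ln (real n))"
  proof (rule sum_mono)
    fix k assume "k \<in> ?P \<union> ?Q"
    then have k: "k > 0" "k \<le> n" by (auto intro: prime_gt_0_nat primepow_gt_0_nat)
    then have "mangoldt k \<le> ln (real k)" by (intro mangoldt_le)
    also have "\<dots> \<le> ln (real n)" using k by simp
    finally show "mangoldt k \<le> ln (real n)" .
  qed
  also have "\<dots> = real (card (?P \<union> ?Q)) * ln (real n)" by simp
  also have "\<dots> \<le> (real (card ?P) + sqrt (real n) * (2 * ln (real n))) * ln (real n)"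
  proof (intro mult_right_mono ln_nonneg)
    have "real (card (?P \<union> ?Q)) \<le> real (card ?P + card ?Q)"
      by (simp only: of_nat_le_iff) (rule card_Un_le)
    then show "real (card (?P \<union> ?Q)) \<le> real (card ?P) + sqrt (real n) * (2 * ln (real n))"
      using cardQ by simp
  qed
  finally show ?thesis .
qed simp

lemma many_primes:
  fixes D :: real
  assumes D: "D \<ge> 1"
  shows "\<forall>\<^sub>F L in at_top. \<forall>u v. 0 \<le> u \<longrightarrow> v \<le> D * L \<longrightarrow> v - u = L / 2 \<longrightarrow>
    real (card {p::nat. prime p \<and> u < real p \<and> real p \<le> v}) \<ge> 1 / 8 * (L / ln L)"
proof -
  \<comment> \<open>At arguments up to \<open>D * L\<close> a relative error of
    \<open>1 / (16 * D)\<close> means at most \<open>L / 16\<close> at each end. Of the length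
    \<open>L / 2\<close> there remain \<open>3 / 8 * L\<close>, up to constants.\<close>
  obtain c where c: "\<And>N. \<bar>chebyshev_psi N - real N\<bar> \<le> 1 / (16 * D) * real N + c"
    using chebyshev_psi_uniform[of "1 / (16 * D)"] D by auto
  define E where "E = (\<lambda>L. sqrt (D * L) * (2 * ln (D * L)))"
  define G where "G = (\<lambda>L. ((3 / 8 * L - 1 - 2 * c) / ln (D * L) - E L) / (L / ln L))"
  \<comment> \<open>For fixed \<open>D\<close>, \<open>ln (D * L)\<close> is asymptotic to
    \<open>ln L\<close>, and the term \<open>E\<close> for the prime powers is of lower order than
    \<open>L / ln L\<close>.\<close>
  have "(G \<longlongrightarrow> 3 / 8) at_top"
    unfolding G_def E_def using D by real_asymp
  then have "\<forall>\<^sub>F L in at_top. G L > 1 / 8" by (rule order_tendstoD(1)) simp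
  moreover have "\<forall>\<^sub>F L::real in at_top. L > 2" by (rule eventually_gt_at_top)
  ultimately show ?thesis
  proof eventually_elim
    case (elim L)
    show ?case
    proof (intro allI impI)
      fix u v assume uv: "0 \<le> u" "v \<le> D * L" "v - u = L / 2"
      define m n where "m = nat \<lfloor>u\<rfloor>" and "n = nat \<lfloor>v\<rfloor>"
      have v1: "v > 1" using uv elim by linarith
      have mn: "real m \<le> u" "u < real m + 1" "real n \<le> v" "v < real n + 1" "m \<le> n"
        using uv v1 elim by (auto simp: m_def n_def intro!: nat_mono floor_mono)
      have DL: "D * L > 2" using D elim(2) mult_right_mono[of 1 D L] by linarith
      have n1: "n \<ge> 1" using mn v1 by linarith
      have "1 / (16 * D) * real k \<le> L / 16" if "real k \<le> v" for k
      proof -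
        have "1 / (16 * D) * real k \<le> 1 / (16 * D) * (D * L)"
          using that uv D by (intro mult_left_mono) auto
        then show ?thesis using D by simp
      qed
      from this[of m] this[of n] have "\<bar>chebyshev_psi m - real m\<bar> \<le> L / 16 + c" "\<bar>chebyshev_psi n - real n\<bar> \<le> L / 16 + c"
        using c[of m] c[of n] mn uv elim by linarith+
      then have "3 / 8 * L - 1 - 2 * c \<le> chebyshev_psi n - chebyshev_psi m"
        using mn uv by linarith
      also have "\<dots> \<le> (real (card {p. prime p \<and> m < p \<and> p \<le> n}) + sqrt (real n) * (2 * ln (real n))) * ln (real n)"
        unfolding chebyshev_psi_diff[OF mn(5)] by (rule sum_mangoldt_le_card_primes)
      also have "\<dots> \<le> (real (card {p. prime p \<and> m < p \<and> p \<le> n}) + E L) * ln (D * L)"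
        unfolding E_def using n1 mn uv DL
        by (intro mult_mono add_mono real_sqrt_le_mono mult_nonneg_nonneg add_nonneg_nonneg) auto
      finally have "(3 / 8 * L - 1 - 2 * c) / ln (D * L) \<le> real (card {p. prime p \<and> m < p \<and> p \<le> n}) + E L"
        using DL by (subst pos_divide_le_eq) auto
      then have "(3 / 8 * L - 1 - 2 * c) / ln (D * L) - E L \<le> real (card {p. prime p \<and> m < p \<and> p \<le> n})"
        by linarith
      moreover have "1 / 8 * (L / ln L) < (3 / 8 * L - 1 - 2 * c) / ln (D * L) - E L"
      proof -
        have "L / ln L > 0" using elim by simp
        then show ?thesis using elim(1) unfolding G_def by (simp only: pos_less_divide_eq)
      qed
      moreover have "{p. prime p \<and> m < p \<and> p \<le> n} = {p::nat. prime p \<and> u < real p \<and> real p \<le> v}"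
      proof -
        have "m < p \<longleftrightarrow> u < real p" "p \<le> n \<longleftrightarrow> real p \<le> v" for p
          using mn by linarith+
        then show ?thesis by auto
      qed
      ultimately show "real (card {p::nat. prime p \<and> u < real p \<and> real p \<le> v}) \<ge> 1 / 8 * (L / ln L)"
        by simp
    qed
  qed
qed

section \<open>Primes and prime pairs in \<open>[a, b]\<close> as sets of integers\<close>

definition int_primes_in :: "real \<Rightarrow> real \<Rightarrow> int set" where
  "int_primes_in a b = {k. a \<le> real_of_int k \<and> real_of_int k \<le> b \<and> prime (nat \<bar>k\<bar>)}"

lemma int_primes_in_subset: "int_primes_in a b \<subseteq> {\<lceil>a\<rceil>..\<lfloor>b\<rfloor>}"
  by (auto simp: int_primes_in_def ceiling_le_iff le_floor_iff)

lemma finite_int_primes_in: "finite (int_primes_in a b)"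
  using int_primes_in_subset by (rule finite_subset) simp

lemma pm_primes_Int: "pm_primes \<inter> {a..b} = real_of_int ` int_primes_in a b"
proof (intro equalityI subsetI)
  fix x assume x: "x \<in> pm_primes \<inter> {a..b}"
  then obtain p :: nat where p: "prime p" "x = real_of_int (int p) \<or> x = real_of_int (- int p)"
    by (auto simp: pm_primes_def)
  have key: "x \<in> real_of_int ` int_primes_in a b" if "x = real_of_int k" "nat \<bar>k\<bar> = p" for k
  proof -
    have "prime (nat \<bar>k\<bar>)" using p(1) that(2) by (simp only:)
    then have "k \<in> int_primes_in a b" using x that(1) by (simp add: int_primes_in_def)
    then show ?thesis unfolding that(1) by (rule imageI)
  qed
  from p(2) show "x \<in> real_of_int ` int_primes_in a b"
  proof
    assume "x = real_of_int (int p)"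
    then show ?thesis by (rule key) simp
  next
    assume "x = real_of_int (- int p)"
    then show ?thesis by (rule key) simp
  qed
next
  fix x assume "x \<in> real_of_int ` int_primes_in a b"
  then obtain k where k: "x = real_of_int k" "k \<in> int_primes_in a b" by (rule imageE)
  have "real_of_int k = real (nat \<bar>k\<bar>) \<or> real_of_int k = - real (nat \<bar>k\<bar>)" by (cases "k \<ge> 0") auto
  moreover have "prime (nat \<bar>k\<bar>)" "x \<in> {a..b}" using k by (simp_all add: int_primes_in_def)
  ultimately show "x \<in> pm_primes \<inter> {a..b}"
    unfolding pm_primes_def k(1) by blast
qed

text \<open>The interval may contain 0, but one of its halves does not cross it: the right half if
  the midpoint is nonnegative, otherwise the left half, which is reflected. Its far end is at most
  \<open>(d + 1) * L\<close> from 0.\<close>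

lemma many_int_primes:
  fixes d :: real
  assumes d: "d > 0"
  shows "\<forall>\<^sub>F L in at_top. \<forall>a b. b - a = L \<longrightarrow> \<bar>a\<bar> < d * L \<longrightarrow>
    real (card (int_primes_in a b)) \<ge> 1 / 8 * (L / ln L)"
proof -
  have "\<forall>\<^sub>F L in at_top. \<forall>u v. 0 \<le> u \<longrightarrow> v \<le> (d + 1) * L \<longrightarrow> v - u = L / 2 \<longrightarrow>
      1 / 8 * (L / ln L) \<le> real (card {p::nat. prime p \<and> u < real p \<and> real p \<le> v})"
    by (rule many_primes) (use d in simp)
  moreover have "\<forall>\<^sub>F L::real in at_top. L > 0" by (rule eventually_gt_at_top)
  ultimately show ?thesis
  proof (rule eventually_elim2, intro allI impI)
    fix L a b :: real
    assume many: "\<forall>u v. 0 \<le> u \<longrightarrow> v \<le> (d + 1) * L \<longrightarrow> v - u = L / 2 \<longrightarrow>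
        1 / 8 * (L / ln L) \<le> real (card {p::nat. prime p \<and> u < real p \<and> real p \<le> v})"
      and L: "L > 0" and ab: "b - a = L" "\<bar>a\<bar> < d * L"
    let ?S = "\<lambda>u v. {p::nat. prime p \<and> u < real p \<and> real p \<le> v}"
    have dL: "(d + 1) * L = d * L + L" by (simp add: algebra_simps)
    show "1 / 8 * (L / ln L) \<le> real (card (int_primes_in a b))"
    proof (cases "a + b \<ge> 0")
      case True
      have "1 / 8 * (L / ln L) \<le> real (card (?S ((a + b) / 2) b))"
        using True ab by (intro many[rule_format]) (auto simp: dL field_simps)
      also have "card (?S ((a + b) / 2) b) \<le> card (int_primes_in a b)"
        using True ab L finite_int_primes_in
        by (intro card_inj_on_le[of int]) (auto simp: int_primes_in_def inj_on_def field_simps)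
      finally show ?thesis by simp
    next
      case False
      have "1 / 8 * (L / ln L) \<le> real (card (?S (- (a + b) / 2) (- a)))"
        using False ab L by (intro many[rule_format]) (auto simp: dL field_simps)
      also have "card (?S (- (a + b) / 2) (- a)) \<le> card (int_primes_in a b)"
        using False ab L finite_int_primes_in
        by (intro card_inj_on_le[of "\<lambda>p. - int p"]) (auto simp: int_primes_in_def inj_on_def field_simps)
      finally show ?thesis by simp
    qed
  qed
qed

lemma few_prime_pairs:
  fixes h :: int and e :: real
  assumes h: "h \<noteq> 0" and e: "e > 0"
  shows "\<forall>\<^sub>F L in at_top. \<forall>a b. b - a = L \<longrightarrow>
    real (card {k \<in> int_primes_in a b. k + h \<in> int_primes_in a b}) \<le> e * (L / ln L)"
proof -
  \<comment> \<open>An interval of length \<open>L\<close> may contain as many as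
    \<open>L + 1\<close> integers; the loss is at most a factor 2, hence the
    \<open>e / 2\<close>.\<close>
  have "filterlim (\<lambda>L::real. L + 1) at_top at_top" by real_asymp
  from eventually_compose_filterlim[OF card_prime_pairs_little_o[OF h, of "e / 2"] this] e
  have "\<forall>\<^sub>F L in at_top. \<forall>m l. real l \<le> L + 1 \<longrightarrow>
     real (card {n \<in> {m..<m + int l}. prime (nat \<bar>n\<bar>) \<and> prime (nat \<bar>n + h\<bar>)}) \<le> e / 2 * ((L + 1) / ln (L + 1))"
    by simp
  moreover have "\<forall>\<^sub>F L::real in at_top. L > 1" by (rule eventually_gt_at_top)
  ultimately show ?thesis
  proof eventually_elim
    case (elim L)
    show ?case
    proof (intro allI impI)
      fix a b assume ab: "b - a = L"
      define l where "l = nat (\<lfloor>b\<rfloor> - \<lceil>a\<rceil> + 1)"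
      let ?N = "{k \<in> int_primes_in a b. k + h \<in> int_primes_in a b}" and ?M = "{n \<in> {\<lceil>a\<rceil>..<\<lceil>a\<rceil> + int l}. prime (nat \<bar>n\<bar>) \<and> prime (nat \<bar>n + h\<bar>)}"
      have l: "real l \<le> L + 1" using ab elim(2) unfolding l_def by linarith
      have "?N \<subseteq> ?M"
        using int_primes_in_subset[of a b] by (auto simp: int_primes_in_def l_def)
      then have "card ?N \<le> card ?M"
        by (rule card_mono[rotated]) (rule finite_subset[of _ "{\<lceil>a\<rceil>..<\<lceil>a\<rceil> + int l}"]; auto)
      then have "real (card ?N) \<le> e / 2 * ((L + 1) / ln (L + 1))"
        using elim(1) l by (meson of_nat_le_iff order_trans)
      also have "(L + 1) / ln (L + 1) \<le> (2 * L) / ln L"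
        using elim(2) by (intro frac_le) auto
      finally show "real (card ?N) \<le> e * (L / ln L)"
        using e by simp
    qed
  qed
qed

lemma sum_card_swap:
  assumes "finite A" "finite B"
  shows "(\<Sum>x\<in>A. card {y \<in> B. R x y}) = (\<Sum>y\<in>B. card {x \<in> A. R x y})"
proof -
  have "(\<Sum>x\<in>A. card {y \<in> B. R x y}) = (\<Sum>x\<in>A. \<Sum>y\<in>B. if R x y then 1 else 0)"
    using assms by (simp add: sum.If_cases Int_def)
  also have "\<dots> = (\<Sum>y\<in>B. \<Sum>x\<in>A. if R x y then 1 else 0)" by (rule sum.swap)
  also have "\<dots> = (\<Sum>y\<in>B. card {x \<in> A. R x y})"
    using assms by (simp add: sum.If_cases Int_def)
  finally show ?thesis .
qed

text \<open>The diagonal contributes exactly \<open>f 0\<close>. Off the diagonal, the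
  \<open>j\<close> that matter for a given \<open>i\<close> correspond to shifts
  \<open>h = j - i\<close> of size at most \<open>r\<close>, and exchanging the order of summation
  counts the pairs shift by shift.\<close>

lemma gamma_fin_int_diff_le:
  fixes Z :: "int set" and r :: int
  assumes Z: "finite Z" "Z \<noteq> {}" and B: "\<And>x. cmod (f x) \<le> B"
    and supp: "\<And>x. \<bar>x\<bar> > real_of_int r \<Longrightarrow> f x = 0"
  shows "cmod (gamma_fin (real_of_int ` Z) f - f 0) \<le> B * (\<Sum>h\<in>{- r..r} - {0}. real (card {k \<in> Z. k + h \<in> Z})) / real (card Z)"
proof -
  let ?H = "{- r..r} - {0}"
  have inj: "inj_on real_of_int A" for A by (auto simp: inj_on_def)
  have cardZ: "real (card Z) > 0" using Z by (simp add: card_gt_0_iff)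
  have B0: "B \<ge> 0" using B[of 0] norm_ge_zero order_trans by blast
  have "(\<Sum>(x, y)\<in>real_of_int ` Z \<times> real_of_int ` Z. f (x - y)) = (\<Sum>i\<in>Z. \<Sum>j\<in>Z. f (real_of_int (i - j)))"
    by (simp add: sum.cartesian_product[symmetric] sum.reindex[OF inj])
  also have "\<dots> = (\<Sum>i\<in>Z. f 0 + (\<Sum>j\<in>Z - {i}. f (real_of_int (i - j))))"
  proof (rule sum.cong)
    fix i assume "i \<in> Z"
    from sum.remove[OF Z(1) this, of "\<lambda>j. f (real_of_int (i - j))"]
    show "(\<Sum>j\<in>Z. f (real_of_int (i - j))) = f 0 + (\<Sum>j\<in>Z - {i}. f (real_of_int (i - j)))"
      by (simp only: diff_self of_int_0)
  qed simp
  also have "\<dots> = of_nat (card Z) * f 0 + (\<Sum>i\<in>Z. \<Sum>j\<in>Z - {i}. f (real_of_int (i - j)))"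
    by (simp add: sum.distrib)
  finally have sum_eq: "(\<Sum>(x, y)\<in>real_of_int ` Z \<times> real_of_int ` Z. f (x - y))
      = of_nat (card Z) * f 0 + (\<Sum>i\<in>Z. \<Sum>j\<in>Z - {i}. f (real_of_int (i - j)))" .
  have "gamma_fin (real_of_int ` Z) f = 1 / of_nat (card Z) * (\<Sum>(x, y)\<in>real_of_int ` Z \<times> real_of_int ` Z. f (x - y))"
    unfolding gamma_fin_def card_image[OF inj] using Z(2) by simp
  moreover have "1 / c * (c * y + z) - y = z / c" if "c \<noteq> 0" for c y z :: complex
    using that by (simp add: distrib_left)
  moreover have "of_nat (card Z) \<noteq> (0 :: complex)" using cardZ by simp
  ultimately have "gamma_fin (real_of_int ` Z) f - f 0 = (\<Sum>i\<in>Z. \<Sum>j\<in>Z - {i}. f (real_of_int (i - j))) / of_nat (card Z)"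
    by (simp only: sum_eq)
  then have "cmod (gamma_fin (real_of_int ` Z) f - f 0) = cmod (\<Sum>i\<in>Z. \<Sum>j\<in>Z - {i}. f (real_of_int (i - j))) / real (card Z)"
    by (simp add: norm_divide)
  also have "\<dots> \<le> B * (\<Sum>h\<in>?H. real (card {k \<in> Z. k + h \<in> Z})) / real (card Z)"
  proof (rule divide_right_mono)
    have "cmod (\<Sum>i\<in>Z. \<Sum>j\<in>Z - {i}. f (real_of_int (i - j))) \<le> (\<Sum>i\<in>Z. B * real (card {h \<in> ?H. i + h \<in> Z}))"
    proof (rule sum_norm_le)
      fix i assume "i \<in> Z"
      have "(\<Sum>j\<in>Z - {i}. f (real_of_int (i - j))) = (\<Sum>j\<in>{j \<in> Z - {i}. \<bar>i - j\<bar> \<le> r}. f (real_of_int (i - j)))"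
        using Z(1) by (intro sum.mono_neutral_right) (auto intro!: supp simp flip: of_int_diff of_int_abs)
      also have "cmod \<dots> \<le> of_nat (card {j \<in> Z - {i}. \<bar>i - j\<bar> \<le> r}) * B"
        by (rule sum_norm_bound) (rule B)
      also have "card {j \<in> Z - {i}. \<bar>i - j\<bar> \<le> r} \<le> card {h \<in> ?H. i + h \<in> Z}"
        proof (rule card_inj_on_le[of "\<lambda>j. j - i"])
          show "finite {h \<in> ?H. i + h \<in> Z}" by (rule finite_subset[of _ ?H]) auto
        qed (auto simp: inj_on_def)
      finally show "cmod (\<Sum>j\<in>Z - {i}. f (real_of_int (i - j))) \<le> B * real (card {h \<in> ?H. i + h \<in> Z})"
        using B0 by (simp add: mult.commute mult_left_mono)
    qed
    also have "\<dots> = B * real (\<Sum>i\<in>Z. card {h \<in> ?H. i + h \<in> Z})"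
      by (simp add: sum_distrib_left)
    also have "(\<Sum>i\<in>Z. card {h \<in> ?H. i + h \<in> Z}) = (\<Sum>h\<in>?H. card {k \<in> Z. k + h \<in> Z})"
      using Z(1) by (intro sum_card_swap) auto
    finally show "cmod (\<Sum>i\<in>Z. \<Sum>j\<in>Z - {i}. f (real_of_int (i - j))) \<le> B * (\<Sum>h\<in>?H. real (card {k \<in> Z. k + h \<in> Z}))"
      by simp
  qed simp
  finally show ?thesis .
qed

lemma gamma_fin_primes_tendsto:
  fixes a b :: "nat \<Rightarrow> real" and d :: real
  assumes vanHove: "filterlim (\<lambda>n. b n - a n) at_top sequentially"
    and d: "d > 0" and d_bound: "\<And>n. \<bar>a n\<bar> < d * (b n - a n)" and f: "f \<in> Cc"
  shows "(\<lambda>n. gamma_fin (pm_primes \<inter> {a n..b n}) f) \<longlonglongrightarrow> f 0"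
proof (rule LIMSEQ_I)
  fix e :: real assume e: "e > 0"
  obtain B where B: "B \<ge> 0" "\<And>x. cmod (f x) \<le> B" using Cc_bounded[OF f] by blast
  obtain K where K: "compact K" "\<And>x. x \<notin> K \<Longrightarrow> f x = 0" using f by (auto simp: Cc_def)
  obtain R where R: "\<And>x. x \<in> K \<Longrightarrow> \<bar>x\<bar> \<le> R"
    using compact_imp_bounded[OF K(1)] by (auto simp: bounded_iff)
  define r where "r = max 0 \<lceil>R\<rceil>"
  have supp: "f x = 0" if "\<bar>x\<bar> > real_of_int r" for x
  proof -
    have "R \<le> real_of_int r" unfolding r_def by linarith
    then show ?thesis using that R[of x] K(2)[of x] by force
  qed
  let ?H = "{- r..r} - {0}"
  \<comment> \<open>The 8 is the reciprocal of the density constant in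
    \<open>many_int_primes\<close>; the summand 1 avoids division by 0 and makes the final estimate
    strict.\<close>
  define \<eta> where "\<eta> = e / (8 * (B * real (card ?H) + 1))"
  have den: "B * real (card ?H) + 1 > 0" using B(1) by (simp add: add_nonneg_pos)
  then have \<eta>: "\<eta> > 0" using e by (simp add: \<eta>_def)
  have "\<forall>\<^sub>F L in at_top. \<forall>h\<in>?H. \<forall>a b. b - a = L \<longrightarrow>
    real (card {k \<in> int_primes_in a b. k + h \<in> int_primes_in a b}) \<le> \<eta> * (L / ln L)"
    using few_prime_pairs \<eta> by (intro eventually_ball_finite) auto
  moreover have "\<forall>\<^sub>F L::real in at_top. L > 1" by (rule eventually_gt_at_top)
  ultimately have "\<forall>\<^sub>F L in at_top. \<forall>a b. b - a = L \<longrightarrow> \<bar>a\<bar> < d * L \<longrightarrow>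
    norm (gamma_fin (pm_primes \<inter> {a..b}) f - f 0) < e"
    using many_int_primes[OF d]
  proof eventually_elim
    case (elim L)
    show ?case
    proof (intro allI impI)
      fix a b assume ab: "b - a = L" "\<bar>a\<bar> < d * L"
      let ?Z = "int_primes_in a b" and ?q = "L / ln L"
      have q: "?q > 0" using elim(2) by simp
      have card: "1 / 8 * ?q \<le> real (card ?Z)" using elim(3) ab by blast
      then have "?Z \<noteq> {}" using q by auto
      then have "norm (gamma_fin (real_of_int ` ?Z) f - f 0) \<le> B * (\<Sum>h\<in>?H. real (card {k \<in> ?Z. k + h \<in> ?Z})) / real (card ?Z)"
        using finite_int_primes_in B(2) supp by (intro gamma_fin_int_diff_le) auto
      also have "\<dots> \<le> B * (\<Sum>h\<in>?H. \<eta> * ?q) / (1 / 8 * ?q)"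
      proof (rule frac_le)
        show "B * (\<Sum>h\<in>?H. real (card {k \<in> ?Z. k + h \<in> ?Z})) \<le> B * (\<Sum>h\<in>?H. \<eta> * ?q)"
          using elim(1) ab B(1) by (intro mult_left_mono sum_mono) auto
        show "0 \<le> B * (\<Sum>h\<in>?H. \<eta> * ?q)" using B(1) \<eta> q by (intro mult_nonneg_nonneg sum_nonneg) auto
      qed (use card q in auto)
      also have "\<dots> = B * real (card ?H) * (8 * \<eta>)"
      proof -
        have "x * (n * (\<eta> * y)) / (1 / 8 * y) = x * n * (8 * \<eta>)" if "y > 0" for x n y :: real
          using that by (simp add: field_simps)
        from this[OF q] show ?thesis by (simp only: sum_constant)
      qed
      also have "\<dots> < (B * real (card ?H) + 1) * (8 * \<eta>)"
        using \<eta> by (intro mult_strict_right_mono) auto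
      also have "\<dots> = e"
      proof -
        have "x * (8 * (e / (8 * x))) = e" if "x > 0" for x using that by simp
        from this[OF den] show ?thesis by (simp only: \<eta>_def)
      qed
      finally show "norm (gamma_fin (pm_primes \<inter> {a..b}) f - f 0) < e"
        by (simp only: pm_primes_Int)
    qed
  qed
  \<comment> \<open>The estimate is uniform over all intervals of length \<open>L\<close> with
    \<open>|a| < d * L\<close>, so only the lengths have to tend to infinity.\<close>
  from eventually_compose_filterlim[OF this vanHove]
  have "\<forall>\<^sub>F n in sequentially. norm (gamma_fin (pm_primes \<inter> {a n..b n}) f - f 0) < e"
    by eventually_elim (use d_bound in blast)
  then show "\<exists>no. \<forall>n\<ge>no. norm (gamma_fin (pm_primes \<inter> {a n..b n}) f - f 0) < e"
    by (simp add: eventually_sequentially)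
qed

theorem theorem5p13:
  fixes a b :: "nat \<Rightarrow> real" and d :: real
  assumes ab: "\<And>n. a n < b n"
    and vanHove: "filterlim (\<lambda>n. b n - a n) at_top sequentially"
    and d_pos: "d > 0"
    and d_bound: "\<And>n. \<bar>a n\<bar> < d * (b n - a n)"
  shows "counting_autocorrelation pm_primes (\<lambda>n. {a n..b n}) (return borel 0)
         \<and> is_fourier_transform (return borel 0) lborel"
proof
  have "(LINT x|return borel 0. f x) = f 0" if "f \<in> Cc" for f
    by (rule integral_return) (use Cc_measurable[OF that] in auto)
  then show "counting_autocorrelation pm_primes (\<lambda>n. {a n..b n}) (return borel 0)"
    using gamma_fin_primes_tendsto[OF vanHove d_pos d_bound]
    by (simp add: counting_autocorrelation_def locally_finite_borel_return)
  show "is_fourier_transform (return borel 0) lborel"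
    by (rule fourier_transform_dirac)
qed

end
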